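(* Let $K$ be an infinite field and $S=K[x_1,\dots,x_n]$ with the standard grading. Let $d\in\mathbb{N}$, $0\leq k\leq\binom{n+d-1}{d}$, and let $I\subset S$ be a graded ideal with $d$-linear resolution and $k$ generators (i.e. $\beta_{0,d}(I)=k$). Then $$\beta_{i,i+j}(I)\geq\beta_{i,i+j}(I(d,k))\quad\text{for all } i,j\in\mathbb{N}.$$
   Context: $\mathbb{N}=\{0,1,2,\dots\}$. $\beta_{i,i+j}(I)=\dim_K\operatorname{Tor}^S_i(I,K)_{i+j}$. A graded ideal $I$ has a $d$-linear resolution if $\beta_{i,i+j}(I)=0$ for all $i$ and all $j\neq d$. The order $>_{rlex}$ on monomials: $x^a>_{rlex}x^b$ if either $|a|>|b|$, or $|a|=|b|$ and there is an $r$ with $a_r<b_r$ and $a_s=b_s$ for $s>r$ (here $|a|=a_1+\dots+a_n$). For a monomial $x^a$ with $|a|=d$, the revlex-segment is $R(x^a)=\{x^b: |b|=d,\ x^b\geq_{rlex}x^a\}$. $I(d,k)$ is the ideal of $S$ generated by the revlex-segment $R(x^a)$ of degree $d$ with $|R(x^a)|=k$, i.e. by the $k$ largest monomials of degree $d$ with respect to $>_{rlex}$; for $k=0$ it is the zero ideal. *)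

theory Defs
  imports
    Complex_Main
    "HOL-Library.Poly_Mapping"
    "HOL-Library.Function_Algebras"
    "HOL-Algebra.Ideal"
begin

section \<open>The polynomial ring\<close>

text \<open>
  Monomials \<open>x\<^sup>a\<close> are identified with their exponent vectors, and \<open>K[x\<^sub>1,\<dots>,x\<^sub>n]\<close> is the subring of
  the polynomials over \<open>K\<close> that involve only the variables with indices \<open>0,\<dots>,n-1\<close>.
\<close>

type_synonym mon = "nat \<Rightarrow>\<^sub>0 nat"
type_synonym 'k mpol = "mon \<Rightarrow>\<^sub>0 'k"

definition mdeg :: "mon \<Rightarrow> nat" where
  "mdeg a = (\<Sum>r\<in>Poly_Mapping.keys a. Poly_Mapping.lookup a r)"

definition poly_ring :: "nat \<Rightarrow> 'k::field mpol ring" where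
  "poly_ring n = \<lparr>carrier = {p. \<forall>a\<in>Poly_Mapping.keys p. Poly_Mapping.keys a \<subseteq> {..<n}},
                  monoid.mult = (*), one = 1, zero = 0, add = (+)\<rparr>"

lemma cring_poly_ring: "cring (poly_ring n)"
proof (rule cringI)
  have m: "p * q \<in> carrier (poly_ring n)"
    if "p \<in> carrier (poly_ring n)" "q \<in> carrier (poly_ring n)" for p q :: "'k::field mpol"
  proof -
    have "Poly_Mapping.keys c \<subseteq> {..<n}" if "c \<in> Poly_Mapping.keys (p * q)" for c
    proof -
      obtain a b where "c = a + b" "a \<in> Poly_Mapping.keys p" "b \<in> Poly_Mapping.keys q"
        using \<open>c \<in> Poly_Mapping.keys (p * q)\<close> keys_mult[of p q] by blast
      then show ?thesis
        using \<open>p \<in> _\<close> \<open>q \<in> _\<close> keys_add[of a b] by (fastforce simp: poly_ring_def)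
    qed
    then show ?thesis by (simp add: poly_ring_def)
  qed
  have s: "p + q \<in> carrier (poly_ring n)"
    if "p \<in> carrier (poly_ring n)" "q \<in> carrier (poly_ring n)" for p q :: "'k::field mpol"
    using that keys_add[of p q] by (fastforce simp: poly_ring_def)
  have u: "- p \<in> carrier (poly_ring n)" if "p \<in> carrier (poly_ring n)" for p :: "'k::field mpol"
    using that by (auto simp: poly_ring_def)
  show "abelian_group (poly_ring n :: 'k::field mpol ring)"
  proof (rule abelian_groupI)
    fix p :: "'k mpol" assume p: "p \<in> carrier (poly_ring n)"
    show "\<exists>q\<in>carrier (poly_ring n). q \<oplus>\<^bsub>poly_ring n\<^esub> p = \<zero>\<^bsub>poly_ring n\<^esub>"
      using u[OF p] by (intro bexI[of _ "- p"]) (auto simp: poly_ring_def)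
  qed (use s in \<open>simp_all add: poly_ring_def algebra_simps\<close>)
  show "Group.comm_monoid (poly_ring n :: 'k::field mpol ring)"
    by (rule comm_monoidI) (use m in \<open>simp_all add: poly_ring_def algebra_simps\<close>)
qed (auto simp: poly_ring_def algebra_simps)

definition hom_component :: "nat \<Rightarrow> 'k::field mpol \<Rightarrow> 'k mpol" where
  "hom_component e p = (\<Sum>a\<in>{a\<in>Poly_Mapping.keys p. mdeg a = e}.
                        Poly_Mapping.single a (Poly_Mapping.lookup p a))"

definition graded_ideal :: "nat \<Rightarrow> 'k::field mpol set \<Rightarrow> bool" where
  "graded_ideal n I \<longleftrightarrow> ideal I (poly_ring n) \<and> (\<forall>p\<in>I. \<forall>e. hom_component e p \<in> I)"

section \<open>Graded free resolutions\<close>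

text \<open>
  The graded free module \<open>F\<^sub>i\<close> has a basis indexed by \<open>{..<rk F i}\<close>, whose \<open>b\<close>-th element has degree
  \<open>shift F i b\<close>.  The augmentation \<open>F\<^sub>0 \<rightarrow> I\<close> sends the \<open>b\<close>-th basis element to \<open>aug F b\<close>, and
  \<open>entry F i c b\<close> is the entry in row \<open>c\<close> and column \<open>b\<close> of the matrix of \<open>F\<^bsub>i+1\<^esub> \<rightarrow> F\<^sub>i\<close>.
  Basis elements in negative degrees are not needed for modules that live in degrees \<open>\<ge> 0\<close>.
\<close>

record (overloaded) 'k free_complex =
  rk :: "nat \<Rightarrow> nat"
  shift :: "nat \<Rightarrow> nat \<Rightarrow> nat"
  aug :: "nat \<Rightarrow> 'k mpol"
  entry :: "nat \<Rightarrow> nat \<Rightarrow> nat \<Rightarrow> 'k mpol"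

definition free_module :: "nat \<Rightarrow> nat \<Rightarrow> (nat \<Rightarrow> 'k::field mpol) set" where
  "free_module n r = {v. (\<forall>b<r. v b \<in> carrier (poly_ring n)) \<and> (\<forall>b\<ge>r. v b = 0)}"

definition aug_map :: "'k::field free_complex \<Rightarrow> (nat \<Rightarrow> 'k mpol) \<Rightarrow> 'k mpol" where
  "aug_map F v = (\<Sum>b<rk F 0. aug F b * v b)"

definition diff_map :: "'k::field free_complex \<Rightarrow> nat \<Rightarrow> (nat \<Rightarrow> 'k mpol) \<Rightarrow> nat \<Rightarrow> 'k mpol" where
  "diff_map F i v = (\<lambda>c. if c < rk F i then \<Sum>b<rk F (Suc i). entry F i c b * v b else 0)"

definition graded_free_resolution ::
    "nat \<Rightarrow> 'k::field mpol set \<Rightarrow> 'k free_complex \<Rightarrow> bool" where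
  "graded_free_resolution n I F \<longleftrightarrow>
     (\<forall>b<rk F 0. aug F b \<in> carrier (poly_ring n) \<and>
        (\<forall>a\<in>Poly_Mapping.keys (aug F b). mdeg a = shift F 0 b)) \<and>
     (\<forall>i. \<forall>b<rk F (Suc i). \<forall>c<rk F i. entry F i c b \<in> carrier (poly_ring n) \<and>
        (\<forall>a\<in>Poly_Mapping.keys (entry F i c b). mdeg a + shift F i c = shift F (Suc i) b)) \<and>
     aug_map F ` free_module n (rk F 0) = I \<and>
     {v \<in> free_module n (rk F 0). aug_map F v = 0} =
       diff_map F 0 ` free_module n (rk F (Suc 0)) \<and>
     (\<forall>i. {v \<in> free_module n (rk F (Suc i)). diff_map F i v = 0} =
       diff_map F (Suc i) ` free_module n (rk F (Suc (Suc i))))"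

section \<open>Graded Betti numbers\<close>

text \<open>
  As \<open>K = S/(x\<^sub>1,\<dots>,x\<^sub>n)\<close>, tensoring \<open>F\<close> with \<open>K\<close> over \<open>S\<close> turns \<open>F\<^sub>i\<close> into the \<open>K\<close>-vector space on the
  same basis and replaces every matrix entry by its constant term.  The set
  \<open>tensor_comp F i e\<close> is the component of \<open>F\<^sub>i \<otimes> K\<close> of degree \<open>e\<close>.
\<close>

definition tensor_comp :: "'k::field free_complex \<Rightarrow> nat \<Rightarrow> nat \<Rightarrow> (nat \<Rightarrow> 'k) set" where
  "tensor_comp F i e = {w. \<forall>b. w b \<noteq> 0 \<longrightarrow> b < rk F i \<and> shift F i b = e}"

definition tensor_diff :: "'k::field free_complex \<Rightarrow> nat \<Rightarrow> (nat \<Rightarrow> 'k) \<Rightarrow> nat \<Rightarrow> 'k" where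
  "tensor_diff F i w =
     (\<lambda>c. if c < rk F i
           then \<Sum>b<rk F (Suc i). Poly_Mapping.lookup (entry F i c b) 0 * w b
           else 0)"

fun tensor_cycles :: "'k::field free_complex \<Rightarrow> nat \<Rightarrow> nat \<Rightarrow> (nat \<Rightarrow> 'k) set" where
  "tensor_cycles F 0 e = tensor_comp F 0 e"
| "tensor_cycles F (Suc i) e = {w \<in> tensor_comp F (Suc i) e. tensor_diff F i w = 0}"

definition tensor_boundaries :: "'k::field free_complex \<Rightarrow> nat \<Rightarrow> nat \<Rightarrow> (nat \<Rightarrow> 'k) set" where
  "tensor_boundaries F i e = tensor_diff F i ` tensor_comp F (Suc i) e"

definition kscale :: "'k::field \<Rightarrow> (nat \<Rightarrow> 'k) \<Rightarrow> nat \<Rightarrow> 'k" where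
  "kscale c w = (\<lambda>b. c * w b)"

lemma vector_space_kscale: "vector_space kscale"
  by unfold_locales (auto simp: kscale_def algebra_simps)

text \<open>
  The dimension of the quotient of the (finite-dimensional) space of cycles by the space of boundaries.
\<close>

definition tor_dim :: "'k::field free_complex \<Rightarrow> nat \<Rightarrow> nat \<Rightarrow> nat" where
  "tor_dim F i e =
     vector_space.dim kscale (tensor_cycles F i e) - vector_space.dim kscale (tensor_boundaries F i e)"

text \<open>
  \<open>betti n I i e\<close> is the dimension over \<open>K\<close> of \<open>Tor\<^sub>i(I,K)\<^sub>e\<close> for a graded ideal \<open>I\<close>; the usual notation
  \<open>\<beta>\<^bsub>i,i+j\<^esub>(I)\<close> is \<open>betti n I i (i + j)\<close>.  As usual for derived functors, Tor is computed from some chosen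
  resolution; one with all \<open>F\<^sub>i\<close> of finite rank exists because \<open>S\<close> is Noetherian, and the
  dimension does not depend on the choice.
\<close>

definition betti :: "nat \<Rightarrow> 'k::field mpol set \<Rightarrow> nat \<Rightarrow> nat \<Rightarrow> nat" where
  "betti n I i e = tor_dim (SOME F. graded_free_resolution n I F) i e"

definition linear_resolution :: "nat \<Rightarrow> nat \<Rightarrow> 'k::field mpol set \<Rightarrow> bool" where
  "linear_resolution n d I \<longleftrightarrow> (\<forall>i j. j \<noteq> d \<longrightarrow> betti n I i (i + j) = 0)"

section \<open>Revlex-segments\<close>

definition rlex_greater :: "mon \<Rightarrow> mon \<Rightarrow> bool" where
  "rlex_greater a b \<longleftrightarrow> mdeg a > mdeg b \<or>
     (mdeg a = mdeg b \<and>
        (\<exists>r. Poly_Mapping.lookup a r < Poly_Mapping.lookup b r \<and>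
          (\<forall>s>r. Poly_Mapping.lookup a s = Poly_Mapping.lookup b s)))"

definition monomials :: "nat \<Rightarrow> nat \<Rightarrow> mon set" where
  "monomials n d = {a. Poly_Mapping.keys a \<subseteq> {..<n} \<and> mdeg a = d}"

definition revlex_segment :: "nat \<Rightarrow> mon \<Rightarrow> mon set" where
  "revlex_segment n a = {b \<in> monomials n (mdeg a). rlex_greater b a \<or> b = a}"

text \<open>
  For \<open>1 \<le> k \<le> (n + d - 1 choose d)\<close> exactly one \<open>a\<close> contributes to the union; for \<open>k = 0\<close> none does,
  and the ideal is zero.
\<close>

definition revlex_ideal :: "nat \<Rightarrow> nat \<Rightarrow> nat \<Rightarrow> 'k::field mpol set" where
  "revlex_ideal n d k =
     Idl\<^bsub>poly_ring n\<^esub> ((\<lambda>b. Poly_Mapping.single b 1) `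
       (\<Union>a \<in> {a \<in> monomials n d. card (revlex_segment n a) = k}. revlex_segment n a))"

end

theory Submission
  imports Defs
begin

text \<open>
  Computing Tor from the other factor, the Betti numbers of a graded ideal \<open>I\<close> are the dimensions of the
  Koszul homology of \<open>I\<close>; for an ideal with a \<open>d\<close>-linear resolution they are therefore determined by the
  Hilbert function.  Such an ideal is \<open>d\<close>-regular, and over an infinite field a generic linear form is
  a nonzerodivisor on \<open>S/I\<close> in degrees \<open>\<ge> d\<close> and preserves \<open>d\<close>-regularity of the quotient.  Cutting down
  by \<open>n\<close> such forms, which may be taken triangular, expresses the Betti numbers as combinations, with
  coefficients \<open>(m choose i) - (m-1 choose i)\<close>, of the dimensions of \<open>S/(I, l\<^sub>1, \<dots>, l\<^sub>t)\<close> in degree \<open>d\<close>.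
  The revlex-segment ideal is stable, so that it also has a \<open>d\<close>-linear resolution and the last
  variables serve as generic forms.  It minimizes all these dimensions at once, since every monomial in
  the first \<open>r\<close> variables precedes all monomials involving another variable.
\<close>

section \<open>Linear algebra\<close>

text \<open>\<open>betti\<close> refers to a resolution picked by \<open>SOME\<close>, so it yields
  nothing until Tor is seen to be balanced: a resolution is constructed, and the double complex
  formed with the Koszul complex is compared with both of its edges. Signs decide the inequality.
  After summation by parts the difference of two Betti numbers depends on the dimensions in the
  single degree d after each cut; the uncut term agrees for both ideals, since both have k
  generators, and all others enter with one sign. What needs the triangular forms is a bound for an
  arbitrary ideal: after t cuts every residue class is represented in n - t variables, so the next
  form enlarges the ideal in degree d by at most the number of monomials of degree d - 1 in them.
  The minimum of this bound and the dimension of all forms is attained by the revlex ideal. The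
  field must be infinite because a pencil of linear forms has finitely many bad members, and one
  outside them is chosen.\<close>

definition fin_dim :: "('k::field \<Rightarrow> 'b::ab_group_add \<Rightarrow> 'b) \<Rightarrow> 'b set \<Rightarrow> bool" where
  "fin_dim s A \<longleftrightarrow> (\<exists>W. finite W \<and> A \<subseteq> module.span s W)"

lemma fin_dim_mono: "fin_dim s A \<Longrightarrow> B \<subseteq> A \<Longrightarrow> fin_dim s B"
  by (auto simp: fin_dim_def)

locale vec = vector_space s for s :: "'k::field \<Rightarrow> 'b::ab_group_add \<Rightarrow> 'b"
begin
lemma fin_dim_finite_independent:
  assumes "fin_dim s A" "independent B" "B \<subseteq> A"
  shows "finite B" "card B \<le> dim A"
proof -
  obtain W where W: "finite W" "A \<subseteq> span W" using assms(1) by (auto simp: fin_dim_def)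
  have B: "finite B" if "independent B" "B \<subseteq> A" for B
    using independent_span_bound[of W B] W that by auto
  show "finite B" using B assms by auto
  obtain C where C: "C \<subseteq> A" "independent C" "A \<subseteq> span C" "card C = dim A"
    using basis_exists by metis
  then show "card B \<le> dim A"
    using independent_span_bound[of C B] B[of C] assms by auto
qed

lemma fin_dim_basis:
  assumes "fin_dim s A" "subspace A"
  obtains B where "B \<subseteq> A" "independent B" "span B = A" "card B = dim A" "finite B"
proof -
  obtain C where C: "C \<subseteq> A" "independent C" "A \<subseteq> span C" "card C = dim A"
    using basis_exists by metis
  moreover have "span C \<subseteq> A" using C(1) assms(2) span_minimal by blast
  ultimately show ?thesis using that fin_dim_finite_independent[OF assms(1)] by blast
qed

lemma dim_mono_fin: "fin_dim s A \<Longrightarrow> B \<subseteq> A \<Longrightarrow> dim B \<le> dim A"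
  by (metis basis_exists fin_dim_finite_independent(2) order_trans)

lemma dim_0 [simp]: "dim {0} = 0" "dim {} = 0"
  using dim_le_card[of "{0}" "{}"] dim_le_card[of "{}" "{}"] by auto

lemma fin_dim_0 [simp]: "fin_dim s {0}"
  by (auto simp: fin_dim_def intro!: exI[of _ "{}"])

lemma dim_eq_imp_eq:
  assumes "fin_dim s A" "subspace A" "subspace B" "B \<subseteq> A" "dim A \<le> dim B"
  shows "A = B"
proof -
  obtain C where C: "C \<subseteq> B" "independent C" "span C = B" "card C = dim B" "finite C"
    using fin_dim_basis assms fin_dim_mono by metis
  have "x \<in> span C" if "x \<in> A" for x
  proof (rule ccontr)
    assume x: "x \<notin> span C"
    then have "independent (insert x C)" using C independent_insertI by blast
    then have "card (insert x C) \<le> dim A"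
      using fin_dim_finite_independent[OF assms(1)] C that assms(4) by blast
    moreover have "x \<notin> C" using x span_base by blast
    ultimately show False using C assms(5) by simp
  qed
  then show ?thesis using C assms by blast
qed

end

section \<open>Comparing dimensions of quotients along a linear relation\<close>

locale vec_pair = vs1: vec s1 + vs2: vec s2
  for s1 :: "'k::field \<Rightarrow> 'b::ab_group_add \<Rightarrow> 'b" and s2 :: "'k \<Rightarrow> 'c::ab_group_add \<Rightarrow> 'c"
begin

definition linear_rel :: "('b \<Rightarrow> 'c \<Rightarrow> bool) \<Rightarrow> bool" where
  "linear_rel R \<longleftrightarrow> R 0 0 \<and> (\<forall>x y x' y'. R x x' \<longrightarrow> R y y' \<longrightarrow> R (x + y) (x' + y')) \<and>
     (\<forall>c x x'. R x x' \<longrightarrow> R (s1 c x) (s2 c x'))"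

text \<open>A linear relation that is total on A and injective modulo B and B' bounds dim A/B by dim
  A'/B': partners of the basis vectors of A outside B are independent modulo B'. Sums replace
  differences to avoid truncated subtraction.\<close>

lemma quot_dim_rel_le:
  assumes sub: "vs1.subspace B" "vs2.subspace B'" "vs1.subspace A" "vs2.subspace A'"
    and fin: "fin_dim s1 A" "fin_dim s2 A'"
    and le: "B \<subseteq> A" "B' \<subseteq> A'"
    and R: "linear_rel R"
    and ex: "\<And>a. a \<in> A \<Longrightarrow> \<exists>a'\<in>A'. R a a'"
    and iff: "\<And>a a'. a \<in> A \<Longrightarrow> a' \<in> A' \<Longrightarrow> R a a' \<Longrightarrow> a' \<in> B' \<Longrightarrow> a \<in> B"
  shows "vs1.dim A + vs2.dim B' \<le> vs2.dim A' + vs1.dim B"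
proof -
  obtain bB where bB: "bB \<subseteq> B" "vs1.independent bB" "vs1.span bB = B" "card bB = vs1.dim B" "finite bB"
    using vs1.fin_dim_basis[OF fin_dim_mono[OF fin(1) le(1)] sub(1)] by blast
  obtain bB' where bB': "bB' \<subseteq> B'" "vs2.independent bB'" "vs2.span bB' = B'"
      "card bB' = vs2.dim B'" "finite bB'"
    using vs2.fin_dim_basis[OF fin_dim_mono[OF fin(2) le(2)] sub(2)] by blast
  obtain bA where bA: "bB \<subseteq> bA" "bA \<subseteq> A" "vs1.independent bA" "A \<subseteq> vs1.span bA"
    using vs1.maximal_independent_subset_extend[of bB A] bB le by blast
  have finA: "finite bA" using vs1.fin_dim_finite_independent[OF fin(1) bA(3,2)] by blast
  have cA: "card bA = vs1.dim A" using vs1.basis_card_eq_dim bA by metis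
  define C where "C = bA - bB"
  have cC: "card C + vs1.dim B = vs1.dim A"
    using cA bB(4,5) bA(1) card_mono[OF finA bA(1)] unfolding C_def by (simp add: card_Diff_subset)
  have CA0: "C \<subseteq> A" "C \<inter> bB = {}" "C \<subseteq> bA" using bA(2) unfolding C_def by auto
  obtain g where g: "\<And>c. c \<in> C \<Longrightarrow> g c \<in> A' \<and> R c (g c)"
    using ex bA(2) unfolding C_def by (metis DiffD1 subsetD)
  have R0: "R 0 0" and Radd: "\<And>x y x' y'. R x x' \<Longrightarrow> R y y' \<Longrightarrow> R (x + y) (x' + y')"
    and Rscale: "\<And>c x x'. R x x' \<Longrightarrow> R (s1 c x) (s2 c x')"
    using R by (auto simp: linear_rel_def)
  have Rdiff: "R (x - y) (x' - y')" if "R x x'" "R y y'" for x y x' y'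
    using Radd[OF that(1) Rscale[OF that(2), of "-1"]]
    by (simp only: vs1.scale_minus_left vs1.scale_one vs2.scale_minus_left vs2.scale_one add_uminus_conv_diff)
  have dcl: "a - (a + b) = - b" for a b :: 'c by simp
  have "finite C0 \<Longrightarrow> C0 \<subseteq> C \<Longrightarrow> vs2.independent (g ` C0 \<union> bB') \<and>
      card (g ` C0 \<union> bB') = card C0 + card bB'" for C0
  proof (induction C0 rule: finite_induct)
    case empty
    then show ?case using bB' by simp
  next
    case (insert c C0)
    let ?S = "g ` C0 \<union> bB'"
    \<comment> \<open>Up to B', every vector spanned so far is a partner of some combination of C0.
      This takes the place of linearity of g, which is an arbitrary choice of partners.\<close>
    have *: "\<exists>x\<in>vs1.span C0. \<exists>b\<in>B'. R x (y + b)" if "y \<in> vs2.span ?S" for y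
      using that
    proof (induction rule: vs2.span_induct_alt)
      case base
      show ?case using R0 vs1.span_zero vs2.subspace_0[OF sub(2)] by force
    next
      case (step r z y)
      obtain x b where x: "x \<in> vs1.span C0" "b \<in> B'" "R x (y + b)" using step(2) by blast
      show ?case
      proof (cases "z \<in> bB'")
        case True
        have "z \<in> B'" using True bB' by blast
        then have "b - s2 r z \<in> B'"
          using x(2) sub(2) by (simp add: vs2.subspace_diff vs2.subspace_scale)
        moreover have "s2 r z + y + (b - s2 r z) = y + b" by simp
        then have "R x (s2 r z + y + (b - s2 r z))" using x(3) by (simp only:)
        ultimately show ?thesis using x(1) by blast
      next
        case False
        then obtain c' where c': "c' \<in> C0" "z = g c'" using step(1) by blast
        have "R (s1 r c' + x) (s2 r z + y + b)"
          unfolding add.assoc[of "s2 r z"]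
          using Radd[OF Rscale[of c' "g c'" r] x(3)] c' g insert.prems by blast
        moreover have "s1 r c' + x \<in> vs1.span C0"
          using c' x by (simp add: vs1.span_add vs1.span_base vs1.span_scale)
        ultimately show ?thesis using x(2) by blast
      qed
    qed
    have cC: "c \<in> C" "C0 \<subseteq> C" using insert.prems by simp_all
    \<comment> \<open>Otherwise subtracting the relation for x from that for c would relate c - x to
      an element of B', so c - x would lie in B and c in the span of the other basis
      vectors.\<close>
    have "g c \<notin> vs2.span ?S"
    proof
      assume gc: "g c \<in> vs2.span ?S"
      from *[OF gc] obtain x b where x: "x \<in> vs1.span C0" "b \<in> B'" "R x (g c + b)" by blast
      have Rn: "R (c - x) (- b)"
      proof -
        have "R c (g c)" using g[OF cC(1)] by blast
        from Rdiff[OF this x(3)] show ?thesis unfolding dcl .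
      qed
      have negb: "- b \<in> B'" by (rule vs2.subspace_neg[OF sub(2) x(2)])
      have cbA: "c \<in> bA" by (rule DiffD1[OF cC(1)[unfolded C_def]])
      note CA = CA0
      have "C0 \<subseteq> A" using cC(2) CA(1) by (rule subset_trans)
      then have xA: "x \<in> A" using vs1.span_minimal[OF _ sub(3)] x(1) by blast
      have cA: "c \<in> A" using cC(1) CA(1) by blast
      have "c - x \<in> A" by (rule vs1.subspace_diff[OF sub(3) cA xA])
      then have "c - x \<in> B" using iff[OF _ _ Rn negb] le(2) negb by blast
      moreover have "bB \<subseteq> bA - {c}" using bA(1) CA(2) cC(1) by blast
      ultimately have 1: "c - x \<in> vs1.span (bA - {c})"
        using bB(3) vs1.span_mono by blast
      have "C0 \<subseteq> bA - {c}" using cC(2) CA(3) insert(2) by blast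
      then have 2: "x \<in> vs1.span (bA - {c})"
        using x(1) vs1.span_mono by blast
      have "c \<in> vs1.span (bA - {c})" using vs1.span_add[OF 1 2] by simp
      then show False using bA(3) cbA unfolding vs1.dependent_def by blast
    qed
    note ind = vs2.independent_insertI[OF this]
    have ni: "g c \<notin> ?S" using \<open>g c \<notin> vs2.span ?S\<close> vs2.span_base[of "g c" ?S] by blast
    have IH: "vs2.independent ?S" "card ?S = card C0 + card bB'" using insert.IH cC(2) by auto
    have "finite ?S" using insert.hyps bB'(5) by simp
    then have "card (insert (g c) ?S) = Suc (card C0 + card bB')" using ni IH(2) by simp
    then show ?case using insert.hyps ind[OF IH(1)] by simp
  qed
  moreover have "finite C" using finA by (simp add: C_def)
  ultimately have "vs2.independent (g ` C \<union> bB')" "card (g ` C \<union> bB') = card C + card bB'"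
    by blast+
  moreover have "g ` C \<union> bB' \<subseteq> A'" using g bB'(1) le(2) by blast
  ultimately have "card C + card bB' \<le> vs2.dim A'"
    using vs2.fin_dim_finite_independent(2)[OF fin(2), of "g ` C \<union> bB'"] by simp
  then show ?thesis using cC bB'(4) by simp
qed

end

text \<open>
  An isomorphism \<open>A/B \<rightarrow> A'/B'\<close> given by a linear relation: connecting homomorphisms arise in this form,
  and no lifts have to be chosen.
\<close>

lemma quot_dim_rel:
  fixes s1 :: "'k::field \<Rightarrow> 'b::ab_group_add \<Rightarrow> 'b" and s2 :: "'k \<Rightarrow> 'c::ab_group_add \<Rightarrow> 'c"
  assumes vs: "vector_space s1" "vector_space s2"
    and sub: "module.subspace s1 B" "module.subspace s2 B'" "module.subspace s1 A" "module.subspace s2 A'"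
    and fin: "fin_dim s1 A" "fin_dim s2 A'"
    and le: "B \<subseteq> A" "B' \<subseteq> A'"
    and R0: "R 0 0" and Radd: "\<And>x y x' y'. R x x' \<Longrightarrow> R y y' \<Longrightarrow> R (x + y) (x' + y')"
    and Rscale: "\<And>c x x'. R x x' \<Longrightarrow> R (s1 c x) (s2 c x')"
    and ex: "\<And>a. a \<in> A \<Longrightarrow> \<exists>a'\<in>A'. R a a'"
    and ex': "\<And>a'. a' \<in> A' \<Longrightarrow> \<exists>a\<in>A. R a a'"
    and iff: "\<And>a a'. a \<in> A \<Longrightarrow> a' \<in> A' \<Longrightarrow> R a a' \<Longrightarrow> a \<in> B \<longleftrightarrow> a' \<in> B'"
  shows "vector_space.dim s1 A + vector_space.dim s2 B' = vector_space.dim s2 A' + vector_space.dim s1 B"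
proof -
  interpret p: vec_pair s1 s2 using vs by (simp add: vec_pair_def vec_def)
  interpret q: vec_pair s2 s1 using vs by (simp add: vec_pair_def vec_def)
  have 1: "p.linear_rel R" using R0 Radd Rscale by (auto simp: p.linear_rel_def)
  have 2: "q.linear_rel (\<lambda>x y. R y x)" using R0 Radd Rscale by (auto simp: q.linear_rel_def)
  have "vector_space.dim s1 A + vector_space.dim s2 B' \<le> vector_space.dim s2 A' + vector_space.dim s1 B"
    by (rule p.quot_dim_rel_le[OF sub fin le 1 ex]) (use iff in auto)
  moreover have "vector_space.dim s2 A' + vector_space.dim s1 B \<le> vector_space.dim s1 A + vector_space.dim s2 B'"
    by (rule q.quot_dim_rel_le[OF sub(2,1,4,3) fin(2,1) le(2,1) 2 ex']) (use iff in auto)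
  ultimately show ?thesis by simp
qed

text \<open>The graph of \<open>f\<close> is a relation between A modulo the kernel and the image
  modulo 0, so \<open>quot_dim_rel\<close> applies.\<close>

lemma rank_nullity:
  fixes s1 :: "'k::field \<Rightarrow> 'b::ab_group_add \<Rightarrow> 'b" and s2 :: "'k \<Rightarrow> 'c::ab_group_add \<Rightarrow> 'c"
  assumes f: "Vector_Spaces.linear s1 s2 f" and sub: "module.subspace s1 A" and fin: "fin_dim s1 A"
  shows "vector_space.dim s1 A = vector_space.dim s2 (f ` A) + vector_space.dim s1 {a \<in> A. f a = 0}"
    and "fin_dim s2 (f ` A)"
proof -
  interpret Vector_Spaces.linear s1 s2 f by fact
  interpret p: vector_space_pair s1 s2 ..
  obtain W where W: "finite W" "A \<subseteq> vs1.span W" using fin by (auto simp: fin_dim_def)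
  then have "f ` A \<subseteq> vs2.span (f ` W)" using p.linear_span_image[OF f] by blast
  then show 2: "fin_dim s2 (f ` A)" using W(1) by (auto simp: fin_dim_def)
  interpret vec_pair s1 s2 by (simp add: vec_pair_def vec_def vs1.vector_space_axioms vs2.vector_space_axioms)
  have 3: "vs1.subspace {a \<in> A. f a = 0}"
    using sub by (auto simp: vs1.subspace_def add scale)
  have "vs1.dim A + vs2.dim {0} = vs2.dim (f ` A) + vs1.dim {a \<in> A. f a = 0}"
    by (rule quot_dim_rel[where R="\<lambda>a b. b = f a"])
       (use f 2 3 sub fin in \<open>auto simp: add scale vs1.vector_space_axioms vs2.vector_space_axioms
          p.linear_subspace_image[OF f] vs2.subspace_single_0 vs1.subspace_0
          intro!: image_eqI[of _ _ 0]\<close>)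
  then show "vs1.dim A = vs2.dim (f ` A) + vs1.dim {a \<in> A. f a = 0}" by simp
qed

definition fscale :: "('k \<Rightarrow> 'b \<Rightarrow> 'b) \<Rightarrow> 'k \<Rightarrow> ('x \<Rightarrow> 'b) \<Rightarrow> 'x \<Rightarrow> 'b" where
  "fscale s c f = (\<lambda>x. s c (f x))"

lemma vector_space_fscale: "vector_space s \<Longrightarrow> vector_space (fscale s)"
  by (auto simp: vector_space_def fscale_def fun_eq_iff)

text \<open>A direct power of W indexed by X, encoded by total functions vanishing off X; Koszul
  chains take this shape with X the subsets of a given size.\<close>

definition fun_space :: "'x set \<Rightarrow> 'b::zero set \<Rightarrow> ('x \<Rightarrow> 'b) set" where
  "fun_space X W = {f. (\<forall>x. f x \<in> W) \<and> (\<forall>x. f x \<noteq> 0 \<longrightarrow> x \<in> X)}"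

lemma subspace_fun_space:
  assumes "vector_space s" "module.subspace s W"
  shows "module.subspace (fscale s) (fun_space X W)"
proof -
  interpret vector_space s by fact
  interpret f: vector_space "fscale s" using assms(1) by (rule vector_space_fscale)
  have "f + g \<in> fun_space X W" if "f \<in> fun_space X W" "g \<in> fun_space X W" for f g
  proof -
    have "f x + g x \<in> W" for x using that by (auto simp: fun_space_def intro: subspace_add[OF assms(2)])
    moreover have "x \<in> X" if "f x + g x \<noteq> 0" for x
      using that \<open>f \<in> _\<close> \<open>g \<in> _\<close> by (cases "f x = 0") (auto simp: fun_space_def)
    ultimately show ?thesis by (simp add: fun_space_def)
  qed
  moreover have "0 \<in> fun_space X W" using subspace_0[OF assms(2)] by (simp add: fun_space_def)
  moreover have "fscale s c f \<in> fun_space X W" if f: "f \<in> fun_space X W" for c f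
  proof -
    have "s c (f x) \<in> W" for x using f by (intro subspace_scale[OF assms(2)]) (simp add: fun_space_def)
    then show ?thesis using f by (simp add: fun_space_def fscale_def)
  qed
  ultimately show ?thesis unfolding f.subspace_def by blast
qed

text \<open>Evaluation at a new point maps onto W with kernel the functions on the old points, so
  each point contributes dim W.\<close>

lemma fun_space_dim:
  fixes s :: "'k::field \<Rightarrow> 'b::ab_group_add \<Rightarrow> 'b"
  assumes s: "vector_space s" and W: "module.subspace s W" "fin_dim s W" and X: "finite X"
  shows "fin_dim (fscale s) (fun_space X W) \<and>
         vector_space.dim (fscale s) (fun_space X W) = card X * vector_space.dim s W"
  using X
proof (induction X rule: finite_induct)
  interpret vec s using s by (simp add: vec_def)
  interpret f: vec "fscale s" using vector_space_fscale[OF s] by (simp add: vec_def)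
  case empty
  have "fun_space {} W = {0 :: 'a \<Rightarrow> 'b}" using subspace_0[OF W(1)] by (auto simp: fun_space_def)
  then show ?case by (simp add: f.fin_dim_0)
next
  interpret vec s using s by (simp add: vec_def)
  interpret f: vec "fscale s" using vector_space_fscale[OF s] by (simp add: vec_def)
  case (insert x X)
  obtain B where B: "B \<subseteq> W" "finite B" "span B = W" using fin_dim_basis[OF W(2,1)] by metis
  obtain C where C: "finite C" "fun_space X W \<subseteq> f.span C" using insert by (auto simp: fin_dim_def)
  define \<iota> where "\<iota> w = (\<lambda>y. if y = x then w else 0)" for w :: 'b
  interpret vp: vector_space_pair s "fscale s" ..
  have lin\<iota>: "Vector_Spaces.linear s (fscale s) \<iota>"
    by (auto simp: Vector_Spaces.linear_iff s f.vector_space_axioms \<iota>_def fscale_def fun_eq_iff)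
  define ev where "ev f = f x" for f :: "'a \<Rightarrow> 'b"
  have linev: "Vector_Spaces.linear (fscale s) s ev"
    by (auto simp: Vector_Spaces.linear_iff s f.vector_space_axioms ev_def fscale_def)
  have "g \<in> f.span (C \<union> \<iota> ` B)" if g: "g \<in> fun_space (insert x X) W" for g
  proof -
    have "g - \<iota> (g x) \<in> fun_space X W"
      using g insert.hyps subspace_0[OF W(1)] by (auto simp: fun_space_def \<iota>_def)
    then have 1: "g - \<iota> (g x) \<in> f.span (C \<union> \<iota> ` B)" using C f.span_mono[of C "C \<union> \<iota> ` B"] by blast
    have "g x \<in> span B" using g B by (simp add: fun_space_def)
    then have "\<iota> (g x) \<in> f.span (\<iota> ` B)" using vp.linear_span_image[OF lin\<iota>] by blast
    then have "\<iota> (g x) \<in> f.span (C \<union> \<iota> ` B)" using f.span_mono[of "\<iota> ` B" "C \<union> \<iota> ` B"] by blast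
    from f.span_add[OF 1 this] show ?thesis by simp
  qed
  then have fd: "fin_dim (fscale s) (fun_space (insert x X) W)"
    unfolding fin_dim_def using C(1) B(2) by (intro exI[of _ "C \<union> \<iota> ` B"]) auto
  have im: "ev ` fun_space (insert x X) W = W"
  proof
    show "ev ` fun_space (insert x X) W \<subseteq> W" by (auto simp: ev_def fun_space_def)
    show "W \<subseteq> ev ` fun_space (insert x X) W"
    proof
      fix w assume "w \<in> W"
      then have "\<iota> w \<in> fun_space (insert x X) W"
        using subspace_0[OF W(1)] by (auto simp: fun_space_def \<iota>_def)
      moreover have "ev (\<iota> w) = w" by (simp add: ev_def \<iota>_def)
      ultimately show "w \<in> ev ` fun_space (insert x X) W" by force
    qed
  qed
  have ker: "{f \<in> fun_space (insert x X) W. ev f = 0} = fun_space X W"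
    using insert.hyps by (auto simp: ev_def fun_space_def)
  show ?case
    using rank_nullity(1)[OF linev subspace_fun_space[OF s W(1)] fd] insert fd by (simp add: im ker)
qed

section \<open>Polynomials and homogeneous ideals\<close>

abbreviation "lk \<equiv> Poly_Mapping.lookup"
abbreviation "ks \<equiv> Poly_Mapping.keys"
abbreviation "sg \<equiv> Poly_Mapping.single"

lemma poly_sum: "p = (\<Sum>b\<in>ks p. sg b (lk p b))"
proof (rule poly_mapping_eqI)
  fix m
  show "lk p m = lk (\<Sum>b\<in>ks p. sg b (lk p b)) m"
    by (simp add: lookup_sum lookup_single when_def in_keys_iff)
qed

lemma lookup_single_mult:
  fixes p :: "('a::cancel_comm_monoid_add) \<Rightarrow>\<^sub>0 'k::comm_semiring_1"
  shows "lk (sg a c * p) m = (if \<exists>b. m = a + b then c * lk p (m - a) else 0)"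
proof -
  have "sg a c * p = (\<Sum>b\<in>ks p. sg (a + b) (c * lk p b))"
    by (subst poly_sum[of p]) (simp add: sum_distrib_left mult_single)
  then have *: "lk (sg a c * p) m = (\<Sum>b\<in>ks p. if a + b = m then c * lk p b else 0)"
    by (simp add: lookup_sum lookup_single when_def)
  show ?thesis
  proof (cases "\<exists>b. m = a + b")
    case True
    then obtain b where b: "m = a + b" by blast
    have "(\<Sum>b\<in>ks p. if a + b = m then c * lk p b else 0) = (\<Sum>b'\<in>ks p. if b' = b then c * lk p b else 0)"
      using b by (intro sum.cong) auto
    then show ?thesis using * b by (simp add: in_keys_iff)
  next
    case False
    then show ?thesis using * by (auto intro!: sum.neutral)
  qed
qed

lemma lookup_single_mult_add [simp]:
  fixes p :: "('a::cancel_comm_monoid_add) \<Rightarrow>\<^sub>0 'k::comm_semiring_1"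
  shows "lk (sg a c * p) (a + b) = c * lk p b"
  by (auto simp: lookup_single_mult)

lemma lookup_single_0_mult [simp]:
  fixes p :: "('a::cancel_comm_monoid_add) \<Rightarrow>\<^sub>0 'k::comm_semiring_1"
  shows "lk (sg 0 c * p) b = c * lk p b"
  using lookup_single_mult_add[of 0 c p b] by simp

lemma keys_uminus [simp]: "ks (- p :: 'a \<Rightarrow>\<^sub>0 'b::ab_group_add) = ks p"
  by (auto simp: in_keys_iff)

lemma mdeg_superset:
  assumes "finite A" "ks a \<subseteq> A"
  shows "mdeg a = (\<Sum>r\<in>A. lk a r)"
  unfolding mdeg_def using assms by (intro sum.mono_neutral_left) (auto simp: in_keys_iff)

lemma mdeg_0 [simp]: "mdeg 0 = 0"
  by (simp add: mdeg_def)

lemma mdeg_eq_0_iff [simp]: "mdeg a = 0 \<longleftrightarrow> a = 0"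
  by (auto simp: mdeg_def in_keys_iff intro!: poly_mapping_eqI)

lemma mdeg_add [simp]: "mdeg (a + b) = mdeg a + mdeg b"
proof -
  let ?A = "ks a \<union> ks b"
  have "ks (a + b) \<subseteq> ?A" by (rule keys_add)
  then show ?thesis
    by (simp add: mdeg_superset[of ?A] lookup_add sum.distrib)
qed

lemma mdeg_single [simp]: "mdeg (sg j m) = m"
  by (simp add: mdeg_def)

lemma keys_add_nat [simp]: "ks (a + b :: 'a \<Rightarrow>\<^sub>0 nat) = ks a \<union> ks b"
  by (auto simp: in_keys_iff lookup_add)

lemma mon_le_iff: "(\<exists>c. b = a + c) \<longleftrightarrow> (\<forall>r. lk a r \<le> lk b r)" for a b :: mon
proof
  assume "\<forall>r. lk a r \<le> lk b r"
  then have "b = a + (b - a)" by (intro poly_mapping_eqI) (simp add: lookup_add lookup_minus)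
  then show "\<exists>c. b = a + c" by blast
qed (auto simp: lookup_add)

definition polys :: "nat \<Rightarrow> 'k::field mpol set" where
  "polys n = {p. \<forall>a\<in>ks p. ks a \<subseteq> {..<n}}"

lemma carrier_poly_ring: "carrier (poly_ring n) = polys n"
  by (simp add: poly_ring_def polys_def)

lemma polys_0 [simp]: "0 \<in> polys n" and polys_1 [simp]: "1 \<in> polys n"
  by (auto simp: polys_def)

lemma polys_add [simp]: "p \<in> polys n \<Longrightarrow> q \<in> polys n \<Longrightarrow> p + q \<in> polys n"
  using keys_add[of p q] by (fastforce simp: polys_def)

lemma polys_uminus [simp]: "- p \<in> polys n \<longleftrightarrow> p \<in> polys n"
  by (simp add: polys_def)

lemma polys_diff [simp]: "p \<in> polys n \<Longrightarrow> q \<in> polys n \<Longrightarrow> p - q \<in> polys n"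
  using polys_add[of p n "- q"] by simp

lemma polys_mult [simp]: "p \<in> polys n \<Longrightarrow> q \<in> polys n \<Longrightarrow> p * q \<in> polys n"
  using cring.cring_simprules(5)[OF cring_poly_ring, of p n q]
  by (simp add: carrier_poly_ring) (simp add: poly_ring_def)

lemma polys_sum [simp]: "(\<And>i. i \<in> A \<Longrightarrow> f i \<in> polys n) \<Longrightarrow> sum f A \<in> polys n"
  by (induction A rule: infinite_finite_induct) auto

lemma polys_single [simp]: "sg a c \<in> polys n \<longleftrightarrow> c = 0 \<or> ks a \<subseteq> {..<n}"
  by (auto simp: polys_def)

definition homog :: "nat \<Rightarrow> 'k::field mpol \<Rightarrow> bool" where
  "homog e p \<longleftrightarrow> (\<forall>a\<in>ks p. mdeg a = e)"

lemma homog_0 [simp]: "homog e 0"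
  by (simp add: homog_def)

lemma homog_add: "homog e p \<Longrightarrow> homog e q \<Longrightarrow> homog e (p + q)"
  using keys_add[of p q] by (fastforce simp: homog_def)

lemma homog_uminus [simp]: "homog e (- p) \<longleftrightarrow> homog e p"
  by (simp add: homog_def)

lemma homog_diff: "homog e p \<Longrightarrow> homog e q \<Longrightarrow> homog e (p - q)"
  using homog_add[of e p "- q"] by simp

lemma homog_sum: "(\<And>i. i \<in> A \<Longrightarrow> homog e (f i)) \<Longrightarrow> homog e (sum f A)"
  by (induction A rule: infinite_finite_induct) (auto intro: homog_add)

lemma homog_mult: "homog e p \<Longrightarrow> homog f q \<Longrightarrow> homog (e + f) (p * q)"
  using keys_mult[of p q] by (fastforce simp: homog_def)

lemma homog_single: "homog e (sg a c) \<longleftrightarrow> c = 0 \<or> mdeg a = e"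
  by (auto simp: homog_def)

lemma lookup_hom_component: "lk (hom_component e p) a = (if mdeg a = e then lk p a else 0)"
proof -
  have "lk (hom_component e p) a = (\<Sum>b\<in>{b\<in>ks p. mdeg b = e}. if b = a then lk p b else 0)"
    by (simp add: hom_component_def lookup_sum lookup_single when_def)
  then show ?thesis by (auto simp: in_keys_iff)
qed

lemma homog_hom_component: "homog e (hom_component e p)"
  by (auto simp: homog_def in_keys_iff lookup_hom_component split: if_splits)

lemma keys_hom_component: "ks (hom_component e p) \<subseteq> ks p"
  by (auto simp: in_keys_iff lookup_hom_component split: if_splits)

lemma polys_hom_component [simp]: "p \<in> polys n \<Longrightarrow> hom_component e p \<in> polys n"
  using keys_hom_component by (fastforce simp: polys_def)

lemma hom_component_add: "hom_component e (p + q) = hom_component e p + hom_component e q"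
  by (intro poly_mapping_eqI) (simp add: lookup_hom_component lookup_add)

lemma hom_component_0 [simp]: "hom_component e 0 = 0"
  by (intro poly_mapping_eqI) (simp add: lookup_hom_component)

lemma hom_component_sum: "hom_component e (sum f A) = (\<Sum>i\<in>A. hom_component e (f i))"
  by (induction A rule: infinite_finite_induct) (auto simp: hom_component_add)

lemma hom_component_homog: "homog f p \<Longrightarrow> hom_component e p = (if e = f then p else 0)"
  by (intro poly_mapping_eqI) (auto simp: lookup_hom_component homog_def in_keys_iff)

lemma sum_hom_component: 
  assumes "finite E" "mdeg ` ks p \<subseteq> E" shows "p = (\<Sum>e\<in>E. hom_component e p)"
  using assms by (intro poly_mapping_eqI) (force simp: lookup_sum lookup_hom_component in_keys_iff)

lemma hom_component_mult:
  assumes "homog f q"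
  shows "hom_component e (q * p) = (if f \<le> e then q * hom_component (e - f) p else 0)"
proof -
  let ?E = "mdeg ` ks p"
  have "hom_component e (q * p) = (\<Sum>d\<in>?E. hom_component e (q * hom_component d p))"
    by (subst sum_hom_component[of ?E p]) (auto simp: sum_distrib_left hom_component_sum)
  also have "\<dots> = (\<Sum>d\<in>?E. if e = f + d then q * hom_component d p else 0)"
    by (intro sum.cong refl) (simp add: hom_component_homog[OF homog_mult[OF assms homog_hom_component]])
  also have "\<dots> = (if f \<le> e then q * hom_component (e - f) p else 0)"
  proof (cases "f \<le> e \<and> e - f \<in> ?E")
    case True
    then have "(\<Sum>d\<in>?E. if e = f + d then q * hom_component d p else 0) =
        (\<Sum>d\<in>?E. if d = e - f then q * hom_component d p else 0)"
      by (intro sum.cong) auto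
    then show ?thesis using True by simp
  next
    case False
    have "hom_component (e - f) p = 0" if "e - f \<notin> ?E"
      using that by (intro poly_mapping_eqI) (force simp: lookup_hom_component in_keys_iff)
    with False show ?thesis by (auto intro!: sum.neutral)
  qed
  finally show ?thesis .
qed

definition forms :: "nat \<Rightarrow> nat \<Rightarrow> 'k::field mpol set" where
  "forms n e = {p \<in> polys n. homog e p}"

lemma forms_0 [simp]: "0 \<in> forms n e"
  by (simp add: forms_def)

lemma forms_add: "p \<in> forms n e \<Longrightarrow> q \<in> forms n e \<Longrightarrow> p + q \<in> forms n e"
  by (simp add: forms_def homog_add)

lemma forms_uminus [simp]: "- p \<in> forms n e \<longleftrightarrow> p \<in> forms n e"
  by (simp add: forms_def)

lemma forms_diff: "p \<in> forms n e \<Longrightarrow> q \<in> forms n e \<Longrightarrow> p - q \<in> forms n e"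
  by (simp add: forms_def homog_diff)

lemma forms_mult: "p \<in> forms n e \<Longrightarrow> q \<in> forms n f \<Longrightarrow> p * q \<in> forms n (e + f)"
  by (simp add: forms_def homog_mult)

lemma forms_sum: "(\<And>i. i \<in> A \<Longrightarrow> f i \<in> forms n e) \<Longrightarrow> sum f A \<in> forms n e"
  by (simp add: forms_def homog_sum)

lemma forms_const [simp]: "sg 0 c \<in> forms n 0"
  by (simp add: forms_def homog_single)

lemma forms_0_const: "p \<in> forms n 0 \<Longrightarrow> p = sg 0 (lk p 0)"
  by (intro poly_mapping_eqI) (auto simp: forms_def homog_def in_keys_iff lookup_single when_def)

definition var :: "nat \<Rightarrow> 'k::field mpol" where
  "var j = sg (sg j 1) 1"

lemma var_forms [simp]: "var j \<in> forms n (Suc 0) \<longleftrightarrow> j < n"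
  by (simp add: forms_def homog_single var_def)

lemma var_polys [simp]: "var j \<in> polys n \<longleftrightarrow> j < n"
  by (simp add: var_def)

definition pscale :: "'k::field \<Rightarrow> 'k mpol \<Rightarrow> 'k mpol" where
  "pscale c p = sg 0 c * p"

lemma vector_space_pscale: "vector_space pscale"
  by unfold_locales (auto simp: pscale_def algebra_simps single_add mult_single)

lemma lookup_pscale [simp]: "lk (pscale c p) a = c * lk p a"
  by (simp add: pscale_def)

lemma pscale_forms: "p \<in> forms n e \<Longrightarrow> pscale c p \<in> forms n e"
  using forms_mult[of "sg 0 c" n 0 p e] by (simp add: pscale_def)

lemma pscale_mult_left: "pscale c (p * q) = p * pscale c q"
  by (simp add: pscale_def algebra_simps)

interpretation pv: vec pscale by (simp add: vec_def vector_space_pscale)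

lemma subspace_forms: "pv.subspace (forms n e)"
  by (simp add: pv.subspace_def forms_add pscale_forms)

lemma finite_monomials: "finite (monomials n d)"
proof -
  have "lk a r \<le> d" if "a \<in> monomials n d" for a r
  proof (cases "r \<in> ks a")
    case True
    then show ?thesis
      using that member_le_sum[of r "ks a" "lk a"] by (simp add: monomials_def mdeg_def)
  qed (simp add: in_keys_iff)
  then have "lk ` monomials n d \<subseteq> {f. \<forall>x. (x \<in> {..<n} \<longrightarrow> f x \<in> {..d}) \<and> (x \<notin> {..<n} \<longrightarrow> f x = 0)}"
    by (force simp: monomials_def in_keys_iff)
  moreover have "finite \<dots>" by (rule finite_set_of_finite_funs) auto
  ultimately have "finite (lk ` monomials n d)" by (rule finite_subset)
  then show ?thesis
    by (rule finite_imageD) (auto simp: inj_on_def intro: poly_mapping_eqI)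
qed

lemma forms_eq: "forms n e = {p. ks p \<subseteq> monomials n e}"
  by (auto simp: forms_def polys_def homog_def monomials_def)

definition monspan :: "mon set \<Rightarrow> 'k::field mpol set" where
  "monspan M = {p. ks p \<subseteq> M}"

lemma subspace_monspan: "pv.subspace (monspan M)"
  by (auto simp: pv.subspace_def monspan_def in_keys_iff lookup_add)
     (metis add.right_neutral in_keys_iff subsetD)

lemma monspan_dim:
  assumes "finite M"
  shows "fin_dim pscale (monspan M :: 'k::field mpol set)" "pv.dim (monspan M :: 'k mpol set) = card M"
proof -
  let ?B = "(\<lambda>a. sg a 1 :: 'k mpol) ` M"
  have inj: "inj_on (\<lambda>a. sg a 1 :: 'k mpol) M"
    by (auto simp: inj_on_def dest: arg_cong[of _ _ ks])
  have sub: "?B \<subseteq> monspan M" by (auto simp: monspan_def)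
  have span: "monspan M \<subseteq> pv.span ?B"
  proof
    fix p :: "'k mpol" assume p: "p \<in> monspan M"
    have "sg a (lk p a) \<in> pv.span ?B" if "a \<in> ks p" for a
    proof -
      have "sg a (lk p a) = pscale (lk p a) (sg a 1)" by (simp add: pscale_def mult_single)
      moreover have "sg a 1 \<in> pv.span ?B" using p that by (intro pv.span_base) (auto simp: monspan_def)
      ultimately show ?thesis by (simp only: pv.span_scale)
    qed
    then show "p \<in> pv.span ?B" by (subst poly_sum) (auto intro: pv.span_sum)
  qed
  have ind: "pv.independent ?B"
  proof
    assume "pv.dependent ?B"
    then obtain a where a: "a \<in> M" "sg a 1 \<in> pv.span (?B - {sg a 1})"
      by (auto simp: pv.dependent_def)
    have "pv.span (?B - {sg a 1}) \<subseteq> monspan (M - {a})"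
      by (rule pv.span_minimal[OF _ subspace_monspan]) (auto simp: monspan_def)
    then show False using a by (auto simp: monspan_def)
  qed
  show "fin_dim pscale (monspan M :: 'k mpol set)"
    unfolding fin_dim_def using assms span by (intro exI[of _ ?B]) auto
  show "pv.dim (monspan M :: 'k mpol set) = card M"
    using pv.basis_card_eq_dim[OF sub span ind] card_image[OF inj] by simp
qed

lemma fin_dim_forms: "fin_dim pscale (forms n e)"
  and dim_forms: "pv.dim (forms n e) = card (monomials n e)"
  using monspan_dim[OF finite_monomials] by (simp_all add: forms_eq monspan_def)

text \<open>Graded ideals as bare closure conditions in the type-class operations, so that arguments
  need not pass through the ring record \<open>poly_ring\<close>.\<close>

definition hideal :: "nat \<Rightarrow> 'k::field mpol set \<Rightarrow> bool" where
  "hideal n I \<longleftrightarrow> I \<subseteq> polys n \<and> 0 \<in> I \<and> (\<forall>p\<in>I. \<forall>q\<in>I. p + q \<in> I) \<and>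
     (\<forall>r\<in>polys n. \<forall>p\<in>I. r * p \<in> I) \<and> (\<forall>p\<in>I. \<forall>e. hom_component e p \<in> I)"

lemma hidealD:
  assumes "hideal n I"
  shows "p \<in> I \<Longrightarrow> p \<in> polys n" "0 \<in> I" "p \<in> I \<Longrightarrow> q \<in> I \<Longrightarrow> p + q \<in> I"
    "r \<in> polys n \<Longrightarrow> p \<in> I \<Longrightarrow> r * p \<in> I" "p \<in> I \<Longrightarrow> hom_component e p \<in> I"
    "p \<in> I \<Longrightarrow> - p \<in> I" "p \<in> I \<Longrightarrow> q \<in> I \<Longrightarrow> p - q \<in> I"
proof -
  show *: "p \<in> I \<Longrightarrow> p \<in> polys n" "0 \<in> I" "p \<in> I \<Longrightarrow> q \<in> I \<Longrightarrow> p + q \<in> I"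
    "r \<in> polys n \<Longrightarrow> p \<in> I \<Longrightarrow> r * p \<in> I" "p \<in> I \<Longrightarrow> hom_component e p \<in> I" for p q r
    using assms by (auto simp: hideal_def)
  show "p \<in> I \<Longrightarrow> - p \<in> I" for p using *(4)[of "-1" p] by simp
  then show "p \<in> I \<Longrightarrow> q \<in> I \<Longrightarrow> p - q \<in> I" using *(3)[of p "- q"] by simp
qed

lemma hideal_sum: "hideal n I \<Longrightarrow> (\<And>i. i \<in> A \<Longrightarrow> f i \<in> I) \<Longrightarrow> sum f A \<in> I"
  by (induction A rule: infinite_finite_induct) (auto intro: hidealD)

lemma ideal_poly_ringD:
  assumes "ideal I (poly_ring n)"
  shows "0 \<in> I" "p \<in> I \<Longrightarrow> q \<in> I \<Longrightarrow> p + q \<in> I" "r \<in> polys n \<Longrightarrow> p \<in> I \<Longrightarrow> r * p \<in> I"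
proof -
  interpret ideal I "poly_ring n" by fact
  show "0 \<in> I" using additive_subgroup.zero_closed[OF additive_subgroup_axioms] by (simp add: poly_ring_def)
  show "p \<in> I \<Longrightarrow> q \<in> I \<Longrightarrow> p + q \<in> I"
    using additive_subgroup.a_closed[OF additive_subgroup_axioms, of p q] by (simp add: poly_ring_def)
  show "r \<in> polys n \<Longrightarrow> p \<in> I \<Longrightarrow> r * p \<in> I"
    using I_l_closed[of p r] unfolding carrier_poly_ring by (simp add: poly_ring_def)
qed

lemma graded_ideal_imp_hideal:
  assumes "graded_ideal n I" shows "hideal n I"
proof -
  have I: "ideal I (poly_ring n)" using assms by (simp add: graded_ideal_def)
  interpret ideal I "poly_ring n" by (rule I)
  have "I \<subseteq> polys n" using a_subset carrier_poly_ring by auto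
  then show ?thesis using assms ideal_poly_ringD[OF I] by (simp add: graded_ideal_def hideal_def)
qed

lemma subspace_hideal: "hideal n I \<Longrightarrow> pv.subspace (I \<inter> forms n e)"
  unfolding pv.subspace_def
  by (auto intro: hidealD forms_add pscale_forms) (simp add: hidealD pscale_def)

lemma fin_dim_hideal: "fin_dim pscale (I \<inter> forms n e)"
  by (rule fin_dim_mono[OF fin_dim_forms]) auto

section \<open>The Koszul complex and regularity\<close>

definition ksgn :: "nat \<Rightarrow> nat set \<Rightarrow> 'k::field mpol" where
  "ksgn j \<tau> = (-1) ^ card {s \<in> \<tau>. s < j}"

text \<open>The Koszul differential of the chain with coefficient \<open>c \<sigma>\<close> at the
  basis vector of \<sigma>, written coefficientwise: the coefficient at \<tau> collects one term
  from each set with one element more.\<close>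

definition kos :: "nat \<Rightarrow> (nat set \<Rightarrow> 'k::field mpol) \<Rightarrow> nat set \<Rightarrow> 'k mpol" where
  "kos n c = (\<lambda>\<tau>. \<Sum>j\<in>{..<n} - \<tau>. ksgn j \<tau> * (var j * c (insert j \<tau>)))"

text \<open>
  Forms shifted by \<open>q\<close> into total degree \<open>e\<close>, without truncated subtraction: only \<open>0\<close> if \<open>e < q\<close>.
\<close>

definition sforms :: "nat \<Rightarrow> nat \<Rightarrow> nat \<Rightarrow> 'k::field mpol set" where
  "sforms n q e = {p \<in> polys n. \<forall>a\<in>ks p. mdeg a + q = e}"

definition ksub :: "nat \<Rightarrow> nat \<Rightarrow> nat set set" where
  "ksub n i = {\<sigma>. \<sigma> \<subseteq> {..<n} \<and> card \<sigma> = i}"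

text \<open>Exterior degree i and degree shift q are separate parameters because coefficients also
  come from shifted modules: for S(-s) one takes q = i + s.\<close>

definition kch :: "nat \<Rightarrow> nat \<Rightarrow> nat \<Rightarrow> nat \<Rightarrow> (nat set \<Rightarrow> 'k::field mpol) set" where
  "kch n i q e = fun_space (ksub n i) (sforms n q e)"

lemma sforms_eq: "sforms n q e = (if q \<le> e then forms n (e - q) else {0})"
proof (cases "q \<le> e")
  case True
  then have "mdeg a + q = e \<longleftrightarrow> mdeg a = e - q" for a by auto
  then show ?thesis using True by (simp add: sforms_def forms_def homog_def)
next
  case False
  then have "mdeg a + q \<noteq> e" for a by simp
  then show ?thesis using False by (auto simp: sforms_def)
qed

lemma sforms_0 [simp]: "0 \<in> sforms n q e"
  by (simp add: sforms_def)

lemma sforms_add: "p \<in> sforms n q e \<Longrightarrow> p' \<in> sforms n q e \<Longrightarrow> p + p' \<in> sforms n q e"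
  by (auto simp: sforms_eq forms_add split: if_splits)

lemma sforms_uminus [simp]: "- p \<in> sforms n q e \<longleftrightarrow> p \<in> sforms n q e"
  by (auto simp: sforms_eq split: if_splits)

lemma sforms_sum: "(\<And>i. i \<in> A \<Longrightarrow> f i \<in> sforms n q e) \<Longrightarrow> sum f A \<in> sforms n q e"
  by (induction A rule: infinite_finite_induct) (auto intro: sforms_add)

lemma sforms_mult:
  assumes "l \<in> forms n m" "p \<in> sforms n (m + q) e"
  shows "l * p \<in> sforms n q e"
proof -
  have "mdeg a + q = e" if "a \<in> ks (l * p)" for a
  proof -
    obtain b c where "b \<in> ks l" "c \<in> ks p" "a = b + c" using \<open>a \<in> _\<close> keys_mult[of l p] by blast
    then show ?thesis using assms by (fastforce simp: sforms_def forms_def homog_def)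
  qed
  then show ?thesis using assms by (simp add: sforms_def forms_def)
qed

lemma sforms_pscale: "p \<in> sforms n q e \<Longrightarrow> pscale c p \<in> sforms n q e"
  using sforms_mult[of "sg 0 c" n 0 p q e] by (simp add: pscale_def)

lemma subspace_sforms: "pv.subspace (sforms n q e)"
  by (simp add: pv.subspace_def sforms_add sforms_pscale)

lemma fin_dim_sforms: "fin_dim pscale (sforms n q e)"
  using fin_dim_forms pv.fin_dim_0 by (auto simp: sforms_eq)

lemma ksgn_forms: "ksgn j \<tau> \<in> forms n 0"
proof -
  have "1 \<in> forms n 0" by (simp add: forms_def homog_def)
  then show ?thesis unfolding ksgn_def by (cases "even (card {s \<in> \<tau>. s < j})") simp_all
qed

lemma ksgn_polys [simp]: "(ksgn j \<tau> :: 'k::field mpol) \<in> polys n"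
proof -
  have "(ksgn j \<tau> :: 'k mpol) \<in> forms n 0" by (rule ksgn_forms)
  then show ?thesis by (simp add: forms_def)
qed

lemma ksgn_square [simp]: "ksgn j \<tau> * (ksgn j \<tau> * p) = p"
  by (simp add: ksgn_def flip: mult.assoc power_mult_distrib)

lemma ksgn_insert:
  assumes "finite \<tau>" "i \<notin> \<tau>"
  shows "ksgn j (insert i \<tau>) = (if i < j then - ksgn j \<tau> else ksgn j \<tau>)"
proof -
  have "{s \<in> insert i \<tau>. s < j} = (if i < j then insert i {s \<in> \<tau>. s < j} else {s \<in> \<tau>. s < j})" by auto
  then show ?thesis using assms by (simp add: ksgn_def)
qed

lemma kchD:
  assumes "c \<in> kch n i q e"
  shows "c \<sigma> \<in> sforms n q e" "c \<sigma> \<in> polys n" "\<not> \<sigma> \<subseteq> {..<n} \<Longrightarrow> c \<sigma> = 0" "card \<sigma> \<noteq> i \<Longrightarrow> c \<sigma> = 0"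
  using assms by (auto simp: kch_def fun_space_def ksub_def sforms_def)

lemma kchI:
  assumes "\<And>\<sigma>. c \<sigma> \<in> sforms n q e" "\<And>\<sigma>. c \<sigma> \<noteq> 0 \<Longrightarrow> \<sigma> \<subseteq> {..<n} \<and> card \<sigma> = i"
  shows "c \<in> kch n i q e"
  using assms by (auto simp: kch_def fun_space_def ksub_def)

lemma kch_0 [simp]: "0 \<in> kch n i q e" "(\<lambda>_. 0) \<in> kch n i q e"
  by (auto intro!: kchI)

lemma kch_add:
  assumes "c \<in> kch n i q e" "c' \<in> kch n i q e" shows "(\<lambda>\<sigma>. c \<sigma> + c' \<sigma>) \<in> kch n i q e"
proof (rule kchI)
  show "c \<sigma> + c' \<sigma> \<in> sforms n q e" for \<sigma> using assms by (simp add: kchD(1) sforms_add)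
  show "\<sigma> \<subseteq> {..<n} \<and> card \<sigma> = i" if "c \<sigma> + c' \<sigma> \<noteq> 0" for \<sigma>
    using that kchD(3,4)[OF assms(1), of \<sigma>] kchD(3,4)[OF assms(2), of \<sigma>] by (metis add.right_neutral)
qed

lemma kch_uminus: "c \<in> kch n i q e \<Longrightarrow> (\<lambda>\<sigma>. - c \<sigma>) \<in> kch n i q e"
  by (rule kchI) (auto dest: kchD)

lemma kch_diff:
  "c \<in> kch n i q e \<Longrightarrow> c' \<in> kch n i q e \<Longrightarrow> (\<lambda>\<sigma>. c \<sigma> - c' \<sigma>) \<in> kch n i q e"
  using kch_add[OF _ kch_uminus] by fastforce

lemma kch_mult:
  assumes "l \<in> forms n m" "c \<in> kch n i (m + q) e" shows "(\<lambda>\<sigma>. l * c \<sigma>) \<in> kch n i q e"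
proof (rule kchI)
  show "l * c \<sigma> \<in> sforms n q e" for \<sigma> by (rule sforms_mult[OF assms(1) kchD(1)[OF assms(2)]])
  show "\<sigma> \<subseteq> {..<n} \<and> card \<sigma> = i" if "l * c \<sigma> \<noteq> 0" for \<sigma>
    using that kchD(3,4)[OF assms(2), of \<sigma>] by force
qed

lemma kos_kch:
  assumes c: "c \<in> kch n (Suc i) (Suc q) e"
  shows "kos n c \<in> kch n i q e"
proof (rule kchI)
  fix \<tau>
  show "kos n c \<tau> \<in> sforms n q e"
    unfolding kos_def
  proof (rule sforms_sum)
    fix j assume "j \<in> {..<n} - \<tau>"
    then have "var j * c (insert j \<tau>) \<in> sforms n q e"
      using sforms_mult[of "var j" n 1 "c (insert j \<tau>)" q e] kchD(1)[OF c] by simp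
    then show "ksgn j \<tau> * (var j * c (insert j \<tau>)) \<in> sforms n q e"
      using sforms_mult[OF ksgn_forms] by simp
  qed
  assume "kos n c \<tau> \<noteq> 0"
  then obtain j where j0: "j \<in> {..<n} - \<tau>" "ksgn j \<tau> * (var j * c (insert j \<tau>)) \<noteq> 0"
    unfolding kos_def by (rule sum.not_neutral_contains_not_neutral)
  have "c (insert j \<tau>) \<noteq> 0"
  proof
    assume "c (insert j \<tau>) = 0"
    then show False using j0(2) by simp
  qed
  note j = j0(1) this
  then have "insert j \<tau> \<subseteq> {..<n}" "card (insert j \<tau>) = Suc i" using kchD(3,4)[OF c] by blast+
  moreover from this have "finite \<tau>" by (meson finite_insert finite_lessThan finite_subset)
  ultimately show "\<tau> \<subseteq> {..<n} \<and> card \<tau> = i" using j(1) by simp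
qed

lemma kos_kch_0:
  assumes c: "c \<in> kch n 0 q e"
  shows "kos n c = 0"
proof
  fix \<tau>
  have "c (insert j \<tau>) = 0" if "j < n" for j
  proof (cases "insert j \<tau> \<subseteq> {..<n}")
    case True
    then have "finite (insert j \<tau>)" by (rule finite_subset) simp
    then have "card (insert j \<tau>) \<noteq> 0" by (metis card_0_eq insert_not_empty)
    then show ?thesis by (rule kchD(4)[OF c])
  qed (rule kchD(3)[OF c])
  then show "kos n c \<tau> = 0 \<tau>" by (simp add: kos_def)
qed

lemma kos_add: "kos n (\<lambda>\<sigma>. c \<sigma> + c' \<sigma>) = (\<lambda>\<sigma>. kos n c \<sigma> + kos n c' \<sigma>)"
  by (simp add: kos_def algebra_simps sum.distrib)

lemma kos_mult: "kos n (\<lambda>\<sigma>. l * c \<sigma>) = (\<lambda>\<sigma>. l * kos n c \<sigma>)"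
  by (simp add: kos_def sum_distrib_left mult.left_commute)

lemma kos_diff: "kos n (\<lambda>\<sigma>. c \<sigma> - c' \<sigma>) = (\<lambda>\<sigma>. kos n c \<sigma> - kos n c' \<sigma>)"
  by (simp add: kos_def algebra_simps sum_subtractf)

lemma kos_0 [simp]: "kos n (\<lambda>_. 0) = (\<lambda>_. 0)" "kos n 0 = 0"
  by (simp_all add: kos_def fun_eq_iff)

lemma kos_sum: "kos n (\<lambda>\<sigma>. \<Sum>b\<in>B. c b \<sigma>) = (\<lambda>\<sigma>. \<Sum>b\<in>B. kos n (c b) \<sigma>)"
  unfolding kos_def by (simp add: sum_distrib_left sum.swap[of _ B])

text \<open>Removing j and i in either order leads to the same coefficient with opposite signs;
  splitting the double sum at the diagonal pairs these terms.\<close>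

lemma kos_kos:
  assumes "finite \<tau>"
  shows "kos n (kos n c) \<tau> = 0"
proof -
  define N where "N = {..<n} - \<tau>"
  define f where "f j i = ksgn j \<tau> * (var j * (ksgn i (insert j \<tau>) * (var i * c (insert i (insert j \<tau>)))))" for j i
  have fN: "finite N" by (simp add: N_def)
  have anti: "f j i + f i j = 0" if "j < i" "j \<in> N" "i \<in> N" for i j
  proof -
    have "j \<notin> \<tau>" "i \<notin> \<tau>" using that by (auto simp: N_def)
    then have "ksgn i (insert j \<tau>) = (- ksgn i \<tau> :: 'a mpol)" "ksgn j (insert i \<tau>) = (ksgn j \<tau> :: 'a mpol)"
      using that(1) by (simp_all add: ksgn_insert[OF assms])
    moreover have "insert i (insert j \<tau>) = insert j (insert i \<tau>)" by auto
    ultimately show ?thesis by (simp add: f_def algebra_simps)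
  qed
  have "kos n (kos n c) \<tau> = (\<Sum>j\<in>N. \<Sum>i\<in>N - {j}. f j i)"
    unfolding kos_def f_def N_def
    by (simp only: sum_distrib_left Diff_insert[of "{..<n}" _ \<tau>])
  also have "\<dots> = (\<Sum>j\<in>N. (\<Sum>i\<in>{i\<in>N. j < i}. f j i) + (\<Sum>i\<in>{i\<in>N. i < j}. f j i))"
    using fN by (intro sum.cong refl, subst sum.union_disjoint[symmetric])
      (auto intro!: sum.cong)
  also have "\<dots> = (\<Sum>j\<in>N. \<Sum>i\<in>{i\<in>N. j < i}. f j i) + (\<Sum>j\<in>N. \<Sum>i\<in>{i\<in>N. i < j}. f j i)"
    by (simp add: sum.distrib)
  also have "(\<Sum>j\<in>N. \<Sum>i\<in>{i\<in>N. i < j}. f j i) = (\<Sum>i\<in>N. \<Sum>j\<in>{j\<in>N. i < j}. f j i)"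
    using fN fN by (rule sum.swap_restrict)
  also have "(\<Sum>j\<in>N. \<Sum>i\<in>{i\<in>N. j < i}. f j i) + \<dots> = (\<Sum>j\<in>N. \<Sum>i\<in>{i\<in>N. j < i}. f j i + f i j)"
    by (simp add: sum.distrib)
  also have "\<dots> = 0" using anti by (intro sum.neutral ballI) auto
  finally show ?thesis .
qed

lemma kos_kos_kch:
  assumes "c \<in> kch n (Suc i) (Suc q) e"
  shows "kos n (kos n c) = 0"
proof
  fix \<tau>
  show "kos n (kos n c) \<tau> = 0 \<tau>"
  proof (cases "finite \<tau>")
    case False
    then have "\<not> insert j \<tau> \<subseteq> {..<n}" for j by (meson finite_insert finite_lessThan finite_subset)
    then have "kos n c (insert j \<tau>) = 0" for j using kchD(3)[OF kos_kch[OF assms]] by blast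
    then show ?thesis unfolding kos_def[of n "kos n c"] by simp
  qed (simp add: kos_kos)
qed

section \<open>The null-homotopy for multiplication by a variable\<close>

definition wed :: "nat \<Rightarrow> (nat set \<Rightarrow> 'k::field mpol) \<Rightarrow> nat set \<Rightarrow> 'k mpol" where
  "wed r c = (\<lambda>\<sigma>. if r \<in> \<sigma> then ksgn r (\<sigma> - {r}) * c (\<sigma> - {r}) else 0)"

lemma wed_kch:
  assumes c: "c \<in> kch n i q e" and r: "r < n"
  shows "wed r c \<in> kch n (Suc i) q e"
proof (rule kchI)
  fix \<sigma>
  show "wed r c \<sigma> \<in> sforms n q e"
    using sforms_mult[OF ksgn_forms, of "c (\<sigma> - {r})" n q e r] kchD(1)[OF c] by (simp add: wed_def)
  assume "wed r c \<sigma> \<noteq> 0"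
  have *: "r \<in> \<sigma>" "c (\<sigma> - {r}) \<noteq> 0"
  proof -
    show "r \<in> \<sigma>" by (rule ccontr) (use \<open>wed r c \<sigma> \<noteq> 0\<close> in \<open>simp add: wed_def\<close>)
    show "c (\<sigma> - {r}) \<noteq> 0"
    proof
      assume "c (\<sigma> - {r}) = 0"
      then show False using \<open>wed r c \<sigma> \<noteq> 0\<close> \<open>r \<in> \<sigma>\<close> by (simp add: wed_def)
    qed
  qed
  have 1: "\<sigma> - {r} \<subseteq> {..<n}" "card (\<sigma> - {r}) = i"
    using *(2) kchD(3)[OF c, of "\<sigma> - {r}"] kchD(4)[OF c, of "\<sigma> - {r}"] by fast+
  have "finite (\<sigma> - {r})" by (rule finite_subset[OF 1(1)]) simp
  then have "card \<sigma> = Suc i" using card.remove[of \<sigma> r] *(1) 1(2) by simp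
  moreover have "\<sigma> \<subseteq> {..<n}" using 1(1) r by blast
  ultimately show "\<sigma> \<subseteq> {..<n} \<and> card \<sigma> = Suc i" by blast
qed

text \<open>\<open>wed r\<close> is exterior multiplication by the r-th basis vector. In the sum of
  the two composites the terms for j different from r cancel by the sign rule, and the term for j =
  r gives x_r.\<close>

lemma kos_wed:
  assumes r: "r < n" and fin: "finite \<sigma>"
  shows "kos n (wed r c) \<sigma> + wed r (kos n c) \<sigma> = var r * c \<sigma>"
proof (cases "r \<in> \<sigma>")
  case False
  have "kos n (wed r c) \<sigma> = (\<Sum>j\<in>{..<n} - \<sigma>. if j = r then var r * c \<sigma> else 0)"
    unfolding kos_def
  proof (intro sum.cong refl)
    fix j assume "j \<in> {..<n} - \<sigma>"
    have "var r * (ksgn r \<sigma> * c \<sigma>) = ksgn r \<sigma> * (var r * c \<sigma>)" by (rule mult.left_commute)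
    then show "ksgn j \<sigma> * (var j * wed r c (insert j \<sigma>)) = (if j = r then var r * c \<sigma> else 0)"
      using False by (auto simp: wed_def)
  qed
  then show ?thesis using False r by (simp add: wed_def)
next
  case True
  define \<tau> where "\<tau> = \<sigma> - {r}"
  have \<sigma>: "\<sigma> = insert r \<tau>" "r \<notin> \<tau>" "finite \<tau>" using True fin by (auto simp: \<tau>_def)
  have "wed r (kos n c) \<sigma> = ksgn r \<tau> * (\<Sum>j\<in>insert r ({..<n} - \<sigma>). ksgn j \<tau> * (var j * c (insert j \<tau>)))"
  proof -
    have "insert r ({..<n} - \<sigma>) = {..<n} - \<tau>" using r \<sigma> by auto
    then show ?thesis using True by (simp add: wed_def kos_def \<tau>_def)
  qed
  also have "\<dots> = var r * c \<sigma> + (\<Sum>j\<in>{..<n} - \<sigma>. ksgn r \<tau> * (ksgn j \<tau> * (var j * c (insert j \<tau>))))"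
    using \<sigma> by (simp add: sum_distrib_left distrib_left)
  finally have 1: "wed r (kos n c) \<sigma> = var r * c \<sigma> + (\<Sum>j\<in>{..<n} - \<sigma>. ksgn r \<tau> * (ksgn j \<tau> * (var j * c (insert j \<tau>))))" .
  have "kos n (wed r c) \<sigma> = (\<Sum>j\<in>{..<n} - \<sigma>. - (ksgn r \<tau> * (ksgn j \<tau> * (var j * c (insert j \<tau>)))))"
    unfolding kos_def
  proof (intro sum.cong refl)
    fix j assume j: "j \<in> {..<n} - \<sigma>"
    then have j': "j \<notin> \<tau>" "j \<noteq> r" using \<sigma> by auto
    have "insert j \<sigma> - {r} = insert j \<tau>" using j' \<sigma> by auto
    then have "wed r c (insert j \<sigma>) = ksgn r (insert j \<tau>) * c (insert j \<tau>)"
      using True by (simp add: wed_def)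
    moreover have "ksgn j \<sigma> * ksgn r (insert j \<tau>) = (- (ksgn r \<tau> * ksgn j \<tau>) :: 'a mpol)"
      unfolding \<sigma>(1) using j' \<sigma> by (cases "r < j") (auto simp: ksgn_insert mult.commute)
    moreover have "ksgn j \<sigma> * (var j * (p * q)) = ksgn j \<sigma> * p * (var j * q)" for p q :: "'a mpol"
      by (simp only: ac_simps)
    ultimately have "ksgn j \<sigma> * (var j * wed r c (insert j \<sigma>)) = - (ksgn r \<tau> * ksgn j \<tau>) * (var j * c (insert j \<tau>))"
      by (simp only:)
    then show "ksgn j \<sigma> * (var j * wed r c (insert j \<sigma>)) =
        - (ksgn r \<tau> * (ksgn j \<tau> * (var j * c (insert j \<tau>))))"
      by (simp only: mult_minus_left mult.assoc)
  qed
  then show ?thesis using 1 by (simp add: sum_negf)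
qed

section \<open>Adding a linear form to an ideal\<close>

definition addl :: "nat \<Rightarrow> 'k::field mpol set \<Rightarrow> 'k mpol \<Rightarrow> 'k mpol set" where
  "addl n I l = {a + l * u | a u. a \<in> I \<and> u \<in> polys n}"

lemma hideal_addl:
  assumes I: "hideal n I" and l: "l \<in> forms n 1"
  shows "hideal n (addl n I l)"
  unfolding hideal_def
proof (intro conjI ballI allI)
  have lp: "l \<in> polys n" and lh: "homog 1 l" using l by (auto simp: forms_def)
  show "addl n I l \<subseteq> polys n" using lp hidealD(1)[OF I] by (auto simp: addl_def)
  show "0 \<in> addl n I l" using hidealD(2)[OF I] by (force simp: addl_def)
  fix p assume "p \<in> addl n I l"
  then obtain a u where p: "p = a + l * u" "a \<in> I" "u \<in> polys n" by (auto simp: addl_def)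
  show "p + q \<in> addl n I l" if "q \<in> addl n I l" for q
  proof -
    from that obtain b v where q: "q = b + l * v" "b \<in> I" "v \<in> polys n" unfolding addl_def by blast
    have "p + q = (a + b) + l * (u + v)" by (simp add: p q algebra_simps)
    then show ?thesis unfolding addl_def using hidealD(3)[OF I p(2) q(2)] polys_add[OF p(3) q(3)] by blast
  qed
  show "r * p \<in> addl n I l" if "r \<in> polys n" for r
  proof -
    have "r * p = r * a + l * (r * u)" by (simp add: p algebra_simps)
    then show ?thesis unfolding addl_def using hidealD(4)[OF I that p(2)] polys_mult[OF that p(3)] by blast
  qed
  show "hom_component e p \<in> addl n I l" for e
  proof -
    have "hom_component e p = hom_component e a + l * (if 1 \<le> e then hom_component (e - 1) u else 0)"
      by (simp add: p hom_component_add hom_component_mult[OF lh])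
    moreover have "(if 1 \<le> e then hom_component (e - 1) u else 0) \<in> polys n" using p by simp
    ultimately show ?thesis unfolding addl_def using hidealD(5)[OF I p(2)] by blast
  qed
qed

lemma addl_superset: "I \<subseteq> addl n I l"
  by (force simp: addl_def)

lemma addl_mult: "hideal n I \<Longrightarrow> u \<in> polys n \<Longrightarrow> l * u \<in> addl n I l"
  by (force simp: addl_def dest: hidealD(2))

text \<open>The component of degree e - q of any representation a + l u is again a representation;
  as l has degree 1, the cofactor lives one degree lower, hence the shift
  \<open>Suc q\<close>.\<close>

lemma addl_sforms:
  assumes I: "hideal n I" and l: "l \<in> forms n 1" and p: "p \<in> sforms n q e" "p \<in> addl n I l"
  shows "\<exists>a\<in>I \<inter> sforms n q e. \<exists>u\<in>sforms n (Suc q) e. p = a + l * u"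
proof (cases "q \<le> e")
  case True
  have lp: "l \<in> polys n" and lh: "homog 1 l" using l by (auto simp: forms_def)
  obtain a u where au: "p = a + l * u" "a \<in> I" "u \<in> polys n" using p by (auto simp: addl_def)
  let ?u = "if 1 \<le> e - q then hom_component (e - q - 1) u else 0"
  have "p = hom_component (e - q) p"
    using hom_component_homog[of "e - q" p "e - q"] p(1) True by (simp add: sforms_eq forms_def)
  also have "\<dots> = hom_component (e - q) a + l * ?u"
    by (simp add: au hom_component_add hom_component_mult[OF lh])
  finally have "p = hom_component (e - q) a + l * ?u" .
  moreover have "hom_component (e - q) a \<in> I" using hidealD(5)[OF I au(2)] .
  moreover have "hom_component (e - q) a \<in> sforms n q e"
    using True hidealD(1)[OF I au(2)] by (simp add: sforms_eq forms_def homog_hom_component)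
  moreover have "?u \<in> sforms n (Suc q) e"
    using True au(3) by (auto simp: sforms_eq forms_def homog_hom_component)
  ultimately show ?thesis by blast
next
  case False
  then have "p = 0" using p by (simp add: sforms_eq)
  then show ?thesis using hidealD(2)[OF I] by (intro bexI[of _ 0]) auto
qed

lemma addl_kch:
  assumes I: "hideal n I" and l: "l \<in> forms n 1" and z: "z \<in> kch n i q e" "\<And>\<sigma>. z \<sigma> \<in> addl n I l"
  obtains a u where "a \<in> kch n i q e" "\<And>\<sigma>. a \<sigma> \<in> I" "u \<in> kch n i (Suc q) e" "\<And>\<sigma>. z \<sigma> = a \<sigma> + l * u \<sigma>"
proof -
  \<comment> \<open>The last clause makes both parts vanish wherever z does, so that they inherit
    the support of a Koszul chain.\<close>
  define Q where "Q \<sigma> a u \<longleftrightarrow> a \<in> I \<inter> sforms n q e \<and> u \<in> sforms n (Suc q) e \<and> z \<sigma> = a + l * u \<and>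
      (z \<sigma> = 0 \<longrightarrow> a = 0 \<and> u = 0)" for \<sigma> a u
  have "\<exists>a u. Q \<sigma> a u" for \<sigma>
  proof (cases "z \<sigma> = 0")
    case True
    then show ?thesis using hidealD(2)[OF I] by (intro exI[of _ 0]) (simp add: Q_def)
  next
    case False
    then show ?thesis using addl_sforms[OF I l kchD(1)[OF z(1)] z(2), of \<sigma>] unfolding Q_def by blast
  qed
  then have "\<forall>\<sigma>. \<exists>p. Q \<sigma> (fst p) (snd p)" by (metis fst_conv snd_conv)
  from choice[OF this] obtain f where f: "\<forall>\<sigma>. Q \<sigma> (fst (f \<sigma>)) (snd (f \<sigma>))" by (rule exE)
  define a u where "a \<sigma> = fst (f \<sigma>)" and "u \<sigma> = snd (f \<sigma>)" for \<sigma>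
  have "Q \<sigma> (a \<sigma>) (u \<sigma>)" for \<sigma> using f by (simp add: a_def u_def)
  then have au: "a \<sigma> \<in> I" "a \<sigma> \<in> sforms n q e" "u \<sigma> \<in> sforms n (Suc q) e" "z \<sigma> = a \<sigma> + l * u \<sigma>"
      "z \<sigma> = 0 \<Longrightarrow> a \<sigma> = 0" "z \<sigma> = 0 \<Longrightarrow> u \<sigma> = 0" for \<sigma>
    unfolding Q_def by blast+
  show ?thesis
  proof (rule that)
    have "\<sigma> \<subseteq> {..<n} \<and> card \<sigma> = i" if "z \<sigma> \<noteq> 0" for \<sigma>
      using that kchD(3)[OF z(1), of \<sigma>] kchD(4)[OF z(1), of \<sigma>] by fast
    note supp = this
    show "a \<in> kch n i q e"
    proof (rule kchI[OF au(2)])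
      show "\<sigma> \<subseteq> {..<n} \<and> card \<sigma> = i" if "a \<sigma> \<noteq> 0" for \<sigma> using that au(5) supp by metis
    qed
    show "u \<in> kch n i (Suc q) e"
    proof (rule kchI[OF au(3)])
      show "\<sigma> \<subseteq> {..<n} \<and> card \<sigma> = i" if "u \<sigma> \<noteq> 0" for \<sigma> using that au(6) supp by metis
    qed
  qed (rule au(1,4))+
qed

lemma hideal_kos:
  assumes I: "hideal n I" and a: "\<And>\<sigma>. a \<sigma> \<in> I"
  shows "kos n a \<sigma> \<in> I"
  unfolding kos_def
proof (rule hideal_sum[OF I])
  fix j assume j: "j \<in> {..<n} - \<sigma>"
  have "var j * a (insert j \<sigma>) \<in> I" using j by (intro hidealD(4)[OF I _ a]) simp
  then show "ksgn j \<sigma> * (var j * a (insert j \<sigma>)) \<in> I" by (rule hidealD(4)[OF I ksgn_polys])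
qed

text \<open>
  \<open>reg n I d\<close> says that the Koszul homology of \<open>S/I\<close> vanishes in all degrees \<open>(i, i+j)\<close> with \<open>j \<ge> d\<close>,
  that is, \<open>I\<close> is \<open>d\<close>-regular.
\<close>

definition reg :: "nat \<Rightarrow> 'k::field mpol set \<Rightarrow> nat \<Rightarrow> bool" where
  "reg n I d \<longleftrightarrow> (\<forall>i e. i + d \<le> e \<longrightarrow> (\<forall>z\<in>kch n i i e. (\<forall>\<sigma>. kos n z \<sigma> \<in> I) \<longrightarrow>
     (\<exists>w\<in>kch n (Suc i) (Suc i) e. \<forall>\<sigma>. z \<sigma> - kos n w \<sigma> \<in> I)))"

definition colon_trivial :: "nat \<Rightarrow> 'k::field mpol set \<Rightarrow> 'k mpol \<Rightarrow> nat \<Rightarrow> bool" where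
  "colon_trivial n I l d \<longleftrightarrow> (\<forall>m\<ge>d. \<forall>f\<in>forms n m. l * f \<in> I \<longrightarrow> f \<in> I)"

lemma colon_trivial_sforms:
  "colon_trivial n I l d \<Longrightarrow> hideal n I \<Longrightarrow> f \<in> sforms n q e \<Longrightarrow> q + d \<le> e \<Longrightarrow> l * f \<in> I \<Longrightarrow> f \<in> I"
  unfolding colon_trivial_def by (auto simp: sforms_eq dest!: spec[of _ "e - q"] split: if_splits)

lemma regD:
  assumes "reg n I d" "z \<in> kch n i i e" "\<And>\<sigma>. kos n z \<sigma> \<in> I" "i + d \<le> e"
  obtains w where "w \<in> kch n (Suc i) (Suc i) e" "\<And>\<sigma>. z \<sigma> - kos n w \<sigma> \<in> I"
  using assms unfolding reg_def by blast

text \<open>Chain-level form of the long exact sequence for S/I(-1) -> S/I -> S/(I, l). A cycle z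
  modulo (I, l) has boundary a + l u; cancelling l makes u a cycle modulo I, so u is a boundary of
  some v modulo I, and z - l v is a cycle modulo I, to which regularity applies a second
  time.\<close>

lemma reg_addl:
  assumes I: "hideal n I" and l: "l \<in> forms n 1" and R: "reg n I d" and C: "colon_trivial n I l d"
  shows "reg n (addl n I l) d"
  unfolding reg_def
proof (intro allI impI ballI)
  fix i e and z :: "nat set \<Rightarrow> 'a mpol"
  assume e: "i + d \<le> e" and z: "z \<in> kch n i i e" "\<forall>\<sigma>. kos n z \<sigma> \<in> addl n I l"
  have lp: "l \<in> polys n" using l by (simp add: forms_def)
  have "\<exists>v\<in>kch n i (Suc i) e. \<forall>\<sigma>. kos n (\<lambda>\<sigma>. z \<sigma> - l * v \<sigma>) \<sigma> \<in> I"
  proof (cases i)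
    case 0
    then have "kos n z = 0" using kos_kch_0 z by blast
    then show ?thesis using hidealD(2)[OF I] by (intro bexI[of _ "\<lambda>_. 0"]) auto
  next
    case (Suc i')
    have kz: "kos n z \<in> kch n i' i' e" using kos_kch z Suc by simp
    obtain a u where au: "a \<in> kch n i' i' e" "\<And>\<sigma>. a \<sigma> \<in> I" "u \<in> kch n i' (Suc i') e"
      "\<And>\<sigma>. kos n z \<sigma> = a \<sigma> + l * u \<sigma>"
      using addl_kch[OF I l kz] z(2) by blast
    have "kos n u \<sigma> \<in> I" for \<sigma>
    proof (cases i')
      case 0
      then have "kos n u = 0" using kos_kch_0 au(3) by blast
      then show ?thesis using hidealD(2)[OF I] by simp
    next
      case (Suc i'')
      have "kos n u \<in> kch n i'' i' e" using kos_kch[of u n i'' i' e] au(3) Suc by simp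
      then have s: "kos n u \<sigma> \<in> sforms n i' e" by (rule kchD)
      have "kos n z = (\<lambda>\<sigma>. a \<sigma> + l * u \<sigma>)" using au(4) by blast
      then have "kos n (kos n z) \<sigma> = kos n a \<sigma> + l * kos n u \<sigma>" by (simp add: kos_add kos_mult)
      moreover have "kos n (kos n z) \<sigma> = 0"
        using kos_kos_kch[of z n i' i' e] z(1) \<open>i = Suc i'\<close> by simp
      ultimately have "l * kos n u \<sigma> = - kos n a \<sigma>" by (simp add: eq_neg_iff_add_eq_0 add.commute)
      moreover have "kos n a \<sigma> \<in> I" by (rule hideal_kos[OF I au(2)])
      ultimately have "l * kos n u \<sigma> \<in> I" using hidealD(6)[OF I] by simp
      then show ?thesis using colon_trivial_sforms[OF C I s] e \<open>i = Suc i'\<close> by simp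
    qed
    \<comment> \<open>Absorbing the degree of l, u becomes an unshifted chain of index i - 1 and
      total degree e - 1, so the regularity bound is still met.\<close>
    moreover have u': "u \<in> kch n i' i' (e - 1)"
    proof -
      have "sforms n (Suc i') e = (sforms n i' (e - 1) :: 'a mpol set)"
      proof -
        have "i' \<le> e - 1" "Suc i' \<le> e" "e - Suc i' = e - 1 - i'" using e Suc by auto
        then show ?thesis unfolding sforms_eq by (simp only: if_True)
      qed
      then show ?thesis using au(3) by (simp add: kch_def)
    qed
    ultimately obtain v where v: "v \<in> kch n (Suc i') (Suc i') (e - 1)" "\<And>\<sigma>. u \<sigma> - kos n v \<sigma> \<in> I"
      using regD[OF R u'] e Suc by (metis Suc_eq_plus1 add_Suc le_diff_conv2 le_add2 plus_1_eq_Suc order_trans add_leD1)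
    have "sforms n (Suc i) e = (sforms n i (e - 1) :: 'a mpol set)"
    proof -
      have "i \<le> e - 1" "Suc i \<le> e" "e - Suc i = e - 1 - i" if "i < e" using that by auto
      moreover have "\<not> Suc i \<le> e" "e - 1 < i" "e - i = 0" if "\<not> i < e" using that e Suc by auto
      ultimately show ?thesis unfolding sforms_eq by (cases "i < e") auto
    qed
    then have "v \<in> kch n i (Suc i) e" using v(1) Suc by (simp add: kch_def)
    moreover have "kos n (\<lambda>\<sigma>. z \<sigma> - l * v \<sigma>) \<sigma> \<in> I" for \<sigma>
    proof -
      have "kos n (\<lambda>\<sigma>. z \<sigma> - l * v \<sigma>) \<sigma> = a \<sigma> + l * (u \<sigma> - kos n v \<sigma>)"
        by (simp add: kos_diff kos_mult au(4) algebra_simps)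
      then show ?thesis using au(2) hidealD(4)[OF I lp v(2)] hidealD(3)[OF I] by simp
    qed
    ultimately show ?thesis by blast
  qed
  then obtain v where v: "v \<in> kch n i (Suc i) e" "\<And>\<sigma>. kos n (\<lambda>\<sigma>. z \<sigma> - l * v \<sigma>) \<sigma> \<in> I" by blast
  have "(\<lambda>\<sigma>. z \<sigma> - l * v \<sigma>) \<in> kch n i i e"
    using kch_diff[OF z(1) kch_mult[OF l, of v i i e]] v(1) by simp
  then obtain w where w: "w \<in> kch n (Suc i) (Suc i) e" "\<And>\<sigma>. z \<sigma> - l * v \<sigma> - kos n w \<sigma> \<in> I"
    using regD[OF R _ v(2) e] by blast
  have "z \<sigma> - kos n w \<sigma> \<in> addl n I l" for \<sigma>
  proof -
    have "z \<sigma> - kos n w \<sigma> = (z \<sigma> - l * v \<sigma> - kos n w \<sigma>) + l * v \<sigma>" by simp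
    then show ?thesis unfolding addl_def using w(2) kchD(2)[OF v(1)] by blast
  qed
  then show "\<exists>w\<in>kch n (Suc i) (Suc i) e. \<forall>\<sigma>. z \<sigma> - kos n w \<sigma> \<in> addl n I l" using w(1) by blast
qed

text \<open>A variable acts as zero on Koszul homology, with homotopy \<open>wed r\<close>.\<close>

lemma reg_from_addl:
  assumes I: "hideal n I" and r: "r < n" and R: "reg n (addl n I (var r)) d" and C: "colon_trivial n I (var r) d"
  shows "reg n I d"
  unfolding reg_def
proof (intro allI impI ballI)
  fix i e and z :: "nat set \<Rightarrow> 'a mpol"
  assume e: "i + d \<le> e" and z: "z \<in> kch n i i e" "\<forall>\<sigma>. kos n z \<sigma> \<in> I"
  have l: "var r \<in> forms n 1" using r by simp
  have "\<And>\<sigma>. kos n z \<sigma> \<in> addl n I (var r)" using z(2) addl_superset by blast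
  then obtain w where w: "w \<in> kch n (Suc i) (Suc i) e" "\<And>\<sigma>. z \<sigma> - kos n w \<sigma> \<in> addl n I (var r)"
    using regD[OF R z(1) _ e] by blast
  have zw: "(\<lambda>\<sigma>. z \<sigma> - kos n w \<sigma>) \<in> kch n i i e" using z(1) kos_kch[OF w(1)] by (rule kch_diff)
  obtain a u where au: "a \<in> kch n i i e" "\<And>\<sigma>. a \<sigma> \<in> I" "u \<in> kch n i (Suc i) e"
      "\<And>\<sigma>. z \<sigma> - kos n w \<sigma> = a \<sigma> + var r * u \<sigma>"
    using addl_kch[OF I l zw w(2)] by blast
  have ka: "kos n a \<sigma> \<in> I" for \<sigma> by (rule hideal_kos[OF I au(2)])
  have ku: "kos n u \<sigma> \<in> I" for \<sigma>
  proof (cases i)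
    case 0
    then have "kos n u = 0" using kos_kch_0 au(3) by blast
    then show ?thesis using hidealD(2)[OF I] by simp
  next
    case (Suc i')
    have "kos n u \<in> kch n i' i e" using kos_kch[of u n i' i e] au(3) Suc by simp
    then have s: "kos n u \<sigma> \<in> sforms n i e" by (rule kchD)
    have "kos n (\<lambda>\<sigma>. z \<sigma> - kos n w \<sigma>) = kos n (\<lambda>\<sigma>. a \<sigma> + var r * u \<sigma>)" using au(4) by simp
    then have "kos n z \<sigma> - kos n (kos n w) \<sigma> = kos n a \<sigma> + var r * kos n u \<sigma>"
      by (simp only: kos_diff kos_add kos_mult fun_eq_iff)
    moreover have "kos n (kos n w) \<sigma> = 0" using kos_kos_kch[OF w(1)] by simp
    ultimately have "var r * kos n u \<sigma> = kos n z \<sigma> - kos n a \<sigma>" by simp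
    then have "var r * kos n u \<sigma> \<in> I" using hidealD(7)[OF I] z(2) ka by simp
    then show ?thesis using colon_trivial_sforms[OF C I s e] by blast
  qed
  \<comment> \<open>By the homotopy formula x_r u differs from the boundary of
    \<open>wed r u\<close> by \<open>wed r (kos n u)\<close>, whose coefficients lie in I.\<close>
  define w' where "w' = (\<lambda>\<sigma>. w \<sigma> + wed r u \<sigma>)"
  have "w' \<in> kch n (Suc i) (Suc i) e" unfolding w'_def using w(1) wed_kch[OF au(3) r] by (rule kch_add)
  moreover have "z \<sigma> - kos n w' \<sigma> \<in> I" for \<sigma>
  proof (cases "finite \<sigma>")
    case True
    have "z \<sigma> - kos n w' \<sigma> = a \<sigma> + (var r * u \<sigma> - kos n (wed r u) \<sigma>)"
      using au(4)[of \<sigma>] by (simp add: w'_def kos_add algebra_simps)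
    also have "\<dots> = a \<sigma> + wed r (kos n u) \<sigma>" using kos_wed[OF r True, of u] by (simp add: algebra_simps)
    also have "\<dots> \<in> I"
    proof -
      show ?thesis using au(2) ku hidealD(2,3,4)[OF I] by (simp add: wed_def)
    qed
    finally show ?thesis .
  next
    case False
    then have "\<not> \<sigma> \<subseteq> {..<n}" using finite_subset by blast
    then have "z \<sigma> = 0" "kos n w' \<sigma> = 0"
      using kchD(3)[OF z(1)] kchD(3)[OF kos_kch[OF \<open>w' \<in> _\<close>]] by auto
    then show ?thesis using hidealD(2)[OF I] by simp
  qed
  ultimately show "\<exists>w\<in>kch n (Suc i) (Suc i) e. \<forall>\<sigma>. z \<sigma> - kos n w \<sigma> \<in> I" by blast
qed

section \<open>Stable monomial ideals\<close>

definition mid :: "nat \<Rightarrow> mon set \<Rightarrow> 'k::field mpol set" where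
  "mid n U = {p \<in> polys n. ks p \<subseteq> U}"

definition upclosed :: "mon set \<Rightarrow> bool" where
  "upclosed U \<longleftrightarrow> (\<forall>a\<in>U. \<forall>b. a + b \<in> U)"

lemma hideal_mid:
  assumes "upclosed U"
  shows "hideal n (mid n U :: 'k::field mpol set)"
  unfolding hideal_def
proof (intro conjI ballI allI)
  show "mid n U \<subseteq> polys n" "0 \<in> mid n U" by (auto simp: mid_def)
  fix p :: "'k mpol" assume p: "p \<in> mid n U"
  show "p + q \<in> mid n U" if "q \<in> mid n U" for q
    using p that keys_add[of p q] by (auto simp: mid_def)
  show "hom_component e p \<in> mid n U" for e
    using p keys_hom_component[of e p] by (auto simp: mid_def)
  show "r * p \<in> mid n U" if r: "r \<in> polys n" for r
  proof -
    have "c \<in> U" if c: "c \<in> ks (r * p)" for c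
    proof -
      obtain a b where "c = a + b" "b \<in> ks p" using c keys_mult[of r p] by blast
      moreover have "b \<in> U" using p \<open>b \<in> ks p\<close> by (auto simp: mid_def)
      ultimately show ?thesis using assms unfolding upclosed_def by (metis add.commute)
    qed
    then show ?thesis using p r by (auto simp: mid_def)
  qed
qed

lemma lookup_var_mult: "lk (var r * p) (sg r 1 + b) = lk p b"
  by (simp add: var_def del: One_nat_def)

lemma single_le_mon: "r \<in> ks a \<Longrightarrow> \<exists>b. a = sg r 1 + b" for a :: mon
  by (subst mon_le_iff) (auto simp: lookup_single when_def in_keys_iff)

lemma addl_mid:
  assumes "upclosed U" and r: "r < n"
  shows "addl n (mid n U) (var r) = (mid n (U \<union> {a. r \<in> ks a}) :: 'k::field mpol set)"
proof
  show "addl n (mid n U) (var r) \<subseteq> (mid n (U \<union> {a. r \<in> ks a}) :: 'k mpol set)"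
  proof
    fix p :: "'k mpol" assume "p \<in> addl n (mid n U) (var r)"
    then obtain a u where p: "p = a + var r * u" "a \<in> mid n U" "u \<in> polys n" unfolding addl_def by blast
    have "c \<in> U \<or> r \<in> ks c" if "c \<in> ks p" for c
    proof -
      have "c \<in> ks a \<or> c \<in> ks (var r * u)" using that keys_add[of a "var r * u"] p(1) by blast
      moreover have "r \<in> ks c" if c: "c \<in> ks (var r * u)"
      proof -
        obtain x y where "c = x + y" "x \<in> ks (var r :: 'k mpol)" using c keys_mult[of "var r" u] by blast
        then show ?thesis by (simp add: var_def)
      qed
      ultimately show ?thesis using p(2) by (auto simp: mid_def)
    qed
    moreover have "p \<in> polys n" using p r by (simp add: mid_def)
    ultimately show "p \<in> mid n (U \<union> {a. r \<in> ks a})" by (auto simp: mid_def)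
  qed
  show "(mid n (U \<union> {a. r \<in> ks a}) :: 'k mpol set) \<subseteq> addl n (mid n U) (var r)"
  proof
    fix p :: "'k mpol" assume p: "p \<in> mid n (U \<union> {a. r \<in> ks a})"
    have I: "hideal n (addl n (mid n U) (var r :: 'k mpol))"
      by (rule hideal_addl[OF hideal_mid[OF assms(1)]]) (use r in simp)
    have "sg c (lk p c) \<in> addl n (mid n U) (var r)" if c: "c \<in> ks p" for c
    proof (cases "c \<in> U")
      case True
      have "sg c (lk p c) \<in> mid n U" using True c p by (auto simp: mid_def polys_def)
      then show ?thesis using addl_superset by blast
    next
      case False
      then obtain b where b: "c = sg r 1 + b" using c p single_le_mon[of r c] by (auto simp: mid_def)
      have kc: "ks c \<subseteq> {..<n}" using c p by (auto simp: mid_def polys_def)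
      have "sg c (lk p c) = var r * sg b (lk p c)" by (simp add: b var_def mult_single)
      moreover have "sg b (lk p c) \<in> polys n" using kc by (simp add: b)
      ultimately show ?thesis
        using addl_mult[OF hideal_mid[OF assms(1), of n], of "sg b (lk p c)" "var r"] by simp
    qed
    then have "(\<Sum>c\<in>ks p. sg c (lk p c)) \<in> addl n (mid n U) (var r)" by (rule hideal_sum[OF I])
    then show "p \<in> addl n (mid n U) (var r)" by (simp flip: poly_sum)
  qed
qed

lemma colon_trivial_mid:
  assumes "\<And>a. ks a \<subseteq> {..<n} \<Longrightarrow> d \<le> mdeg a \<Longrightarrow> sg r 1 + a \<in> U \<Longrightarrow> a \<in> U"
  shows "colon_trivial n (mid n U) (var r) d"
  unfolding colon_trivial_def
proof (intro allI impI ballI)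
  fix m and f :: "'k::field mpol" assume m: "d \<le> m" and f: "f \<in> forms n m" "var r * f \<in> mid n U"
  have "a \<in> U" if a: "a \<in> ks f" for a
  proof (rule assms)
    show "ks a \<subseteq> {..<n}" "d \<le> mdeg a" using f(1) a m by (auto simp: forms_def polys_def homog_def)
    have "lk (var r * f) (sg r 1 + a) \<noteq> 0" using a by (subst lookup_var_mult) (simp add: in_keys_iff)
    then show "sg r 1 + a \<in> U" using f(2) by (auto simp: mid_def in_keys_iff)
  qed
  then show "f \<in> mid n U" using f(1) by (auto simp: mid_def forms_def)
qed

text \<open>The monomials of the ideal generated by U and all x_s with s \<ge> r. In n variables r =
  n gives back U, and each decrease of r cuts by one more variable.\<close>

definition upr :: "mon set \<Rightarrow> nat \<Rightarrow> mon set" where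
  "upr U r = U \<union> {a. \<exists>s\<in>ks a. r \<le> s}"

lemma upclosed_upr: "upclosed U \<Longrightarrow> upclosed (upr U r)"
  by (auto simp: upclosed_def upr_def)

lemma addl_mid_upr:
  assumes "upclosed U" "r < n"
  shows "addl n (mid n (upr U (Suc r))) (var r) = mid n (upr U r)"
proof -
  have "upr U (Suc r) \<union> {a. r \<in> ks a} = upr U r"
  proof -
    have "(\<exists>s\<in>ks a. Suc r \<le> s) \<or> r \<in> ks a \<longleftrightarrow> (\<exists>s\<in>ks a. r \<le> s)" for a :: mon
      by (metis Suc_leD Suc_leI le_neq_implies_less order_refl)
    then show ?thesis unfolding upr_def by blast
  qed
  then show ?thesis by (simp add: addl_mid[OF upclosed_upr[OF assms(1)] assms(2)])
qed

lemma mid_upr_n: "mid n (upr U n) = mid n U"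
  by (fastforce simp: mid_def upr_def polys_def)

text \<open>The part of stability that cutting by variables requires: once all x_s with s > r are
  killed, x_r cancels in degrees at least d. The clause for d = 0 supplies the monomial 1, which
  contains no variable.\<close>

definition rstable :: "nat \<Rightarrow> mon set \<Rightarrow> nat \<Rightarrow> bool" where
  "rstable n U d \<longleftrightarrow> (d = 0 \<longrightarrow> 0 \<in> U) \<and>
     (\<forall>r<n. \<forall>a. ks a \<subseteq> {..r} \<longrightarrow> d \<le> mdeg a \<longrightarrow> sg r 1 + a \<in> U \<longrightarrow> a \<in> U)"

lemma colon_trivial_upr:
  assumes "rstable n U d" "r < n"
  shows "colon_trivial n (mid n (upr U (Suc r))) (var r) d"
proof (rule colon_trivial_mid)
  fix a assume a: "ks a \<subseteq> {..<n}" "d \<le> mdeg a" "sg r 1 + a \<in> upr U (Suc r)"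
  show "a \<in> upr U (Suc r)"
  proof (cases "\<exists>s\<in>ks a. Suc r \<le> s")
    case False
    then have "ks a \<subseteq> {..r}" by force
    moreover from this have "sg r 1 + a \<in> U" using a(3) by (auto simp: upr_def)
    ultimately show ?thesis using assms a(2) by (auto simp: rstable_def upr_def)
  qed (simp add: upr_def)
qed

lemma upr_0_superset:
  assumes "rstable n U d" "d \<le> mdeg a"
  shows "a \<in> upr U 0"
proof (cases "a = 0")
  case True
  then show ?thesis using assms by (simp add: rstable_def upr_def)
next
  case False
  then have "ks a \<noteq> {}" by simp
  then show ?thesis by (auto simp: upr_def)
qed

lemma forms_mid_upr_0: "rstable n U d \<Longrightarrow> d \<le> m \<Longrightarrow> forms n m \<subseteq> mid n (upr U 0)"
  using upr_0_superset by (auto simp: forms_def mid_def homog_def)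

lemma reg_if_forms:
  assumes "\<And>m. d \<le> m \<Longrightarrow> forms n m \<subseteq> I"
  shows "reg n I d"
  unfolding reg_def
proof (intro allI impI ballI)
  fix i e and z :: "nat set \<Rightarrow> 'a mpol"
  assume e: "i + d \<le> e" and z: "z \<in> kch n i i e"
  have "z \<sigma> - kos n (\<lambda>_. 0) \<sigma> \<in> I" for \<sigma>
    using kchD(1)[OF z, of \<sigma>] e assms[of "e - i"] by (simp add: sforms_eq subset_iff)
  then show "\<exists>w\<in>kch n (Suc i) (Suc i) e. \<forall>\<sigma>. z \<sigma> - kos n w \<sigma> \<in> I"
    by (intro bexI[of _ "\<lambda>_. 0"]) auto
qed

text \<open>The induction starts at r = 0, where the quotient vanishes in all degrees at least d,
  and restores one variable at a time by \<open>reg_from_addl\<close>.\<close>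

lemma reg_mid:
  assumes U: "upclosed U" "rstable n U d"
  shows "reg n (mid n U :: 'k::field mpol set) d"
proof -
  have "r \<le> n \<Longrightarrow> reg n (mid n (upr U r) :: 'k mpol set) d" for r
  proof (induction r)
    case 0
    show ?case by (rule reg_if_forms) (rule forms_mid_upr_0[OF U(2)])
  next
    case (Suc r)
    then have r: "r < n" by simp
    show ?case
      by (rule reg_from_addl[OF hideal_mid[OF upclosed_upr[OF U(1)]] r _ colon_trivial_upr[OF U(2) r]])
         (use Suc r in \<open>simp add: addl_mid_upr[OF U(1)]\<close>)
  qed
  from this[of n] show ?thesis by (simp add: mid_upr_n)
qed

section \<open>Exactness of the Koszul complex of S\<close>

lemma mid_empty: "mid n {} = {0}"
  by (auto simp: mid_def)

text \<open>The empty set of monomials is stable for d = 1, so acyclicity of the Koszul complex of S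
  drops out of the theory of stable ideals. The bound is 1 because constants survive in the homology
  of index 0.\<close>

lemma reg_zero: "reg n {0 :: 'k::field mpol} 1"
  using reg_mid[of "{}" n 1] by (simp add: mid_empty upclosed_def rstable_def)

text \<open>Constant coefficients lie outside the range of \<open>reg_zero\<close>. At \<sigma> -
  {j} the coefficient of x_j in the differential is the constant z \<sigma> up to sign, as no other
  index contributes to x_j.\<close>

lemma kos_const_injective:
  assumes z: "z \<in> kch n (Suc i) q q" and kz: "kos n z = 0"
  shows "z = 0"
proof
  fix \<sigma>
  show "z \<sigma> = 0 \<sigma>"
  proof (rule ccontr)
    assume nz: "z \<sigma> \<noteq> 0 \<sigma>"
    then have \<sigma>: "\<sigma> \<subseteq> {..<n}" "card \<sigma> = Suc i"
      using kchD(3)[OF z, of \<sigma>] kchD(4)[OF z, of \<sigma>] by fastforce+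
    then obtain j where j: "j \<in> \<sigma>" by fastforce
    define \<tau> where "\<tau> = \<sigma> - {j}"
    have \<sigma>': "insert j \<tau> = \<sigma>" "j \<notin> \<tau>" "j < n" using j \<sigma> by (auto simp: \<tau>_def)
    have const: "z \<rho> = sg 0 (lk (z \<rho>) 0)" for \<rho>
      using kchD(1)[OF z, of \<rho>] by (intro forms_0_const[of _ n]) (simp add: sforms_eq)
    have lkv: "lk (ksgn j' \<tau> * (var j' * z (insert j' \<tau>))) (sg j 1) =
        (if j' = j then lk (ksgn j \<tau> * (var j * z \<sigma>)) (sg j 1) else 0)" for j'
    proof (cases "j' = j")
      case False
      have "ksgn j' \<tau> * (var j' * z (insert j' \<tau>)) = var j' * (ksgn j' \<tau> * z (insert j' \<tau>))"
        by (rule mult.left_commute)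
      moreover have "\<nexists>b. sg j 1 = sg j' (1::nat) + b"
      proof
        assume "\<exists>b. sg j 1 = sg j' (1::nat) + b"
        then obtain b where "sg j 1 = sg j' (1::nat) + b" by blast
        then have "lk (sg j 1) j' = lk (sg j' (1::nat) + b) j'" by simp
        then show False using False by (simp add: lookup_add lookup_single when_def)
      qed
      ultimately show ?thesis using False by (simp only: var_def lookup_single_mult if_False)
    qed (simp add: \<sigma>')
    have "lk (kos n z \<tau>) (sg j 1) = lk (ksgn j \<tau> * (var j * z \<sigma>)) (sg j 1)"
      using \<sigma>' by (simp add: kos_def lookup_sum lkv del: One_nat_def)
    also have "ksgn j \<tau> * (var j * z \<sigma>) = var j * (ksgn j \<tau> * z \<sigma>)" by (rule mult.left_commute)
    also have "lk \<dots> (sg j 1) = lk (ksgn j \<tau> * z \<sigma>) 0"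
      using lookup_var_mult[of j "ksgn j \<tau> * z \<sigma>" 0] by simp
    finally have "lk (ksgn j \<tau> * z \<sigma>) 0 = 0" using kz by simp
    moreover have "ksgn j \<tau> * z \<sigma> = z \<sigma> \<or> ksgn j \<tau> * z \<sigma> = - z \<sigma>"
      by (cases "even (card {s \<in> \<tau>. s < j})") (simp_all add: ksgn_def)
    ultimately have "lk (z \<sigma>) 0 = 0" by auto
    then have "z \<sigma> = 0" using const[of \<sigma>] by simp
    then show False using nz by simp
  qed
qed

lemma kch_shift:
  assumes "q \<le> e"
  shows "kch n i q e = kch n i q' (q' + e - q)"
proof -
  have "q' \<le> q' + e - q" "q' + e - q - q' = e - q" using assms by auto
  then show ?thesis unfolding kch_def sforms_eq using assms by simp
qed

text \<open>\<open>reg_zero\<close> covers q < e; for q = e the coefficients are constants and the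
  kernel is trivial; for e < q there are no nonzero chains. Index 0 with q = e, where the homology
  is K, is excluded by \<open>pos\<close>.\<close>

lemma kos_exact:
  assumes z: "z \<in> kch n i q e" and kz: "kos n z = 0" and pos: "0 < i \<or> q < e"
  shows "\<exists>w\<in>kch n (Suc i) (Suc q) e. kos n w = z"
proof -
  consider "q < e" | "q = e" | "e < q" by linarith
  then show ?thesis
  proof cases
    case 1
    then have qe: "q \<le> e" "Suc q \<le> e" by simp_all
    have z': "z \<in> kch n i i (i + e - q)" using z unfolding kch_shift[OF qe(1), of n i i] .
    obtain w where w: "w \<in> kch n (Suc i) (Suc i) (i + e - q)" "\<And>\<sigma>. z \<sigma> - kos n w \<sigma> \<in> {0}"
      by (rule regD[OF reg_zero z']) (use kz 1 in simp_all)
    have "w \<in> kch n (Suc i) (Suc q) e" using w(1) unfolding kch_shift[OF qe(2), of n "Suc i" "Suc i"] by simp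
    moreover have "kos n w = z" using w(2) by (intro ext) simp
    ultimately show ?thesis by blast
  next
    case 2
    then obtain i' where i': "i = Suc i'" using pos gr0_implies_Suc by auto
    have "z = 0" by (rule kos_const_injective[of z n i' q]) (use z kz i' 2 in simp_all)
    then show ?thesis by (intro bexI[of _ 0]) simp_all
  next
    case 3
    have "z \<sigma> = 0" for \<sigma> using kchD(1)[OF z, of \<sigma>] 3 by (simp add: sforms_eq)
    then have "z = 0" by (intro ext) simp
    then show ?thesis by (intro bexI[of _ 0]) simp_all
  qed
qed

lemma kos_exact_0:
  assumes z: "z \<in> kch n 0 q e" and c: "\<And>\<sigma>. lk (z \<sigma>) 0 = 0"
  shows "\<exists>w\<in>kch n (Suc 0) (Suc q) e. kos n w = z"
proof (cases "q = e")
  case True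
  have "z \<sigma> = 0" for \<sigma>
    using kchD(1)[OF z, of \<sigma>] forms_0_const[of "z \<sigma>" n] c[of \<sigma>] by (simp add: True sforms_eq)
  then have "z = 0" by (intro ext) simp
  then show ?thesis by (intro bexI[of _ 0]) simp_all
next
  case False
  show ?thesis
  proof (cases "q < e")
    case True
    then show ?thesis using kos_exact[OF z kos_kch_0[OF z]] by simp
  next
    case False
    have "z \<sigma> = 0" for \<sigma> using kchD(1)[OF z, of \<sigma>] False \<open>q \<noteq> e\<close> by (simp add: sforms_eq)
    then have "z = 0" by (intro ext) simp
    then show ?thesis by (intro bexI[of _ 0]) simp_all
  qed
qed

section \<open>Finite generation of graded modules\<close>

text \<open>Every sequence has a monotone subsequence, and a decreasing sequence of naturals is
  eventually constant, so a tail of it is increasing as well.\<close>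

lemma nat_seq_incseq_sub:
  fixes s :: "nat \<Rightarrow> nat"
  shows "\<exists>\<psi>. strict_mono \<psi> \<and> incseq (\<lambda>i. s (\<psi> i))"
proof -
  obtain \<psi> where \<psi>: "strict_mono \<psi>" "monoseq (\<lambda>i. s (\<psi> i))" using seq_monosub by blast
  show ?thesis
  proof (cases "incseq (\<lambda>i. s (\<psi> i))")
    case False
    then have dec: "decseq (\<lambda>i. s (\<psi> i))" using \<psi>(2) by (simp add: monoseq_iff)
    define m where "m = (LEAST m. m \<in> range (\<lambda>i. s (\<psi> i)))"
    have "m \<in> range (\<lambda>i. s (\<psi> i))" unfolding m_def by (rule LeastI[of _ "s (\<psi> 0)"]) simp
    then obtain N where N: "m = s (\<psi> N)" by blast
    have "s (\<psi> (N + i)) = m" for i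
    proof (rule antisym)
      show "s (\<psi> (N + i)) \<le> m" using decseqD[OF dec, of N "N + i"] N by simp
      show "m \<le> s (\<psi> (N + i))" unfolding m_def by (rule Least_le) simp
    qed
    then have "incseq (\<lambda>i. s (\<psi> (N + i)))" by (simp add: incseq_def)
    moreover have "strict_mono (\<lambda>i. \<psi> (N + i))" using \<psi>(1) by (simp add: strict_mono_def)
    ultimately show ?thesis by blast
  qed (use \<psi> in blast)
qed

lemma mon_seq_incseq_sub:
  fixes f :: "nat \<Rightarrow> mon"
  shows "\<exists>\<phi>. strict_mono \<phi> \<and> (\<forall>r<n. incseq (\<lambda>i. lk (f (\<phi> i)) r))"
proof (induction n)
  case 0
  have "strict_mono (\<lambda>i::nat. i)" by (simp add: strict_mono_def)
  then show ?case by auto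
next
  case (Suc n)
  then obtain \<phi> where \<phi>: "strict_mono \<phi>" "\<forall>r<n. incseq (\<lambda>i. lk (f (\<phi> i)) r)" by blast
  obtain \<psi> where \<psi>: "strict_mono \<psi>" "incseq (\<lambda>i. lk (f (\<phi> (\<psi> i))) n)"
    using nat_seq_incseq_sub[of "\<lambda>i. lk (f (\<phi> i)) n"] by blast
  have "incseq (\<lambda>i. lk (f (\<phi> (\<psi> i))) r)" if "r < Suc n" for r
  proof (cases "r = n")
    case False
    then have "incseq (\<lambda>i. lk (f (\<phi> i)) r)" using \<phi> that by simp
    then show ?thesis using \<psi>(1) by (simp add: incseq_def strict_mono_less_eq)
  qed (use \<psi> in simp)
  moreover have "strict_mono (\<lambda>i. \<phi> (\<psi> i))" using \<phi>(1) \<psi>(1) by (simp add: strict_mono_def)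
  ultimately show ?case by blast
qed

text \<open>The members minimal for divisibility are pairwise incomparable, whereas an infinite
  sequence of them would have a subsequence increasing in each of the n coordinates.\<close>

lemma dickson:
  fixes L :: "mon set"
  assumes "\<And>a. a \<in> L \<Longrightarrow> ks a \<subseteq> {..<n}"
  obtains B where "finite B" "B \<subseteq> L" "\<And>a. a \<in> L \<Longrightarrow> \<exists>b\<in>B. \<exists>c. a = b + c"
proof -
  define B where "B = {b\<in>L. \<forall>b'\<in>L. (\<exists>c. b = b' + c) \<longrightarrow> b' = b}"
  have finB: "finite B"
  proof (rule ccontr)
    assume "infinite B"
    then obtain f :: "nat \<Rightarrow> mon" where f: "inj f" "range f \<subseteq> B" using infinite_countable_subset by blast
    obtain \<phi> where \<phi>: "strict_mono \<phi>" "\<forall>r<n. incseq (\<lambda>i. lk (f (\<phi> i)) r)"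
      using mon_seq_incseq_sub by blast
    have fB: "f i \<in> B" for i using f(2) by blast
    have "lk (f (\<phi> 0)) r \<le> lk (f (\<phi> 1)) r" for r
    proof (cases "r < n")
      case True
      then show ?thesis using \<phi>(2) incseqD[of "\<lambda>i. lk (f (\<phi> i)) r" 0 1] by simp
    next
      case False
      have "ks (f (\<phi> 0)) \<subseteq> {..<n}" by (rule assms) (use fB B_def in blast)
      then have "r \<notin> ks (f (\<phi> 0))" using False by auto
      then show ?thesis by (simp add: in_keys_iff)
    qed
    then have "\<exists>c. f (\<phi> 1) = f (\<phi> 0) + c" by (simp add: mon_le_iff)
    then have "f (\<phi> 0) = f (\<phi> 1)" using fB[of "\<phi> 0"] fB[of "\<phi> 1"] unfolding B_def by blast
    then show False using f(1) \<phi>(1) by (metis inj_eq strict_mono_eq zero_neq_one)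
  qed
  have subB: "B \<subseteq> L" by (auto simp: B_def)
  have minB: "mdeg a = m \<Longrightarrow> a \<in> L \<Longrightarrow> \<exists>b\<in>B. \<exists>c. a = b + c" for a m
  proof (induction m arbitrary: a rule: less_induct)
    case (less m)
    show ?case
    proof (cases "a \<in> B")
      case True
      then show ?thesis by (intro bexI[of _ a] exI[of _ 0]) simp_all
    next
      case False
      then obtain b c where b: "b \<in> L" "a = b + c" "b \<noteq> a" using less.prems unfolding B_def by blast
      have "c \<noteq> 0" using b(2,3) by auto
      then have "0 < mdeg c" by (metis mdeg_eq_0_iff gr0I)
      then have "mdeg b < m" using b(2) less.prems(1) by simp
      from less.IH[OF this refl b(1)] obtain b' c' where "b' \<in> B" "b = b' + c'" by blast
      then have "a = b' + (c' + c)" using b(2) by (simp add: add.assoc)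
      then show ?thesis using \<open>b' \<in> B\<close> by blast
    qed
  qed
  show ?thesis by (rule that[OF finB subB minB[OF refl]])
qed

text \<open>Dickson's lemma selects finitely many homogeneous elements whose leading monomials
  divide all others, and division by these terminates. Division stays within one degree, which has
  finitely many monomials, so the induction counts those below the leading one instead of using a
  well-order.\<close>

lemma ideal_finitely_generated:
  fixes J :: "'k::field mpol set"
  assumes J: "hideal n J"
  shows "\<exists>G. finite G \<and> G \<subseteq> J \<and> (\<forall>g\<in>G. \<exists>e. g \<in> forms n e) \<and>
    (\<forall>p\<in>J. \<exists>f. (\<forall>g. f g \<in> polys n) \<and> p = (\<Sum>g\<in>G. f g * g))"
proof -
  \<comment> \<open>\<open>Max\<close> refers to the linear order that the type of monomials
    carries; what matters is its compatibility with addition.\<close>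
  define lm where "lm p = Max (ks p)" for p :: "'k mpol"
  define H where "H = {p\<in>J. p \<noteq> 0 \<and> (\<exists>e. p \<in> forms n e)}"
  have lmk: "lm p \<in> ks p" if "p \<noteq> 0" for p using that unfolding lm_def by (intro Max_in) auto
  have "ks a \<subseteq> {..<n}" if "a \<in> lm ` H" for a
    using that lmk by (fastforce simp: H_def forms_def polys_def)
  then obtain B where B: "finite B" "B \<subseteq> lm ` H" "\<And>a. a \<in> lm ` H \<Longrightarrow> \<exists>b\<in>B. \<exists>c. a = b + c"
    using dickson by metis
  obtain G where G: "G \<subseteq> H" "finite G" "B = lm ` G" using finite_subset_image[OF B(1,2)] by metis
  define gen where "gen p \<longleftrightarrow> (\<exists>f. (\<forall>g. f g \<in> polys n) \<and> p = (\<Sum>g\<in>G. f g * g))" for p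
  have gen0: "gen 0" unfolding gen_def by (intro exI[of _ "\<lambda>_. 0"]) simp
  have gen_add: "gen (p + q)" if pq: "gen p" "gen q" for p q
  proof -
    obtain f f' where "\<forall>g. f g \<in> polys n" "p = (\<Sum>g\<in>G. f g * g)" "\<forall>g. f' g \<in> polys n" "q = (\<Sum>g\<in>G. f' g * g)"
      using pq unfolding gen_def by blast
    then show ?thesis unfolding gen_def
      by (intro exI[of _ "\<lambda>g. f g + f' g"]) (simp add: algebra_simps sum.distrib)
  qed
  have gen_mult: "gen (r * g)" if "r \<in> polys n" "g \<in> G" for r g
    unfolding gen_def using that G(2)
    by (intro exI[of _ "\<lambda>g'. if g' = g then r else 0"]) (simp add: if_distrib[of "\<lambda>x. x * _"] cong: if_cong)
  have homcase: "p \<in> J \<Longrightarrow> p \<in> forms n e \<Longrightarrow> card {a\<in>monomials n e. a < lm p} = m \<Longrightarrow> gen p" for p e m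
  proof (induction m arbitrary: p rule: less_induct)
    case (less m)
    show ?case
    proof (cases "p = 0")
      case False
      then have "p \<in> H" using less.prems by (auto simp: H_def)
      then obtain g c where g: "g \<in> G" "lm p = lm g + c" using B(3)[of "lm p"] G(3) by blast
      have gH: "g \<noteq> 0" "g \<in> J" using g(1) G(1) by (auto simp: H_def)
      obtain e' where e': "g \<in> forms n e'" using g(1) G(1) by (auto simp: H_def)
      define t where "t = sg c (lk p (lm p) / lk g (lm g))"
      define q where "q = p - t * g"
      have dl: "mdeg (lm p) = e" "ks (lm p) \<subseteq> {..<n}"
        using lmk[OF False] less.prems(2) by (auto simp: forms_def homog_def polys_def)
      have "mdeg (lm g) = e'" using lmk[OF gH(1)] e' by (auto simp: forms_def homog_def)
      then have e: "e = mdeg c + e'" using dl(1) g(2) by simp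
      have t: "t \<in> forms n (mdeg c)" "t \<in> polys n"
        using dl(2) g(2) by (simp_all add: t_def forms_def homog_single)
      have tg: "t * g \<in> forms n e" using forms_mult[OF t(1) e'] e by simp
      have qf: "q \<in> forms n e" unfolding q_def using less.prems(2) tg by (rule forms_diff)
      have qJ: "q \<in> J" unfolding q_def by (rule hidealD(7)[OF J less.prems(1) hidealD(4)[OF J t(2) gH(2)]])
      have small: "a < lm p" if a: "a \<in> ks q" for a
      proof -
        have "a \<le> lm p"
        proof -
          have "a \<in> ks p \<or> a \<in> ks (t * g)" using a by (auto simp: q_def in_keys_iff lookup_minus)
          then show ?thesis
          proof
            assume "a \<in> ks p"
            then show ?thesis by (simp add: lm_def)
          next
            assume "a \<in> ks (t * g)"
            then obtain x y where xy: "a = x + y" "x \<in> ks t" "y \<in> ks g" using keys_mult[of t g] by blast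
            then have "x = c" "y \<le> lm g" by (auto simp: t_def lm_def split: if_splits)
            then show ?thesis using xy(1) g(2) by (simp add: add.commute)
          qed
        qed
        moreover have "lk q (lm p) = 0"
        proof -
          have "lk (t * g) (c + lm g) = lk p (lm p) / lk g (lm g) * lk g (lm g)"
            unfolding t_def by (rule lookup_single_mult_add)
          moreover have "lk g (lm g) \<noteq> 0" using lmk[OF gH(1)] by (simp add: in_keys_iff)
          ultimately show ?thesis using g(2) by (simp add: q_def lookup_minus add.commute)
        qed
        then have "a \<noteq> lm p" using a by (auto simp: in_keys_iff)
        ultimately show ?thesis by simp
      qed
      have "gen q"
      proof (cases "q = 0")
        case False
        have "lm q < lm p" using small[OF lmk[OF False]] .
        have "{a\<in>monomials n e. a < lm q} \<subset> {a\<in>monomials n e. a < lm p}"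
        proof
          show "{a\<in>monomials n e. a < lm q} \<subseteq> {a\<in>monomials n e. a < lm p}"
            using \<open>lm q < lm p\<close> by auto
          have "lm q \<in> monomials n e" using lmk[OF False] qf by (auto simp: forms_eq)
          then show "{a\<in>monomials n e. a < lm q} \<noteq> {a\<in>monomials n e. a < lm p}"
            using \<open>lm q < lm p\<close> by blast
        qed
        then have "card {a\<in>monomials n e. a < lm q} < m"
          unfolding less.prems(3)[symmetric] by (intro psubset_card_mono) (simp_all add: finite_monomials)
        from less.IH[OF this qJ qf refl] show ?thesis .
      qed (simp add: gen0)
      from gen_add[OF this gen_mult[OF t(2) g(1)]] show ?thesis by (simp add: q_def)
    qed (simp add: gen0)
  qed
  have "gen p" if p: "p \<in> J" for p
  proof -
    have "gen (hom_component e p)" for e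
      by (rule homcase[OF hidealD(5)[OF J p] _ refl, of e e])
         (use hidealD(1)[OF J p] in \<open>simp add: forms_def homog_hom_component\<close>)
    then have "gen (sum (\<lambda>e. hom_component e p) E)" for E
      by (induction E rule: infinite_finite_induct) (simp_all add: gen0 gen_add)
    then have "gen (\<Sum>e\<in>mdeg ` ks p. hom_component e p)" .
    moreover have "p = (\<Sum>e\<in>mdeg ` ks p. hom_component e p)" by (rule sum_hom_component) auto
    ultimately show ?thesis by simp
  qed
  then have "\<forall>p\<in>J. \<exists>f. (\<forall>g. f g \<in> polys n) \<and> p = (\<Sum>g\<in>G. f g * g)" unfolding gen_def by blast
  moreover have "G \<subseteq> J" "\<forall>g\<in>G. \<exists>e. g \<in> forms n e" using G(1) by (auto simp: H_def)
  ultimately show ?thesis using G(2) by blast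
qed

section \<open>Graded submodules of free modules\<close>

definition vcomp :: "(nat \<Rightarrow> nat) \<Rightarrow> nat \<Rightarrow> (nat \<Rightarrow> 'k::field mpol) \<Rightarrow> nat \<Rightarrow> 'k mpol" where
  "vcomp s e v = (\<lambda>b. if s b \<le> e then hom_component (e - s b) (v b) else 0)"

text \<open>Graded submodules of the sum of the S(-s b) for b < r, again as closure conditions;
  \<open>vcomp\<close> takes components with respect to these shifts.\<close>

definition gsub :: "nat \<Rightarrow> nat \<Rightarrow> (nat \<Rightarrow> nat) \<Rightarrow> (nat \<Rightarrow> 'k::field mpol) set \<Rightarrow> bool" where
  "gsub n r s Z \<longleftrightarrow> Z \<subseteq> free_module n r \<and> 0 \<in> Z \<and> (\<forall>v\<in>Z. \<forall>w\<in>Z. (\<lambda>b. v b + w b) \<in> Z) \<and>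
     (\<forall>p\<in>polys n. \<forall>v\<in>Z. (\<lambda>b. p * v b) \<in> Z) \<and> (\<forall>v\<in>Z. \<forall>e. vcomp s e v \<in> Z)"

lemma gsubD:
  assumes "gsub n r s Z"
  shows "v \<in> Z \<Longrightarrow> v \<in> free_module n r" "0 \<in> Z" "v \<in> Z \<Longrightarrow> w \<in> Z \<Longrightarrow> (\<lambda>b. v b + w b) \<in> Z"
    "p \<in> polys n \<Longrightarrow> v \<in> Z \<Longrightarrow> (\<lambda>b. p * v b) \<in> Z" "v \<in> Z \<Longrightarrow> vcomp s e v \<in> Z"
  using assms by (auto simp: gsub_def)

lemma free_moduleD: "v \<in> free_module n r \<Longrightarrow> v b \<in> polys n" "v \<in> free_module n r \<Longrightarrow> r \<le> b \<Longrightarrow> v b = 0"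
  unfolding free_module_def carrier_poly_ring by (cases "b < r"; simp)+

lemma free_moduleI: "(\<And>b. v b \<in> polys n) \<Longrightarrow> (\<And>b. r \<le> b \<Longrightarrow> v b = 0) \<Longrightarrow> v \<in> free_module n r"
  unfolding free_module_def carrier_poly_ring by simp

lemma gsub_sum:
  assumes "gsub n r s Z" "\<And>i. i \<in> A \<Longrightarrow> f i \<in> polys n \<and> v i \<in> Z"
  shows "(\<lambda>b. \<Sum>i\<in>A. f i * v i b) \<in> Z"
  using assms(2)
proof (induction A rule: infinite_finite_induct)
  case (insert i A)
  have "(\<lambda>b. f i * v i b) \<in> Z" using gsubD(4)[OF assms(1)] insert.prems by simp
  from gsubD(3)[OF assms(1) this insert.IH] show ?case using insert by simp
qed (use gsubD(2)[OF assms(1)] in \<open>simp_all add: zero_fun_def\<close>)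

text \<open>Induction on the rank: elements with vanishing last coordinate form a submodule of
  smaller rank, and the last coordinates form a graded ideal, whose generators are lifted
  back.\<close>

lemma gsub_finitely_generated:
  fixes Z :: "(nat \<Rightarrow> 'k::field mpol) set"
  assumes "gsub n r s Z"
  shows "\<exists>G. finite G \<and> G \<subseteq> Z \<and> (\<forall>g\<in>G. \<exists>e. \<forall>b. g b \<in> sforms n (s b) e) \<and>
    (\<forall>v\<in>Z. \<exists>f. (\<forall>g. f g \<in> polys n) \<and> v = (\<lambda>b. \<Sum>g\<in>G. f g * g b))"
  using assms
proof (induction r arbitrary: Z)
  case 0
  have "v = (\<lambda>b. 0)" if "v \<in> Z" for v
    using free_moduleD(2)[OF gsubD(1)[OF 0 that]] by (intro ext) simp
  then show ?case by (intro exI[of _ "{}"]) (auto intro!: exI[of _ "\<lambda>_. 0"])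
next
  case (Suc r)
  note Z = Suc.prems
  define Z' where "Z' = {v\<in>Z. v r = 0}"
  have "gsub n r s Z'"
    unfolding gsub_def
  proof (intro conjI ballI allI subsetI)
    fix v assume v: "v \<in> Z'"
    then have vZ: "v \<in> Z" "v r = 0" by (auto simp: Z'_def)
    show "v \<in> free_module n r"
    proof (rule free_moduleI)
      show "v b \<in> polys n" for b by (rule free_moduleD(1)[OF gsubD(1)[OF Z vZ(1)]])
      show "v b = 0" if "r \<le> b" for b
        using free_moduleD(2)[OF gsubD(1)[OF Z vZ(1)], of b] vZ(2) that by (cases "b = r") simp_all
    qed
    show "vcomp s e v \<in> Z'" for e using gsubD(5)[OF Z vZ(1), of e] vZ(2) by (simp add: Z'_def vcomp_def)
    show "(\<lambda>b. v b + w b) \<in> Z'" if "w \<in> Z'" for w using gsubD(3)[OF Z] vZ that by (simp add: Z'_def)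
    show "(\<lambda>b. p * v b) \<in> Z'" if "p \<in> polys n" for p using gsubD(4)[OF Z] vZ that by (simp add: Z'_def)
  qed (use gsubD(2)[OF Z] in \<open>simp add: Z'_def\<close>)
  from Suc.IH[OF this] obtain G' where G': "finite G'" "G' \<subseteq> Z'" "\<forall>g\<in>G'. \<exists>e. \<forall>b. g b \<in> sforms n (s b) e"
    "\<forall>v\<in>Z'. \<exists>f. (\<forall>g. f g \<in> polys n) \<and> v = (\<lambda>b. \<Sum>g\<in>G'. f g * g b)" by blast
  define J where "J = (\<lambda>v. v r) ` Z"
  have J: "hideal n J"
    unfolding hideal_def
  proof (intro conjI ballI allI subsetI)
    show "0 \<in> J" using gsubD(2)[OF Z] unfolding J_def by (auto intro!: image_eqI[of _ _ 0])
    fix p assume "p \<in> J"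
    then obtain v where v: "v \<in> Z" "p = v r" unfolding J_def by blast
    show "p \<in> polys n" using free_moduleD(1)[OF gsubD(1)[OF Z v(1)]] v(2) by simp
    show "p + q \<in> J" if q: "q \<in> J" for q
    proof -
      obtain w where w: "w \<in> Z" "q = w r" using q unfolding J_def by blast
      show ?thesis unfolding J_def using gsubD(3)[OF Z v(1) w(1)] v(2) w(2) by force
    qed
    show "x * p \<in> J" if "x \<in> polys n" for x
      unfolding J_def using gsubD(4)[OF Z that v(1)] v(2) by force
    show "hom_component e p \<in> J" for e
      unfolding J_def using gsubD(5)[OF Z v(1), of "e + s r"] v(2)
      by (intro image_eqI[of _ _ "vcomp s (e + s r) v"]) (simp_all add: vcomp_def)
  qed
  from ideal_finitely_generated[OF J] obtain H where H: "finite H" "H \<subseteq> J" "\<forall>g\<in>H. \<exists>e. g \<in> forms n e"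
    "\<forall>p\<in>J. \<exists>f. (\<forall>g. f g \<in> polys n) \<and> p = (\<Sum>g\<in>H. f g * g)"
    by (elim exE conjE)
  have "\<exists>v. v \<in> Z \<and> v r = h \<and> (\<exists>e. \<forall>b. v b \<in> sforms n (s b) e)" if h: "h \<in> H" for h
  proof -
    obtain e where e: "h \<in> forms n e" using H(3) h by blast
    obtain v where v: "v \<in> Z" "h = v r" using h H(2) unfolding J_def by blast
    \<comment> \<open>The component of degree \<open>e + s r\<close> is homogeneous and keeps h, of
      degree e, as its last coordinate.\<close>
    have 1: "vcomp s (e + s r) v \<in> Z" by (rule gsubD(5)[OF Z v(1)])
    have 2: "vcomp s (e + s r) v r = h" using e v(2) by (simp add: vcomp_def forms_def hom_component_homog[of e])
    have 3: "vcomp s (e + s r) v b \<in> sforms n (s b) (e + s r)" for b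
      using free_moduleD(1)[OF gsubD(1)[OF Z v(1)], of b]
      by (simp add: vcomp_def sforms_eq forms_def homog_hom_component)
    show ?thesis using 1 2 3 by blast
  qed
  then have "\<forall>h\<in>H. \<exists>v. v \<in> Z \<and> v r = h \<and> (\<exists>e. \<forall>b. v b \<in> sforms n (s b) e)" by blast
  from bchoice[OF this] obtain lift where
    "\<forall>h\<in>H. lift h \<in> Z \<and> lift h r = h \<and> (\<exists>e. \<forall>b. lift h b \<in> sforms n (s b) e)" by (rule exE)
  then have lift: "h \<in> H \<Longrightarrow> lift h \<in> Z \<and> lift h r = h \<and> (\<exists>e. \<forall>b. lift h b \<in> sforms n (s b) e)" for h
    by blast
  have inj: "inj_on lift H" using lift by (metis inj_onI)
  \<comment> \<open>Lifts of nonzero generators have a nonzero last coordinate; omitting h = 0 makes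
    the two sets of generators disjoint.\<close>
  have disj: "G' \<inter> lift ` (H - {0}) = {}" using G'(2) lift by (force simp: Z'_def)
  define G where "G = G' \<union> lift ` (H - {0})"
  have "\<exists>f. (\<forall>g. f g \<in> polys n) \<and> v = (\<lambda>b. \<Sum>g\<in>G. f g * g b)" if v: "v \<in> Z" for v
  proof -
    have "v r \<in> J" using v by (simp add: J_def)
    then obtain f where f: "\<forall>g. f g \<in> polys n" "v r = (\<Sum>g\<in>H. f g * g)" using H(4) by blast
    define w where "w = (\<lambda>b. v b + (-1) * (\<Sum>h\<in>H - {0}. f h * lift h b))"
    have 1: "(\<lambda>b. \<Sum>h\<in>H - {0}. f h * lift h b) \<in> Z" by (rule gsub_sum[OF Z]) (use f lift in blast)
    have "w \<in> Z" unfolding w_def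
      by (rule gsubD(3)[OF Z v gsubD(4)[OF Z _ 1]]) simp
    moreover have "w r = 0"
    proof -
      have "(\<Sum>h\<in>H - {0}. f h * lift h r) = (\<Sum>h\<in>H - {0}. f h * h)" using lift by (intro sum.cong) simp_all
      also have "\<dots> = (\<Sum>h\<in>H. f h * h)" using H(1) by (intro sum.mono_neutral_left) auto
      finally show ?thesis using f(2) by (simp add: w_def)
    qed
    ultimately have "w \<in> Z'" by (simp add: Z'_def)
    then obtain f' where f': "\<forall>g. f' g \<in> polys n" "w = (\<lambda>b. \<Sum>g\<in>G'. f' g * g b)" using G'(4) by blast
    define F where "F g = (if g \<in> G' then f' g else f (g r))" for g
    have "v b = (\<Sum>g\<in>G. F g * g b)" for b
    proof -
      have "(\<Sum>g\<in>G. F g * g b) = (\<Sum>g\<in>G'. F g * g b) + (\<Sum>g\<in>lift ` (H - {0}). F g * g b)"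
        unfolding G_def using G'(1) H(1) disj by (intro sum.union_disjoint) simp_all
      also have "(\<Sum>g\<in>G'. F g * g b) = w b" by (simp add: f'(2) F_def)
      also have "(\<Sum>g\<in>lift ` (H - {0}). F g * g b) = (\<Sum>h\<in>H - {0}. F (lift h) * lift h b)"
        by (subst sum.reindex) (use inj in \<open>auto simp: inj_on_def\<close>)
      also have "\<dots> = (\<Sum>h\<in>H - {0}. f h * lift h b)"
      proof (intro sum.cong refl)
        fix h assume h: "h \<in> H - {0}"
        then have "lift h \<notin> G'" using disj by blast
        then show "F (lift h) * lift h b = f h * lift h b" using lift h by (simp add: F_def)
      qed
      finally show ?thesis by (simp add: w_def)
    qed
    moreover have "F g \<in> polys n" for g using f f' by (simp add: F_def)
    ultimately show ?thesis by (intro exI[of _ F]) auto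
  qed
  moreover have "finite G" using G'(1) H(1) by (simp add: G_def)
  moreover have "G \<subseteq> Z" using G'(2) lift by (auto simp: G_def Z'_def)
  moreover have "\<forall>g\<in>G. \<exists>e. \<forall>b. g b \<in> sforms n (s b) e"
    using G'(3) lift unfolding G_def by blast
  ultimately show ?case by blast
qed

section \<open>Existence of graded free resolutions\<close>

definition mmap :: "nat \<Rightarrow> nat \<Rightarrow> (nat \<Rightarrow> nat \<Rightarrow> 'k::field mpol) \<Rightarrow> (nat \<Rightarrow> 'k mpol) \<Rightarrow> nat \<Rightarrow> 'k mpol" where
  "mmap r s M v = (\<lambda>c. if c < r then \<Sum>b<s. M c b * v b else 0)"

definition hmat :: "nat \<Rightarrow> nat \<Rightarrow> nat \<Rightarrow> (nat \<Rightarrow> nat) \<Rightarrow> (nat \<Rightarrow> nat) \<Rightarrow> (nat \<Rightarrow> nat \<Rightarrow> 'k::field mpol) \<Rightarrow> bool" where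
  "hmat n r s sr ss M \<longleftrightarrow> (\<forall>b<s. \<forall>c<r. M c b \<in> polys n \<and> (\<forall>a\<in>ks (M c b). mdeg a + sr c = ss b))"

lemma mmap_add: "mmap r s M (\<lambda>b. v b + w b) = (\<lambda>c. mmap r s M v c + mmap r s M w c)"
  by (auto simp: mmap_def fun_eq_iff algebra_simps sum.distrib)

lemma mmap_diff: "mmap r s M (\<lambda>b. v b - w b) = (\<lambda>c. mmap r s M v c - mmap r s M w c)"
  by (auto simp: mmap_def fun_eq_iff algebra_simps sum_subtractf)

lemma mmap_mult: "mmap r s M (\<lambda>b. p * v b) = (\<lambda>c. p * mmap r s M v c)"
  by (auto simp: mmap_def fun_eq_iff sum_distrib_left mult.left_commute)

lemma mmap_0 [simp]: "mmap r s M (\<lambda>b. 0) = (\<lambda>c. 0)" "mmap r s M 0 = 0"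
  by (auto simp: mmap_def fun_eq_iff)

lemma hmat_entry:
  assumes "hmat n r s sr ss M" "b < s" "c < r"
  shows "M c b = 0 \<or> sr c \<le> ss b \<and> M c b \<in> forms n (ss b - sr c)"
proof (cases "M c b = 0")
  case False
  then obtain a where "a \<in> ks (M c b)" by (meson keys_eq_empty ex_in_conv)
  then have "mdeg a + sr c = ss b" using assms by (auto simp: hmat_def)
  moreover have "mdeg a = ss b - sr c" if "a \<in> ks (M c b)" for a
    using assms that unfolding hmat_def by (metis add_diff_cancel_right')
  ultimately show ?thesis using assms by (auto simp: hmat_def forms_def homog_def)
qed simp

lemma mmap_vcomp:
  assumes M: "hmat n r s sr ss M"
  shows "mmap r s M (vcomp ss e v) = vcomp sr e (mmap r s M v)"
proof
  fix c
  show "mmap r s M (vcomp ss e v) c = vcomp sr e (mmap r s M v) c"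
  proof (cases "c < r")
    case True
    have *: "M c b * vcomp ss e v b = (if sr c \<le> e then hom_component (e - sr c) (M c b * v b) else 0)"
      if b: "b < s" for b
    proof (cases "M c b = 0")
      case False
      then have f: "sr c \<le> ss b" "homog (ss b - sr c) (M c b)"
        using hmat_entry[OF M b True] by (auto simp: forms_def)
      show ?thesis
      proof (cases "sr c \<le> e")
        case True
        have "ss b - sr c \<le> e - sr c \<longleftrightarrow> ss b \<le> e" "e - sr c - (ss b - sr c) = e - ss b"
          using f True by auto
        then show ?thesis using True by (simp add: hom_component_mult[OF f(2)] vcomp_def)
      qed (use f in \<open>simp add: vcomp_def\<close>)
    qed simp
    show ?thesis
      using True * by (auto simp: mmap_def vcomp_def[of sr] hom_component_sum)
  qed (simp add: mmap_def vcomp_def)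
qed

lemma free_module_vcomp:
  assumes "v \<in> free_module n r" shows "vcomp s e v \<in> free_module n r"
  by (rule free_moduleI) (use free_moduleD[OF assms] in \<open>auto simp: vcomp_def\<close>)

lemma free_module_add:
  assumes "v \<in> free_module n r" "w \<in> free_module n r" shows "(\<lambda>b. v b + w b) \<in> free_module n r"
  by (rule free_moduleI) (use free_moduleD[OF assms(1)] free_moduleD[OF assms(2)] in simp_all)

lemma free_module_mult:
  assumes "v \<in> free_module n r" "p \<in> polys n" shows "(\<lambda>b. p * v b) \<in> free_module n r"
  by (rule free_moduleI) (use free_moduleD[OF assms(1)] assms(2) in simp_all)

lemma gsub_kernel:
  assumes M: "hmat n r s sr ss M"
  shows "gsub n s ss {v \<in> free_module n s. mmap r s M v = 0}"
  unfolding gsub_def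
proof (intro conjI ballI allI)
  fix v assume v: "v \<in> {v \<in> free_module n s. mmap r s M v = 0}"
  show "(\<lambda>b. v b + w b) \<in> {v \<in> free_module n s. mmap r s M v = 0}"
    if w: "w \<in> {v \<in> free_module n s. mmap r s M v = 0}" for w
    using v w by (simp add: mmap_add free_module_add fun_eq_iff)
  show "(\<lambda>b. p * v b) \<in> {v \<in> free_module n s. mmap r s M v = 0}" if p: "p \<in> polys n" for p
    using v p by (simp add: mmap_mult free_module_mult fun_eq_iff)
  show "vcomp ss e v \<in> {v \<in> free_module n s. mmap r s M v = 0}" for e
    using v by (simp add: mmap_vcomp[OF M] free_module_vcomp) (simp add: vcomp_def fun_eq_iff)
qed (auto intro: free_moduleI)

lemma gsub_matrix:
  fixes Z :: "(nat \<Rightarrow> 'k::field mpol) set"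
  assumes Z: "gsub n r s Z"
  obtains m ss M where "hmat n r m s ss M" "mmap r m M ` free_module n m = Z"
proof -
  obtain G where G: "finite G" "G \<subseteq> Z" "\<forall>g\<in>G. \<exists>e. \<forall>b. g b \<in> sforms n (s b) e"
    "\<forall>v\<in>Z. \<exists>f. (\<forall>g. f g \<in> polys n) \<and> v = (\<lambda>b. \<Sum>g\<in>G. f g * g b)"
    using gsub_finitely_generated[OF Z] by blast
  obtain h where h: "bij_betw h {..<card G} G"
    using ex_bij_betw_nat_finite[OF G(1)] by (auto simp: atLeast0LessThan)
  have hG: "h b \<in> G" if "b < card G" for b using h that by (auto simp: bij_betw_def)
  have "\<forall>b. \<exists>e. b < card G \<longrightarrow> (\<forall>c. h b c \<in> sforms n (s c) e)" using G(3) hG by blast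
  from choice[OF this] obtain ss where ss: "\<forall>b. b < card G \<longrightarrow> (\<forall>c. h b c \<in> sforms n (s c) (ss b))"
    by (rule exE)
  define M where "M c b = h b c" for c b
  have M: "hmat n r (card G) s ss M" using ss by (auto simp: hmat_def M_def sforms_def)
  have hr: "h b c = 0" if "b < card G" "\<not> c < r" for b c
  proof -
    have "h b \<in> Z" using hG[OF that(1)] G(2) by blast
    then show ?thesis using free_moduleD(2)[OF gsubD(1)[OF Z]] that(2) by simp
  qed
  have eq: "mmap r (card G) M v = (\<lambda>c. \<Sum>b<card G. v b * h b c)" for v
    by (rule ext) (auto simp: mmap_def M_def hr mult.commute intro!: sum.cong sum.neutral)
  have "mmap r (card G) M ` free_module n (card G) = Z"
  proof
    show "mmap r (card G) M ` free_module n (card G) \<subseteq> Z"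
    proof
      fix w assume "w \<in> mmap r (card G) M ` free_module n (card G)"
      then obtain v where v: "v \<in> free_module n (card G)" "w = mmap r (card G) M v" by blast
      have "(\<lambda>c. \<Sum>b<card G. v b * h b c) \<in> Z"
        by (rule gsub_sum[OF Z]) (use hG G(2) free_moduleD(1)[OF v(1)] in auto)
      then show "w \<in> Z" using v(2) eq by simp
    qed
    show "Z \<subseteq> mmap r (card G) M ` free_module n (card G)"
    proof
      fix w assume "w \<in> Z"
      then obtain f where f: "\<forall>g. f g \<in> polys n" "w = (\<lambda>b. \<Sum>g\<in>G. f g * g b)" using G(4) by blast
      define v where "v b = (if b < card G then f (h b) else 0)" for b
      have "w = (\<lambda>c. \<Sum>b<card G. v b * h b c)"
      proof
        fix c
        have "w c = (\<Sum>b<card G. f (h b) * h b c)"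
          unfolding f(2) by (rule sum.reindex_bij_betw[OF h, symmetric])
        then show "w c = (\<Sum>b<card G. v b * h b c)" by (simp add: v_def)
      qed
      moreover have "v \<in> free_module n (card G)" by (rule free_moduleI) (use f(1) in \<open>auto simp: v_def\<close>)
      ultimately show "w \<in> mmap r (card G) M ` free_module n (card G)" by (auto simp: eq)
    qed
  qed
  with M show ?thesis by (rule that)
qed

lemma all_nat_0_Suc: "(\<forall>p. Q p) \<longleftrightarrow> Q 0 \<and> (\<forall>p. Q (Suc p))"
  by (metis not0_implies_Suc)

text \<open>
  An exact complex of graded free modules \<open>G\<^sub>p\<close> of rank \<open>R p\<close> with shifts \<open>sh p\<close>, exact except possibly at
  \<open>G\<^sub>0\<close>; \<open>E p\<close> is the matrix of \<open>G\<^bsub>p+1\<^esub> \<rightarrow> G\<^sub>p\<close>.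
\<close>

locale gcx =
  fixes n :: nat and R :: "nat \<Rightarrow> nat" and sh :: "nat \<Rightarrow> nat \<Rightarrow> nat" and E :: "nat \<Rightarrow> nat \<Rightarrow> nat \<Rightarrow> 'k::field mpol"
  assumes hm: "hmat n (R p) (R (Suc p)) (sh p) (sh (Suc p)) (E p)"
    and ex: "{v \<in> free_module n (R (Suc p)). mmap (R p) (R (Suc p)) (E p) v = 0} =
        mmap (R (Suc p)) (R (Suc (Suc p))) (E (Suc p)) ` free_module n (R (Suc (Suc p)))"

text \<open>
  A resolution \<open>F\<close> of \<open>I\<close>, augmented by \<open>F\<^sub>0 \<rightarrow> S\<close>: the modules are \<open>S, F\<^sub>0, F\<^sub>1, \<dots>\<close>.
\<close>

definition aR :: "'k::field free_complex \<Rightarrow> nat \<Rightarrow> nat" where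
  "aR F p = (case p of 0 \<Rightarrow> 1 | Suc i \<Rightarrow> rk F i)"

definition ash :: "'k::field free_complex \<Rightarrow> nat \<Rightarrow> nat \<Rightarrow> nat" where
  "ash F p = (case p of 0 \<Rightarrow> (\<lambda>_. 0) | Suc i \<Rightarrow> shift F i)"

definition aE :: "'k::field free_complex \<Rightarrow> nat \<Rightarrow> nat \<Rightarrow> nat \<Rightarrow> 'k mpol" where
  "aE F p = (case p of 0 \<Rightarrow> (\<lambda>c b. aug F b) | Suc i \<Rightarrow> entry F i)"

lemma aR_simps [simp]: "aR F 0 = 1" "aR F (Suc i) = rk F i"
  and ash_simps [simp]: "ash F 0 = (\<lambda>_. 0)" "ash F (Suc i) = shift F i"
  and aE_simps [simp]: "aE F 0 = (\<lambda>c b. aug F b)" "aE F (Suc i) = entry F i"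
  by (simp_all add: aR_def ash_def aE_def)

lemma diff_map_mmap: "diff_map F i = mmap (rk F i) (rk F (Suc i)) (entry F i)"
  by (intro ext) (simp add: diff_map_def mmap_def)

lemma aug_map_mmap: "mmap (Suc 0) (rk F 0) (\<lambda>c b. aug F b) v = (\<lambda>c. if c = 0 then aug_map F v else 0)"
  by (intro ext) (simp add: aug_map_def mmap_def)

text \<open>With S prepended as G_0 the augmentation becomes the matrix with index 0, so exactness
  at F_0 and further up are instances of a single condition.\<close>

lemma resolution_iff:
  "graded_free_resolution n I F \<longleftrightarrow> gcx n (aR F) (ash F) (aE F) \<and> aug_map F ` free_module n (rk F 0) = I"
  (is "?L \<longleftrightarrow> ?G \<and> ?I")
proof -
  have aug0: "{v \<in> free_module n (rk F 0). mmap (Suc 0) (rk F 0) (\<lambda>c b. aug F b) v = 0} =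
      {v \<in> free_module n (rk F 0). aug_map F v = 0}"
    unfolding aug_map_mmap by (auto simp: fun_eq_iff)
  have h: "(\<forall>p. hmat n (aR F p) (aR F (Suc p)) (ash F p) (ash F (Suc p)) (aE F p)) \<longleftrightarrow>
      (\<forall>b<rk F 0. aug F b \<in> carrier (poly_ring n) \<and> (\<forall>a\<in>ks (aug F b). mdeg a = shift F 0 b)) \<and>
     (\<forall>i. \<forall>b<rk F (Suc i). \<forall>c<rk F i. entry F i c b \<in> carrier (poly_ring n) \<and>
        (\<forall>a\<in>ks (entry F i c b). mdeg a + shift F i c = shift F (Suc i) b))" (is "?P \<longleftrightarrow> ?Q")
    by (subst all_nat_0_Suc) (simp add: hmat_def carrier_poly_ring)
  have e: "(\<forall>p. {v \<in> free_module n (aR F (Suc p)). mmap (aR F p) (aR F (Suc p)) (aE F p) v = 0} =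
        mmap (aR F (Suc p)) (aR F (Suc (Suc p))) (aE F (Suc p)) ` free_module n (aR F (Suc (Suc p)))) \<longleftrightarrow>
      {v \<in> free_module n (rk F 0). aug_map F v = 0} = diff_map F 0 ` free_module n (rk F (Suc 0)) \<and>
     (\<forall>i. {v \<in> free_module n (rk F (Suc i)). diff_map F i v = 0} =
       diff_map F (Suc i) ` free_module n (rk F (Suc (Suc i))))"
    by (subst all_nat_0_Suc) (simp add: diff_map_mmap aug0)
  show ?thesis
    unfolding graded_free_resolution_def gcx_def h e
    by (rule iffI; elim conjE; intro conjI; assumption)
qed

lemma resolution_exists:
  fixes I :: "'k::field mpol set"
  assumes I: "hideal n I"
  shows "\<exists>F. graded_free_resolution n I F"
proof -
  \<comment> \<open>The ideal as a graded submodule of rank 1, so that generators of I and of the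
    syzygy modules are found in the same way.\<close>
  define Z0 where "Z0 = {v :: nat \<Rightarrow> 'k mpol. v 0 \<in> I \<and> (\<forall>b\<ge>Suc 0. v b = 0)}"
  have Z0: "gsub n (Suc 0) (\<lambda>_. 0) Z0"
    unfolding gsub_def
  proof (intro conjI ballI allI subsetI)
    show "0 \<in> Z0" using hidealD(2)[OF I] by (simp add: Z0_def)
    fix v assume v: "v \<in> Z0"
    show "v \<in> free_module n (Suc 0)"
    proof (rule free_moduleI)
      show "v b \<in> polys n" for b
        using v hidealD(1)[OF I] by (cases b) (simp_all add: Z0_def)
    qed (use v in \<open>simp add: Z0_def\<close>)
    show "vcomp (\<lambda>_. 0) e v \<in> Z0" for e using v hidealD(5)[OF I] by (simp add: Z0_def vcomp_def)
    show "(\<lambda>b. v b + w b) \<in> Z0" if "w \<in> Z0" for w using v that hidealD(3)[OF I] by (simp add: Z0_def)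
    show "(\<lambda>b. p * v b) \<in> Z0" if "p \<in> polys n" for p using v that hidealD(4)[OF I] by (simp add: Z0_def)
  qed
  \<comment> \<open>A state holds the number of rows, their shifts, the number of columns, their
    shifts and the matrix; \<open>Q\<close> says that the next matrix maps onto the kernel of the
    current one.\<close>
  define P where "P p t = (case t of (r, sr, s, ss, M :: nat \<Rightarrow> nat \<Rightarrow> 'k mpol) \<Rightarrow> hmat n r s sr ss M \<and>
      (p = 0 \<longrightarrow> r = Suc 0 \<and> sr = (\<lambda>_. 0) \<and> mmap r s M ` free_module n s = Z0))" for p :: nat and t
  define Q where "Q t t' = (case t of (r, sr, s, ss, M :: nat \<Rightarrow> nat \<Rightarrow> 'k mpol) \<Rightarrow>
      (case t' of (r', sr', s', ss', M') \<Rightarrow> r' = s \<and> sr' = ss \<and>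
        mmap s s' M' ` free_module n s' = {v \<in> free_module n s. mmap r s M v = 0}))"
    for t :: "nat \<times> (nat \<Rightarrow> nat) \<times> nat \<times> (nat \<Rightarrow> nat) \<times> (nat \<Rightarrow> nat \<Rightarrow> 'k mpol)"
    and t' :: "nat \<times> (nat \<Rightarrow> nat) \<times> nat \<times> (nat \<Rightarrow> nat) \<times> (nat \<Rightarrow> nat \<Rightarrow> 'k mpol)"
  have "\<exists>f. \<forall>p. P p (f p) \<and> Q (f p) (f (Suc p))"
  proof (rule dependent_nat_choice)
    obtain m ss M where "hmat n (Suc 0) m (\<lambda>_. 0) ss M" "mmap (Suc 0) m M ` free_module n m = Z0"
      by (rule gsub_matrix[OF Z0])
    then show "\<exists>t. P 0 t" by (intro exI[of _ "(Suc 0, (\<lambda>_. 0), m, ss, M)"]) (simp add: P_def)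
    fix t p assume "P p t"
    moreover obtain r sr s ss M where t: "t = (r, sr, s, ss, M)" by (cases t) auto
    ultimately have M: "hmat n r s sr ss M" by (simp add: P_def)
    obtain m' ss' M' where "hmat n s m' ss ss' M'"
      "mmap s m' M' ` free_module n m' = {v \<in> free_module n s. mmap r s M v = 0}"
      by (rule gsub_matrix[OF gsub_kernel[OF M]])
    then show "\<exists>t'. P (Suc p) t' \<and> Q t t'"
      by (intro exI[of _ "(s, ss, m', ss', M')"]) (simp add: P_def Q_def t)
  qed
  then obtain f where f: "\<And>p. P p (f p)" "\<And>p. Q (f p) (f (Suc p))" by blast
  define s where "s p = fst (snd (snd (f p)))" for p
  define ss where "ss p = fst (snd (snd (snd (f p))))" for p
  define M where "M p = snd (snd (snd (snd (f p))))" for p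
  define F where "F = \<lparr>rk = s, shift = ss, aug = M 0 0, entry = (\<lambda>i. M (Suc i))\<rparr>"
  have r0: "fst (f 0) = Suc 0" "fst (snd (f 0)) = (\<lambda>_. 0)" "mmap (Suc 0) (s 0) (M 0) ` free_module n (s 0) = Z0"
    using f(1)[of 0] by (auto simp: P_def s_def ss_def M_def split: prod.splits)
  have rS: "fst (f (Suc p)) = s p" "fst (snd (f (Suc p))) = ss p"
    "mmap (s p) (s (Suc p)) (M (Suc p)) ` free_module n (s (Suc p)) =
      {v \<in> free_module n (s p). mmap (fst (f p)) (s p) (M p) v = 0}" for p
    using f(2)[of p] by (auto simp: Q_def s_def ss_def M_def split: prod.splits)
  have hmf: "hmat n (fst (f p)) (s p) (fst (snd (f p))) (ss p) (M p)" for p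
    using f(1)[of p] by (auto simp: P_def s_def ss_def M_def split: prod.splits)
  \<comment> \<open>\<open>aug\<close> stores row 0 alone, so \<open>aE F 0\<close> repeats this
    row; a map with a single row does not see the difference.\<close>
  have M00: "mmap (Suc 0) (s 0) (\<lambda>c. M 0 0) = mmap (Suc 0) (s 0) (M 0)"
    by (intro ext) (simp add: mmap_def)
  have "gcx n (aR F) (ash F) (aE F)"
  proof
    fix p
    show "hmat n (aR F p) (aR F (Suc p)) (ash F p) (ash F (Suc p)) (aE F p)"
    proof (cases p)
      case 0
      then show ?thesis using hmf[of 0] r0 by (simp add: F_def hmat_def)
    next
      case (Suc i)
      then show ?thesis using hmf[of "Suc i"] rS by (simp add: F_def)
    qed
    show "{v \<in> free_module n (aR F (Suc p)). mmap (aR F p) (aR F (Suc p)) (aE F p) v = 0} =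
        mmap (aR F (Suc p)) (aR F (Suc (Suc p))) (aE F (Suc p)) ` free_module n (aR F (Suc (Suc p)))"
    proof (cases p)
      case 0
      then show ?thesis using rS(3)[of 0] r0(1) by (simp add: F_def M00)
    next
      case (Suc i)
      then show ?thesis using rS(3)[of "Suc i"] rS(1) by (simp add: F_def)
    qed
  qed
  moreover have "aug_map F ` free_module n (rk F 0) = I"
  proof -
    have "aug_map F v = mmap (Suc 0) (s 0) (M 0) v 0" for v
      by (simp add: mmap_def F_def aug_map_def)
    then have "aug_map F ` free_module n (rk F 0) = (\<lambda>v. v 0) ` Z0"
      unfolding r0(3)[symmetric] by (simp add: F_def image_image)
    also have "\<dots> = I"
    proof
      show "I \<subseteq> (\<lambda>v. v 0) ` Z0"
      proof
        fix p assume "p \<in> I"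
        then show "p \<in> (\<lambda>v. v 0) ` Z0"
          by (intro image_eqI[of _ _ "\<lambda>b. if b = 0 then p else 0"]) (auto simp: Z0_def)
      qed
    qed (auto simp: Z0_def)
    finally show ?thesis .
  qed
  ultimately show ?thesis using resolution_iff by blast
qed

section \<open>Betti numbers as Koszul homology\<close>

lemma lookup_mult_0: "lk (p * q) (0::mon) = lk p 0 * lk (q :: 'k::field mpol) 0"
proof -
  have "lk (sg a c * q) (0::mon) = (if a = 0 then c * lk q 0 else 0)" for a c
  proof (cases "a = 0")
    case False
    then have "\<nexists>b. 0 = a + b" by (metis add_eq_0_iff_both_eq_0 mdeg_0 mdeg_add mdeg_eq_0_iff)
    then show ?thesis using False by (simp add: lookup_single_mult)
  qed simp
  note * = this
  have "p * q = (\<Sum>a\<in>ks p. sg a (lk p a) * q)" by (subst poly_sum[of p]) (rule sum_distrib_right)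
  then have "lk (p * q) 0 = (\<Sum>a\<in>ks p. if a = 0 then lk p a * lk q 0 else 0)"
    by (simp only: lookup_sum *)
  also have "\<dots> = lk p 0 * lk q 0" by (simp add: in_keys_iff)
  finally show ?thesis .
qed

abbreviation "mscale \<equiv> fscale (fscale pscale)"

lemma vector_space_mscale: "vector_space mscale"
  by (intro vector_space_fscale vector_space_pscale)

interpretation kv: vec "fscale pscale" by (simp add: vec_def vector_space_fscale vector_space_pscale)
interpretation mv: vec mscale by (simp add: vec_def vector_space_mscale)
interpretation tv: vec kscale by (simp add: vec_def vector_space_kscale)

lemma finite_ksub: "finite (ksub n i)"
  by (rule finite_subset[of _ "Pow {..<n}"]) (auto simp: ksub_def)

lemma card_ksub: "card (ksub n i) = n choose i"
  using n_subsets[of "{..<n}" i] by (simp add: ksub_def)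

lemma subspace_kch: "kv.subspace (kch n i q e)"
  unfolding kch_def by (rule subspace_fun_space[OF vector_space_pscale subspace_sforms])

lemma fin_dim_kch: "fin_dim (fscale pscale) (kch n i q e)"
  unfolding kch_def
  using fun_space_dim[OF vector_space_pscale subspace_sforms fin_dim_sforms finite_ksub] by blast

text \<open>The Koszul homology \<open>H\<^sub>i(x; I)\<close> in total degree \<open>e\<close>.\<close>

definition kcyc :: "nat \<Rightarrow> 'k::field mpol set \<Rightarrow> nat \<Rightarrow> nat \<Rightarrow> (nat set \<Rightarrow> 'k mpol) set" where
  "kcyc n I i e = {z \<in> kch n i i e. (\<forall>\<sigma>. z \<sigma> \<in> I) \<and> kos n z = 0}"

definition kbnd :: "nat \<Rightarrow> 'k::field mpol set \<Rightarrow> nat \<Rightarrow> nat \<Rightarrow> (nat set \<Rightarrow> 'k mpol) set" where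
  "kbnd n I i e = kos n ` {z \<in> kch n (Suc i) (Suc i) e. \<forall>\<sigma>. z \<sigma> \<in> I}"

definition kdim :: "nat \<Rightarrow> 'k::field mpol set \<Rightarrow> nat \<Rightarrow> nat \<Rightarrow> nat" where
  "kdim n I i e = kv.dim (kcyc n I i e) - kv.dim (kbnd n I i e)"

lemma kos_plus: "kos n (c + c') = kos n c + kos n c'"
  using kos_add[of n c c'] by (simp add: plus_fun_def)

lemma kos_scale: "kos n (fscale pscale k c) = fscale pscale k (kos n c)"
  using kos_mult[of n "sg 0 k" c] by (simp add: fscale_def pscale_def)

lemma kos_minus: "kos n (c - c') = kos n c - kos n c'"
  using kos_diff[of n c c'] by (simp add: fun_diff_def)

lemma linear_kos: "Vector_Spaces.linear (fscale pscale) (fscale pscale) (kos n)"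
  by (simp add: Vector_Spaces.linear_iff kos_plus kos_scale kv.vector_space_axioms)

lemma pscale_hideal: "hideal n I \<Longrightarrow> p \<in> I \<Longrightarrow> pscale c p \<in> I"
  by (simp add: pscale_def hidealD(4))

lemma subspace_kI: "hideal n I \<Longrightarrow> kv.subspace {z \<in> kch n i q e. \<forall>\<sigma>. z \<sigma> \<in> I}"
  using subspace_kch[of n i q e] unfolding kv.subspace_def
  by (auto simp: hidealD(2,3) fscale_def pscale_hideal)

lemma subspace_kcyc: "hideal n I \<Longrightarrow> kv.subspace (kcyc n I i e)"
  using subspace_kI[of n I i i e] unfolding kv.subspace_def kcyc_def
  by (auto simp: kos_plus kos_scale)

lemma subspace_kbnd:
  assumes "hideal n I" shows "kv.subspace (kbnd n I i e)"
proof -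
  interpret vp: vector_space_pair "fscale pscale :: 'a \<Rightarrow> (nat set \<Rightarrow> 'a mpol) \<Rightarrow> _" "fscale pscale :: 'a \<Rightarrow> (nat set \<Rightarrow> 'a mpol) \<Rightarrow> _" ..
  show ?thesis unfolding kbnd_def by (rule vp.linear_subspace_image[OF linear_kos subspace_kI[OF assms]])
qed

lemma kbnd_subset:
  assumes I: "hideal n I" shows "kbnd n I i e \<subseteq> kcyc n I i e"
proof
  fix y assume "y \<in> kbnd n I i e"
  then obtain z where z: "z \<in> kch n (Suc i) (Suc i) e" "\<forall>\<sigma>. z \<sigma> \<in> I" "y = kos n z"
    unfolding kbnd_def by blast
  have "kos n z \<sigma> \<in> I" for \<sigma> by (rule hideal_kos[OF I]) (use z(2) in blast)
  then show "y \<in> kcyc n I i e" unfolding kcyc_def using kos_kch[OF z(1)] kos_kos_kch[OF z(1)] z(3) by simp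
qed

lemma fin_dim_kcyc: "fin_dim (fscale pscale) (kcyc n I i e)"
  by (rule fin_dim_mono[OF fin_dim_kch[of n i i e]]) (auto simp: kcyc_def)

lemma mscale_apply: "mscale k c b \<sigma> = pscale k (c b \<sigma>)"
  by (simp add: fscale_def)

lemma sum_apply_fun: "(\<Sum>b\<in>A. f b) x = (\<Sum>b\<in>A. f b x)"
  by (induction A rule: infinite_finite_induct) simp_all

section \<open>The double complex of Koszul chains with coefficients in a resolution\<close>

context gcx
begin

text \<open>
  \<open>MC p i e\<close> are the Koszul \<open>i\<close>-chains of total degree \<open>e\<close> with coefficients in \<open>G\<^sub>p\<close>; \<open>KD\<close> and \<open>Dm\<close> are the
  two differentials of this double complex.  \<open>TC\<close> and \<open>TD\<close> belong to \<open>G \<otimes> K\<close>, and \<open>cst\<close> is \<open>G\<^sub>p \<rightarrow> G\<^sub>p \<otimes> K\<close>.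
\<close>

definition MC :: "nat \<Rightarrow> nat \<Rightarrow> nat \<Rightarrow> (nat \<Rightarrow> nat set \<Rightarrow> 'k mpol) set" where
  "MC p i e = {c. (\<forall>b. c b \<in> kch n i (i + sh p b) e) \<and> (\<forall>b\<ge>R p. c b = 0)}"

definition KD :: "(nat \<Rightarrow> nat set \<Rightarrow> 'k mpol) \<Rightarrow> nat \<Rightarrow> nat set \<Rightarrow> 'k mpol" where
  "KD c = (\<lambda>b. kos n (c b))"

definition Dm :: "nat \<Rightarrow> (nat \<Rightarrow> nat set \<Rightarrow> 'k mpol) \<Rightarrow> nat \<Rightarrow> nat set \<Rightarrow> 'k mpol" where
  "Dm p c = (\<lambda>b \<sigma>. mmap (R p) (R (Suc p)) (E p) (\<lambda>b. c b \<sigma>) b)"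

lemma MC_I: "(\<And>b. c b \<in> kch n i (i + sh p b) e) \<Longrightarrow> (\<And>b. R p \<le> b \<Longrightarrow> c b = 0) \<Longrightarrow> c \<in> MC p i e"
  by (simp add: MC_def)

lemma MC_D: "c \<in> MC p i e \<Longrightarrow> c b \<in> kch n i (i + sh p b) e" "c \<in> MC p i e \<Longrightarrow> R p \<le> b \<Longrightarrow> c b = 0"
  by (simp_all add: MC_def)

lemma MC_0 [simp]: "0 \<in> MC p i e"
  by (rule MC_I) simp_all

lemma KD_add: "KD (c + c') = KD c + KD c'" and KD_diff: "KD (c - c') = KD c - KD c'"
  and KD_scale: "KD (mscale k c) = mscale k (KD c)" and KD_0 [simp]: "KD 0 = 0"
  by (intro ext; simp add: KD_def kos_plus kos_minus fscale_def[of "fscale pscale"] kos_scale)+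

lemma Dm_add: "Dm p (c + c') = Dm p c + Dm p c'" and Dm_diff: "Dm p (c - c') = Dm p c - Dm p c'"
  and Dm_scale: "Dm p (mscale k c) = mscale k (Dm p c)" and Dm_0 [simp]: "Dm p 0 = 0"
  by (intro ext; simp add: Dm_def mmap_add mmap_diff mscale_apply pscale_def mmap_mult)+

lemma MC_add: "c \<in> MC p i e \<Longrightarrow> c' \<in> MC p i e \<Longrightarrow> c + c' \<in> MC p i e"
  by (rule MC_I) (simp add: kv.subspace_add[OF subspace_kch MC_D(1) MC_D(1)], intro ext, simp add: MC_D(2))

lemma MC_diff: "c \<in> MC p i e \<Longrightarrow> c' \<in> MC p i e \<Longrightarrow> c - c' \<in> MC p i e"
  by (rule MC_I) (simp add: kv.subspace_diff[OF subspace_kch MC_D(1) MC_D(1)], intro ext, simp add: MC_D(2))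

lemma MC_scale: "c \<in> MC p i e \<Longrightarrow> mscale k c \<in> MC p i e"
  by (rule MC_I) (simp add: fscale_def[of "fscale pscale"] kv.subspace_scale[OF subspace_kch MC_D(1)],
      intro ext, simp add: mscale_apply MC_D(2))

lemma KD_MC:
  assumes c: "c \<in> MC p (Suc i) e"
  shows "KD c \<in> MC p i e"
proof (rule MC_I)
  show "KD c b \<in> kch n i (i + sh p b) e" for b
    unfolding KD_def by (rule kos_kch) (use MC_D(1)[OF c, of b] in simp)
  show "KD c b = 0" if "R p \<le> b" for b using MC_D(2)[OF c that] by (simp add: KD_def)
qed

lemma KD_KD: "c \<in> MC p (Suc i) e \<Longrightarrow> KD (KD c) = 0"
proof -
  assume c: "c \<in> MC p (Suc i) e"
  have "kos n (kos n (c b)) = 0" for b using kos_kos_kch MC_D(1)[OF c, of b] by simp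
  then show ?thesis by (intro ext) (simp add: KD_def)
qed

lemma KD_0': "c \<in> MC p 0 e \<Longrightarrow> KD c = 0"
proof -
  assume c: "c \<in> MC p 0 e"
  have "kos n (c b) = 0" for b using kos_kch_0 MC_D(1)[OF c, of b] by simp
  then show ?thesis by (intro ext) (simp add: KD_def)
qed

lemma Dm_MC:
  assumes c: "c \<in> MC (Suc p) i e"
  shows "Dm p c \<in> MC p i e"
proof (rule MC_I)
  fix b'
  show "Dm p c b' \<in> kch n i (i + sh p b') e"
  proof (rule kchI)
    fix \<sigma>
    show "Dm p c b' \<sigma> \<in> sforms n (i + sh p b') e"
    proof (cases "b' < R p")
      case True
      have ent: "E p b' b * c b \<sigma> \<in> sforms n (i + sh p b') e" if b: "b < R (Suc p)" for b
      proof (cases "E p b' b = 0")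
        case False
        then have f: "sh p b' \<le> sh (Suc p) b" "E p b' b \<in> forms n (sh (Suc p) b - sh p b')"
          using hmat_entry[OF hm b True] by auto
        have "c b \<sigma> \<in> sforms n (i + sh (Suc p) b) e" by (rule kchD(1)[OF MC_D(1)[OF c]])
        moreover have "i + sh (Suc p) b = sh (Suc p) b - sh p b' + (i + sh p b')" using f(1) by simp
        ultimately show ?thesis using sforms_mult[OF f(2)] by metis
      qed simp
      have "(\<Sum>b<R (Suc p). E p b' b * c b \<sigma>) \<in> sforms n (i + sh p b') e"
        by (rule sforms_sum) (use ent in simp)
      then show ?thesis using True by (simp add: Dm_def mmap_def)
    qed (simp add: Dm_def mmap_def)
    show "\<sigma> \<subseteq> {..<n} \<and> card \<sigma> = i" if nz: "Dm p c b' \<sigma> \<noteq> 0"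
    proof (rule ccontr)
      assume "\<not> (\<sigma> \<subseteq> {..<n} \<and> card \<sigma> = i)"
      then have "c b \<sigma> = 0" for b
        using kchD(3)[OF MC_D(1)[OF c], of \<sigma> b] kchD(4)[OF MC_D(1)[OF c], of \<sigma> b] by fast
      then show False using nz by (simp add: Dm_def)
    qed
  qed
  show "Dm p c b' = 0" if "R p \<le> b'" using that by (intro ext) (simp add: Dm_def mmap_def)
qed

lemma KD_Dm: "KD (Dm p c) = Dm p (KD c)"
proof (intro ext)
  fix b \<sigma>
  show "KD (Dm p c) b \<sigma> = Dm p (KD c) b \<sigma>"
  proof (cases "b < R p")
    case True
    have "KD (Dm p c) b = kos n (\<lambda>\<sigma>. \<Sum>b'<R (Suc p). E p b b' * c b' \<sigma>)"
      using True by (simp add: KD_def Dm_def mmap_def)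
    also have "\<dots> = (\<lambda>\<sigma>. \<Sum>b'<R (Suc p). E p b b' * kos n (c b') \<sigma>)"
      by (simp only: kos_sum kos_mult)
    finally show ?thesis using True by (simp add: KD_def Dm_def mmap_def)
  qed (simp add: KD_def Dm_def mmap_def kos_def)
qed

text \<open>Preimages are chosen for each \<sigma> on its own and replaced by their components of
  degree e - i; as the matrix is homogeneous, this leaves the image unchanged. For e < i all chains
  are zero.\<close>

lemma Dm_lift:
  assumes c: "c \<in> MC p i e"
    and im: "\<And>\<sigma>. (\<lambda>b. c b \<sigma>) \<in> mmap (R p) (R (Suc p)) (E p) ` free_module n (R (Suc p))"
  shows "\<exists>c'\<in>MC (Suc p) i e. Dm p c' = c"
proof (cases "i \<le> e")
  case True
  have "\<exists>u. u \<in> free_module n (R (Suc p)) \<and> mmap (R p) (R (Suc p)) (E p) u = (\<lambda>b. c b \<sigma>)" for \<sigma>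
    using im[of \<sigma>] by (metis imageE)
  then have "\<forall>\<sigma>. \<exists>u. u \<in> free_module n (R (Suc p)) \<and> mmap (R p) (R (Suc p)) (E p) u = (\<lambda>b. c b \<sigma>)" by blast
  from choice[OF this] obtain u where
    "\<forall>\<sigma>. u \<sigma> \<in> free_module n (R (Suc p)) \<and> mmap (R p) (R (Suc p)) (E p) (u \<sigma>) = (\<lambda>b. c b \<sigma>)" by (rule exE)
  then have u: "u \<sigma> \<in> free_module n (R (Suc p))" "mmap (R p) (R (Suc p)) (E p) (u \<sigma>) = (\<lambda>b. c b \<sigma>)" for \<sigma>
    by blast+
  define c' where "c' b \<sigma> = (if \<sigma> \<in> ksub n i then vcomp (sh (Suc p)) (e - i) (u \<sigma>) b else 0)" for b \<sigma>
  have "c' \<in> MC (Suc p) i e"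
  proof (rule MC_I)
    fix b
    show "c' b \<in> kch n i (i + sh (Suc p) b) e"
    proof (rule kchI)
      show "\<sigma> \<subseteq> {..<n} \<and> card \<sigma> = i" if "c' b \<sigma> \<noteq> 0" for \<sigma>
        using that by (auto simp: c'_def ksub_def split: if_splits)
      fix \<sigma>
      have "u \<sigma> b \<in> polys n" by (rule free_moduleD(1)[OF u(1)])
      moreover have "i + sh (Suc p) b \<le> e \<longleftrightarrow> sh (Suc p) b \<le> e - i" "e - (i + sh (Suc p) b) = e - i - sh (Suc p) b"
        using True by auto
      ultimately show "c' b \<sigma> \<in> sforms n (i + sh (Suc p) b) e"
        by (simp add: c'_def vcomp_def sforms_eq forms_def homog_hom_component)
    qed
    show "c' b = 0" if "R (Suc p) \<le> b"
      using free_moduleD(2)[OF u(1) that] by (intro ext) (simp add: c'_def vcomp_def)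
  qed
  moreover have "Dm p c' b \<sigma> = c b \<sigma>" for b \<sigma>
  proof (cases "\<sigma> \<in> ksub n i")
    case True
    have "Dm p c' b \<sigma> = mmap (R p) (R (Suc p)) (E p) (vcomp (sh (Suc p)) (e - i) (u \<sigma>)) b"
      using True by (simp add: Dm_def c'_def)
    also have "\<dots> = vcomp (sh p) (e - i) (\<lambda>b. c b \<sigma>) b" by (simp add: mmap_vcomp[OF hm] u(2))
    also have "\<dots> = c b \<sigma>"
    proof -
      have "c b \<sigma> \<in> sforms n (i + sh p b) e" by (rule kchD(1)[OF MC_D(1)[OF c]])
      moreover have "i + sh p b \<le> e \<longleftrightarrow> sh p b \<le> e - i" "e - (i + sh p b) = e - i - sh p b"
        using \<open>i \<le> e\<close> by auto
      ultimately show ?thesis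
        using hom_component_homog[of "e - i - sh p b" "c b \<sigma>" "e - i - sh p b"]
        by (auto simp: vcomp_def sforms_eq forms_def split: if_splits)
    qed
    finally show ?thesis .
  next
    case False
    then have "c b \<sigma> = 0"
      using kchD(3)[OF MC_D(1)[OF c], of \<sigma> b] kchD(4)[OF MC_D(1)[OF c], of \<sigma> b] unfolding ksub_def by fast
    then show ?thesis using False by (simp add: Dm_def c'_def)
  qed
  ultimately show ?thesis by blast
next
  case False
  have "c b \<sigma> = 0" for b \<sigma> using kchD(1)[OF MC_D(1)[OF c], of b \<sigma>] False by (simp add: sforms_eq)
  then have "c = 0" by (intro ext) simp
  then show ?thesis by (intro bexI[of _ 0]) simp_all
qed

lemma MC_free: "c \<in> MC p i e \<Longrightarrow> (\<lambda>b. c b \<sigma>) \<in> free_module n (R p)"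
  by (rule free_moduleI) (simp_all add: kchD(2)[OF MC_D(1)] MC_D(2))

lemma Dm_exact:
  assumes c: "c \<in> MC (Suc p) i e" and d: "Dm p c = 0"
  shows "\<exists>c'\<in>MC (Suc (Suc p)) i e. Dm (Suc p) c' = c"
proof (rule Dm_lift[OF c])
  fix \<sigma>
  have "mmap (R p) (R (Suc p)) (E p) (\<lambda>b. c b \<sigma>) = 0"
    using fun_cong[OF fun_cong[OF d], of _ \<sigma>] by (intro ext) (simp add: Dm_def)
  then show "(\<lambda>b. c b \<sigma>) \<in> mmap (R (Suc p)) (R (Suc (Suc p))) (E (Suc p)) ` free_module n (R (Suc (Suc p)))"
    unfolding ex[symmetric] using MC_free[OF c] by blast
qed

lemma Dm_Dm:
  assumes c: "c \<in> MC (Suc (Suc p)) i e"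
  shows "Dm p (Dm (Suc p) c) = 0"
proof (intro ext)
  fix b \<sigma>
  have "mmap (R (Suc p)) (R (Suc (Suc p))) (E (Suc p)) (\<lambda>b. c b \<sigma>) \<in>
    {v \<in> free_module n (R (Suc p)). mmap (R p) (R (Suc p)) (E p) v = 0}"
    unfolding ex using MC_free[OF c] by blast
  then show "Dm p (Dm (Suc p) c) b \<sigma> = 0 b \<sigma>" by (simp add: Dm_def)
qed

text \<open>G_p is a sum of shifted copies of S, so the Koszul direction is exact copy by copy,
  except at index 0, where the homology is G_p \<otimes> K.\<close>

lemma KD_exact:
  assumes c: "c \<in> MC p i e" and d: "KD c = 0" and i: "0 < i"
  shows "\<exists>c'\<in>MC p (Suc i) e. KD c' = c"
proof -
  have "\<exists>w. w \<in> kch n (Suc i) (Suc i + sh p b) e \<and> kos n w = c b \<and> (c b = 0 \<longrightarrow> w = 0)" for b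
  proof (cases "c b = 0")
    case True
    then show ?thesis by (intro exI[of _ 0]) simp
  next
    case False
    have "kos n (c b) = 0" using fun_cong[OF d, of b] by (simp add: KD_def)
    from kos_exact[OF MC_D(1)[OF c] this] i False show ?thesis by auto
  qed
  then have "\<forall>b. \<exists>w. w \<in> kch n (Suc i) (Suc i + sh p b) e \<and> kos n w = c b \<and> (c b = 0 \<longrightarrow> w = 0)" by blast
  from choice[OF this] obtain w where
    w: "\<forall>b. w b \<in> kch n (Suc i) (Suc i + sh p b) e \<and> kos n (w b) = c b \<and> (c b = 0 \<longrightarrow> w b = 0)" by (rule exE)
  have "w \<in> MC p (Suc i) e" by (rule MC_I) (use w MC_D(2)[OF c] in auto)
  moreover have "KD w = c" using w by (intro ext) (simp add: KD_def)
  ultimately show ?thesis by blast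
qed

definition cst :: "(nat \<Rightarrow> nat set \<Rightarrow> 'k mpol) \<Rightarrow> nat \<Rightarrow> 'k" where
  "cst u = (\<lambda>b. lk (u b {}) 0)"

lemma KD_exact_0:
  assumes c: "c \<in> MC p 0 e" and d: "cst c = 0"
  shows "\<exists>c'\<in>MC p (Suc 0) e. KD c' = c"
proof -
  have "lk (c b \<sigma>) 0 = 0" for b \<sigma>
  proof (cases "\<sigma> = {}")
    case True
    then show ?thesis using fun_cong[OF d, of b] by (simp add: cst_def)
  next
    case False
    have "c b \<sigma> = 0"
    proof (cases "\<sigma> \<subseteq> {..<n}")
      case True
      then have "finite \<sigma>" by (rule finite_subset) simp
      then have "card \<sigma> \<noteq> 0" using False by simp
      then show ?thesis by (rule kchD(4)[OF MC_D(1)[OF c]])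
    qed (rule kchD(3)[OF MC_D(1)[OF c]])
    then show ?thesis by simp
  qed
  then have "\<exists>w\<in>kch n (Suc 0) (Suc (0 + sh p b)) e. kos n w = c b" for b
    by (intro kos_exact_0 MC_D(1)[OF c])
  then have "\<forall>b. \<exists>w. w \<in> kch n (Suc 0) (Suc 0 + sh p b) e \<and> kos n w = c b \<and> (c b = 0 \<longrightarrow> w = 0)"
  proof -
    fix b
    assume *: "\<And>b. \<exists>w\<in>kch n (Suc 0) (Suc (0 + sh p b)) e. kos n w = c b"
    show ?thesis
    proof
      fix b
      show "\<exists>w. w \<in> kch n (Suc 0) (Suc 0 + sh p b) e \<and> kos n w = c b \<and> (c b = 0 \<longrightarrow> w = 0)"
      proof (cases "c b = 0")
        case True
        then show ?thesis by (intro exI[of _ 0]) simp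
      qed (use *[of b] in auto)
    qed
  qed
  from choice[OF this] obtain w where
    w: "\<forall>b. w b \<in> kch n (Suc 0) (Suc 0 + sh p b) e \<and> kos n (w b) = c b \<and> (c b = 0 \<longrightarrow> w b = 0)" by (rule exE)
  have "w \<in> MC p (Suc 0) e" by (rule MC_I) (use w MC_D(2)[OF c] in auto)
  moreover have "KD w = c" using w by (intro ext) (simp add: KD_def)
  ultimately show ?thesis by blast
qed

section \<open>The complex tensored with K, and the comparison of both edges\<close>

definition TC :: "nat \<Rightarrow> nat \<Rightarrow> (nat \<Rightarrow> 'k) set" where
  "TC p e = {w. \<forall>b. w b \<noteq> 0 \<longrightarrow> b < R p \<and> sh p b = e}"

definition TD :: "nat \<Rightarrow> (nat \<Rightarrow> 'k) \<Rightarrow> nat \<Rightarrow> 'k" where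
  "TD p w = (\<lambda>c. if c < R p then \<Sum>b<R (Suc p). lk (E p c b) 0 * w b else 0)"

definition emb :: "(nat \<Rightarrow> 'k) \<Rightarrow> nat \<Rightarrow> nat set \<Rightarrow> 'k mpol" where
  "emb w = (\<lambda>b \<sigma>. if \<sigma> = {} then sg 0 (w b) else 0)"

lemma cst_TC: "u \<in> MC p 0 e \<Longrightarrow> cst u \<in> TC p e"
proof -
  assume u: "u \<in> MC p 0 e"
  have "b < R p \<and> sh p b = e" if nz: "cst u b \<noteq> 0" for b
  proof
    show "b < R p"
    proof (rule ccontr)
      assume "\<not> b < R p"
      then have "u b = 0" using MC_D(2)[OF u, of b] by simp
      then show False using nz by (simp add: cst_def)
    qed
    have "u b {} \<in> sforms n (0 + sh p b) e" by (rule kchD(1)[OF MC_D(1)[OF u]])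
    moreover have "0 \<in> ks (u b {})" using nz by (simp add: cst_def in_keys_iff)
    ultimately show "sh p b = e" by (auto simp: sforms_def)
  qed
  then show ?thesis by (simp add: TC_def)
qed

lemma emb_MC: "w \<in> TC p e \<Longrightarrow> emb w \<in> MC p 0 e"
proof (rule MC_I)
  fix b assume w: "w \<in> TC p e"
  show "emb w b \<in> kch n 0 (0 + sh p b) e"
  proof (rule kchI)
    show "emb w b \<sigma> \<in> sforms n (0 + sh p b) e" for \<sigma>
      using w by (auto simp: emb_def TC_def sforms_def split: if_splits)
    show "\<sigma> \<subseteq> {..<n} \<and> card \<sigma> = 0" if "emb w b \<sigma> \<noteq> 0" for \<sigma>
      using that by (auto simp: emb_def split: if_splits)
  qed
  show "emb w b = 0" if "R p \<le> b"
  proof -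
    have "w b = 0" using w that by (auto simp: TC_def)
    then show ?thesis by (intro ext) (simp add: emb_def)
  qed
qed

lemma cst_emb [simp]: "cst (emb w) = w"
  by (simp add: cst_def emb_def)

lemma cst_Dm: "cst (Dm p u) = TD p (cst u)"
  by (intro ext) (simp add: cst_def Dm_def TD_def mmap_def lookup_sum lookup_mult_0)

lemma cst_KD: "cst (KD c) = 0"
proof
  fix b
  have "lk (kos n (c b) {}) 0 = 0"
  proof -
    have "sg j 1 \<noteq> (0 :: mon)" for j by (metis mdeg_0 mdeg_single zero_neq_one)
    then show ?thesis by (simp add: kos_def lookup_sum lookup_mult_0 var_def lookup_single when_def)
  qed
  then show "cst (KD c) b = 0 b" by (simp add: cst_def KD_def)
qed

lemma cst_add: "cst (u + u') = cst u + cst u'" and cst_diff: "cst (u - u') = cst u - cst u'"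
  and cst_scale: "cst (mscale k u) = kscale k (cst u)" and cst_0 [simp]: "cst 0 = 0"
  by (intro ext; simp add: cst_def mscale_apply kscale_def lookup_add lookup_minus)+

lemma TD_add: "TD p (w + w') = TD p w + TD p w'" and TD_scale: "TD p (kscale k w) = kscale k (TD p w)"
  and TD_0 [simp]: "TD p 0 = 0"
  by (intro ext; simp add: TD_def kscale_def algebra_simps sum.distrib sum_distrib_left)+

lemma TC_0 [simp]: "0 \<in> TC p e"
  by (simp add: TC_def)

lemma subspace_TC: "tv.subspace (TC p e)"
proof -
  have "w + w' \<in> TC p e" if "w \<in> TC p e" "w' \<in> TC p e" for w w'
  proof -
    have "b < R p \<and> sh p b = e" if "w b + w' b \<noteq> 0" for b
      using that \<open>w \<in> _\<close> \<open>w' \<in> _\<close> by (cases "w b = 0") (auto simp: TC_def)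
    then show ?thesis by (simp add: TC_def)
  qed
  moreover have "kscale k w \<in> TC p e" if "w \<in> TC p e" for k w
    using that by (auto simp: TC_def kscale_def)
  ultimately show ?thesis by (simp add: tv.subspace_def)
qed

lemma fin_dim_TC: "fin_dim kscale (TC p e)"
proof -
  have "w \<in> tv.span ((\<lambda>b. (\<lambda>x. if x = b then 1 else 0)) ` {..<R p})" if w: "w \<in> TC p e" for w
  proof -
    have "w = (\<Sum>b<R p. kscale (w b) (\<lambda>x. if x = b then 1 else 0))"
    proof
      fix x
      have "(\<Sum>b<R p. kscale (w b) (\<lambda>x. if x = b then 1 else 0)) x = (\<Sum>b<R p. if b = x then w x else 0)"
        unfolding sum_apply_fun by (intro sum.cong) (auto simp: kscale_def)
      also have "\<dots> = w x" using w by (auto simp: TC_def)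
      finally show "w x = (\<Sum>b<R p. kscale (w b) (\<lambda>x. if x = b then 1 else 0)) x" ..
    qed
    moreover have "(\<Sum>b<R p. kscale (w b) (\<lambda>x. if x = b then 1 else 0)) \<in>
        tv.span ((\<lambda>b. (\<lambda>x. if x = b then 1 else 0)) ` {..<R p})"
      by (intro tv.span_sum tv.span_scale tv.span_base) simp
    ultimately show ?thesis by (simp only:)
  qed
  then show ?thesis unfolding fin_dim_def
    by (intro exI[of _ "(\<lambda>b. (\<lambda>x. if x = b then 1 else 0)) ` {..<R p}"]) auto
qed

lemma subspace_MC: "mv.subspace (MC p i e)"
  by (simp add: mv.subspace_def MC_add MC_scale)

text \<open>All coefficients have degree at most e, whatever the shift of their basis element, so
  one finite-dimensional space bounds them uniformly.\<close>

lemma fin_dim_MC: "fin_dim mscale (MC p i e)"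
proof -
  define U :: "'k mpol set" where "U = monspan (\<Union>m\<le>e. monomials n m)"
  have fU: "finite (\<Union>m\<le>e. monomials n m)" using finite_monomials by blast
  have U: "pv.subspace U" "fin_dim pscale U"
    unfolding U_def using subspace_monspan monspan_dim(1)[OF fU] by simp_all
  have sU: "sforms n q e \<subseteq> U" for q
  proof
    fix p :: "'k mpol" assume p: "p \<in> sforms n q e"
    have "a \<in> (\<Union>m\<le>e. monomials n m)" if "a \<in> ks p" for a
    proof -
      have "mdeg a \<le> e" "ks a \<subseteq> {..<n}" using p that by (auto simp: sforms_def polys_def)
      then show ?thesis by (auto simp: monomials_def)
    qed
    then show "p \<in> U" by (auto simp: U_def monspan_def)
  qed
  have 1: "kv.subspace (fun_space (ksub n i) U)" "fin_dim (fscale pscale) (fun_space (ksub n i) U)"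
    using subspace_fun_space[OF vector_space_pscale U(1)] 
      fun_space_dim[OF vector_space_pscale U finite_ksub] by auto
  have "fin_dim mscale (fun_space {..<R p} (fun_space (ksub n i) U))"
    using fun_space_dim[OF kv.vector_space_axioms 1, of "{..<R p}"] by simp
  moreover have "MC p i e \<subseteq> fun_space {..<R p} (fun_space (ksub n i) U)"
  proof
    fix c assume c: "c \<in> MC p i e"
    have "c b \<in> fun_space (ksub n i) U" for b
      using MC_D(1)[OF c, of b] sU unfolding kch_def fun_space_def by blast
    moreover have "b \<in> {..<R p}" if "c b \<noteq> 0" for b using that MC_D(2)[OF c, of b] by fastforce
    ultimately show "c \<in> fun_space {..<R p} (fun_space (ksub n i) U)" by (simp add: fun_space_def)
  qed
  ultimately show ?thesis by (rule fin_dim_mono)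
qed

text \<open>Cycles with coefficients in the image of G_{p+1} \<rightarrow> G_p: by
  \<open>Dm_lift\<close> every chain with such coefficients is \<open>Dm p\<close> of a
  chain.\<close>

definition cyc :: "nat \<Rightarrow> nat \<Rightarrow> nat \<Rightarrow> (nat \<Rightarrow> nat set \<Rightarrow> 'k mpol) set" where
  "cyc p i e = {z \<in> Dm p ` MC (Suc p) i e. KD z = 0}"

definition bnd :: "nat \<Rightarrow> nat \<Rightarrow> nat \<Rightarrow> (nat \<Rightarrow> nat set \<Rightarrow> 'k mpol) set" where
  "bnd p i e = KD ` Dm p ` MC (Suc p) (Suc i) e"

text \<open>Indices follow the resolution F, with G_{p+1} = F_p. At p = 0 the map to G_0 = S is the
  augmentation and not a differential of F \<otimes> K, hence the guard.\<close>

definition tcyc :: "nat \<Rightarrow> nat \<Rightarrow> (nat \<Rightarrow> 'k) set" where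
  "tcyc p e = {w \<in> TC (Suc p) e. 0 < p \<longrightarrow> TD p w = 0}"

definition tbnd :: "nat \<Rightarrow> nat \<Rightarrow> (nat \<Rightarrow> 'k) set" where
  "tbnd p e = TD (Suc p) ` TC (Suc (Suc p)) e"

text \<open>The degree \<open>e\<close> part of the Koszul homology \<open>H\<^sub>i\<close> of the image of \<open>G\<^bsub>p+1\<^esub> \<rightarrow> G\<^sub>p\<close>.\<close>

definition khom :: "nat \<Rightarrow> nat \<Rightarrow> nat \<Rightarrow> nat" where
  "khom p i e = mv.dim (cyc p i e) - mv.dim (bnd p i e)"

lemma linear_Dm: "Vector_Spaces.linear mscale mscale (Dm p)"
  by (simp add: Vector_Spaces.linear_iff Dm_add Dm_scale mv.vector_space_axioms)

lemma linear_KD: "Vector_Spaces.linear mscale mscale KD"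
  by (simp add: Vector_Spaces.linear_iff KD_add KD_scale mv.vector_space_axioms)

lemma linear_TD: "Vector_Spaces.linear kscale kscale (TD p)"
  by (simp add: Vector_Spaces.linear_iff TD_add TD_scale tv.vector_space_axioms)

lemma subspace_ker:
  assumes f: "Vector_Spaces.linear s1 s2 f" and A: "module.subspace s1 A"
  shows "module.subspace s1 {z \<in> A. f z = 0}"
proof -
  interpret Vector_Spaces.linear s1 s2 f by fact
  show ?thesis using A by (auto simp: vs1.subspace_def add scale)
qed

lemma subspace_image:
  assumes f: "Vector_Spaces.linear s1 s2 f" and A: "module.subspace s1 A"
  shows "module.subspace s2 (f ` A)"
proof -
  interpret Vector_Spaces.linear s1 s2 f by fact
  interpret vp: vector_space_pair s1 s2 ..
  show ?thesis by (rule vp.linear_subspace_image[OF f A])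
qed

lemma subspace_cyc: "mv.subspace (cyc p i e)"
  unfolding cyc_def by (rule subspace_ker[OF linear_KD subspace_image[OF linear_Dm subspace_MC]])

lemma subspace_bnd: "mv.subspace (bnd p i e)"
  unfolding bnd_def by (rule subspace_image[OF linear_KD subspace_image[OF linear_Dm subspace_MC]])

lemma subspace_tcyc: "tv.subspace (tcyc p e)"
proof (cases "p = 0")
  case True
  then show ?thesis using subspace_TC[of "Suc 0" e] by (simp add: tcyc_def)
next
  case False
  then show ?thesis using subspace_ker[OF linear_TD[of p] subspace_TC[of "Suc p" e]] by (simp add: tcyc_def)
qed

lemma subspace_tbnd: "tv.subspace (tbnd p e)"
  unfolding tbnd_def by (rule subspace_image[OF linear_TD subspace_TC])

lemma cyc_MC: "cyc p i e \<subseteq> MC p i e"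
  unfolding cyc_def using Dm_MC by blast

lemma fin_dim_cyc: "fin_dim mscale (cyc p i e)"
  by (rule fin_dim_mono[OF fin_dim_MC cyc_MC])

lemma fin_dim_tcyc: "fin_dim kscale (tcyc p e)"
  by (rule fin_dim_mono[OF fin_dim_TC[of "Suc p" e]]) (auto simp: tcyc_def)

lemma bnd_cyc: "bnd p i e \<subseteq> cyc p i e"
proof
  fix y assume "y \<in> bnd p i e"
  then obtain c where c: "c \<in> MC (Suc p) (Suc i) e" "y = KD (Dm p c)" unfolding bnd_def by blast
  have "y = Dm p (KD c)" using c(2) KD_Dm by simp
  moreover have "KD c \<in> MC (Suc p) i e" by (rule KD_MC[OF c(1)])
  moreover have "KD y = 0" unfolding c(2) by (rule KD_KD[OF Dm_MC[OF c(1)]])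
  ultimately show "y \<in> cyc p i e" unfolding cyc_def by blast
qed

lemma tbnd_tcyc: "tbnd p e \<subseteq> tcyc p e"
proof
  fix y assume "y \<in> tbnd p e"
  then obtain w where w: "w \<in> TC (Suc (Suc p)) e" "y = TD (Suc p) w" unfolding tbnd_def by blast
  have y: "y = cst (Dm (Suc p) (emb w))" by (simp add: w(2) cst_Dm)
  have 1: "y \<in> TC (Suc p) e" unfolding y by (rule cst_TC[OF Dm_MC[OF emb_MC[OF w(1)]]])
  have "TD p y = cst (Dm p (Dm (Suc p) (emb w)))" unfolding y by (rule cst_Dm[symmetric])
  also have "\<dots> = 0" by (simp add: Dm_Dm[OF emb_MC[OF w(1)]])
  finally show "y \<in> tcyc p e" using 1 by (simp add: tcyc_def)
qed

lemma diff_eq_of_sum_eq: "(a::nat) + d = c + b \<Longrightarrow> b \<le> a \<Longrightarrow> d \<le> c \<Longrightarrow> a - b = c - d"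
  by simp

text \<open>Dimension shifting along \<open>0 \<rightarrow> Z\<^bsub>p+1\<^esub> \<rightarrow> G\<^bsub>p+1\<^esub> \<rightarrow> Z\<^sub>p \<rightarrow> 0\<close>, where \<open>Z\<^sub>p\<close> is the image of \<open>G\<^bsub>p+1\<^esub> \<rightarrow> G\<^sub>p\<close>.\<close>

lemma khom_shift:
  assumes i: "0 < i"
  shows "khom p (Suc i) e = khom (Suc p) i e"
proof -
  \<comment> \<open>The connecting homomorphism: lift along \<open>Dm p\<close>, then apply the
    Koszul differential. Different lifts change the result by a boundary.\<close>
  define Rel where "Rel z y \<longleftrightarrow> (\<exists>c\<in>MC (Suc p) (Suc i) e. Dm p c = z \<and> KD c = y)" for z y
  have "mv.dim (cyc p (Suc i) e) + mv.dim (bnd (Suc p) i e) = mv.dim (cyc (Suc p) i e) + mv.dim (bnd p (Suc i) e)"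
  proof (rule quot_dim_rel[where R = Rel, OF vector_space_mscale vector_space_mscale subspace_bnd subspace_bnd
        subspace_cyc subspace_cyc fin_dim_cyc fin_dim_cyc bnd_cyc bnd_cyc])
    show "Rel 0 0" unfolding Rel_def by (intro bexI[of _ 0]) simp_all
    show "Rel (x + y) (x' + y')" if xy: "Rel x x'" "Rel y y'" for x y x' y'
    proof -
      obtain c c' where "c \<in> MC (Suc p) (Suc i) e" "Dm p c = x" "KD c = x'"
        "c' \<in> MC (Suc p) (Suc i) e" "Dm p c' = y" "KD c' = y'" using xy unfolding Rel_def by blast
      then show ?thesis unfolding Rel_def by (intro bexI[of _ "c + c'"]) (simp_all add: Dm_add KD_add MC_add)
    qed
    show "Rel (mscale k x) (mscale k x')" if xy: "Rel x x'" for k x x'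
    proof -
      obtain c where "c \<in> MC (Suc p) (Suc i) e" "Dm p c = x" "KD c = x'" using xy unfolding Rel_def by blast
      then show ?thesis unfolding Rel_def by (intro bexI[of _ "mscale k c"]) (simp_all add: Dm_scale KD_scale MC_scale)
    qed
    show "\<exists>a'\<in>cyc (Suc p) i e. Rel a a'" if a: "a \<in> cyc p (Suc i) e" for a
    proof -
      obtain c where c: "c \<in> MC (Suc p) (Suc i) e" "Dm p c = a" "KD a = 0" using a unfolding cyc_def by blast
      have "Dm p (KD c) = 0" using c KD_Dm by metis
      from Dm_exact[OF KD_MC[OF c(1)] this] obtain c' where
        "c' \<in> MC (Suc (Suc p)) i e" "Dm (Suc p) c' = KD c" by blast
      then have "KD c \<in> cyc (Suc p) i e" using KD_KD[OF c(1)] unfolding cyc_def by (metis (mono_tags, lifting) image_eqI mem_Collect_eq)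
      then show ?thesis unfolding Rel_def using c by blast
    qed
    show "\<exists>a\<in>cyc p (Suc i) e. Rel a a'" if a: "a' \<in> cyc (Suc p) i e" for a'
    proof -
      obtain c' where c': "c' \<in> MC (Suc (Suc p)) i e" "Dm (Suc p) c' = a'" "KD a' = 0" using a unfolding cyc_def by blast
      have "a' \<in> MC (Suc p) i e" using Dm_MC[OF c'(1)] c'(2) by simp
      from KD_exact[OF this c'(3) i] obtain c where c: "c \<in> MC (Suc p) (Suc i) e" "KD c = a'" by blast
      have "KD (Dm p c) = 0" using KD_Dm[of p c] c(2) c'(2) Dm_Dm[OF c'(1)] by simp
      then have "Dm p c \<in> cyc p (Suc i) e" using c(1) unfolding cyc_def by blast
      then show ?thesis unfolding Rel_def using c by blast
    qed
    show "a \<in> bnd p (Suc i) e \<longleftrightarrow> a' \<in> bnd (Suc p) i e" if rel: "Rel a a'" for a a'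
    proof -
      obtain c where c: "c \<in> MC (Suc p) (Suc i) e" "Dm p c = a" "KD c = a'" using rel unfolding Rel_def by blast
      show ?thesis
      proof
        assume "a \<in> bnd p (Suc i) e"
        then obtain c1 where c1: "c1 \<in> MC (Suc p) (Suc (Suc i)) e" "a = KD (Dm p c1)" unfolding bnd_def by blast
        have "c - KD c1 \<in> MC (Suc p) (Suc i) e" by (rule MC_diff[OF c(1) KD_MC[OF c1(1)]])
        moreover have "Dm p (c - KD c1) = 0" by (simp add: Dm_diff c(2) c1(2) KD_Dm)
        ultimately obtain c2 where c2: "c2 \<in> MC (Suc (Suc p)) (Suc i) e" "Dm (Suc p) c2 = c - KD c1"
          using Dm_exact by blast
        have "KD (Dm (Suc p) c2) = a'" by (simp add: c2(2) KD_diff c(3) KD_KD[OF c1(1)])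
        then show "a' \<in> bnd (Suc p) i e" unfolding bnd_def using c2(1) by blast
      next
        assume "a' \<in> bnd (Suc p) i e"
        then obtain c2 where c2: "c2 \<in> MC (Suc (Suc p)) (Suc i) e" "a' = KD (Dm (Suc p) c2)" unfolding bnd_def by blast
        have m: "c - Dm (Suc p) c2 \<in> MC (Suc p) (Suc i) e" by (rule MC_diff[OF c(1) Dm_MC[OF c2(1)]])
        have "KD (c - Dm (Suc p) c2) = 0" by (simp add: KD_diff c(3) c2(2))
        from KD_exact[OF m this] obtain c1 where c1: "c1 \<in> MC (Suc p) (Suc (Suc i)) e" "KD c1 = c - Dm (Suc p) c2"
          by blast
        have "KD (Dm p c1) = a" by (simp add: KD_Dm c1(2) Dm_diff c(2) Dm_Dm[OF c2(1)])
        then show "a \<in> bnd p (Suc i) e" unfolding bnd_def using c1(1) by blast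
      qed
    qed
  qed
  then show ?thesis
    unfolding khom_def by (rule diff_eq_of_sum_eq) (rule mv.dim_mono_fin[OF fin_dim_cyc bnd_cyc])+
qed

text \<open>At index 0 the Koszul homology of the free modules no longer vanishes and the shift
  ends: \<open>KD c\<close> is lifted along \<open>Dm\<close> once more, to u, whose constant terms
  give the class in G_{p+2} \<otimes> K.\<close>

lemma khom_1: "khom p (Suc 0) e = tv.dim (tcyc (Suc p) e) - tv.dim (tbnd (Suc p) e)"
proof -
  define Rel where "Rel z w \<longleftrightarrow> (\<exists>c\<in>MC (Suc p) (Suc 0) e. \<exists>u\<in>MC (Suc (Suc p)) 0 e.
    Dm p c = z \<and> KD c = Dm (Suc p) u \<and> cst u = w)" for z w
  have "mv.dim (cyc p (Suc 0) e) + tv.dim (tbnd (Suc p) e) = tv.dim (tcyc (Suc p) e) + mv.dim (bnd p (Suc 0) e)"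
  proof (rule quot_dim_rel[where R = Rel, OF vector_space_mscale vector_space_kscale subspace_bnd subspace_tbnd
        subspace_cyc subspace_tcyc fin_dim_cyc fin_dim_tcyc bnd_cyc tbnd_tcyc])
    show "Rel 0 0" unfolding Rel_def by (intro bexI[of _ 0]) simp_all
    show "Rel (x + y) (x' + y')" if xy: "Rel x x'" "Rel y y'" for x y x' y'
    proof -
      obtain c c' u u' where "c \<in> MC (Suc p) (Suc 0) e" "u \<in> MC (Suc (Suc p)) 0 e" "Dm p c = x" "KD c = Dm (Suc p) u" "cst u = x'"
        "c' \<in> MC (Suc p) (Suc 0) e" "u' \<in> MC (Suc (Suc p)) 0 e" "Dm p c' = y" "KD c' = Dm (Suc p) u'" "cst u' = y'"
        using xy unfolding Rel_def by blast
      then show ?thesis unfolding Rel_def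
        by (intro bexI[of _ "c + c'"] bexI[of _ "u + u'"]) (simp_all add: Dm_add KD_add MC_add cst_add)
    qed
    show "Rel (mscale k x) (kscale k x')" if xy: "Rel x x'" for k x x'
    proof -
      obtain c u where "c \<in> MC (Suc p) (Suc 0) e" "u \<in> MC (Suc (Suc p)) 0 e" "Dm p c = x" "KD c = Dm (Suc p) u" "cst u = x'"
        using xy unfolding Rel_def by blast
      then show ?thesis unfolding Rel_def
        by (intro bexI[of _ "mscale k c"] bexI[of _ "mscale k u"]) (simp_all add: Dm_scale KD_scale MC_scale cst_scale)
    qed
    show "\<exists>a'\<in>tcyc (Suc p) e. Rel a a'" if a: "a \<in> cyc p (Suc 0) e" for a
    proof -
      obtain c where c: "c \<in> MC (Suc p) (Suc 0) e" "Dm p c = a" "KD a = 0" using a unfolding cyc_def by blast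
      have "Dm p (KD c) = 0" using c KD_Dm by metis
      from Dm_exact[OF KD_MC[OF c(1)] this] obtain u where
        u: "u \<in> MC (Suc (Suc p)) 0 e" "Dm (Suc p) u = KD c" by blast
      have "TD (Suc p) (cst u) = 0" using cst_Dm[of "Suc p" u] by (simp add: u(2) cst_KD)
      then have "cst u \<in> tcyc (Suc p) e" using cst_TC[OF u(1)] by (simp add: tcyc_def)
      then show ?thesis unfolding Rel_def using c u by force
    qed
    show "\<exists>a\<in>cyc p (Suc 0) e. Rel a a'" if a: "a' \<in> tcyc (Suc p) e" for a'
    proof -
      have w: "a' \<in> TC (Suc (Suc p)) e" "TD (Suc p) a' = 0" using a by (auto simp: tcyc_def)
      have m: "emb a' \<in> MC (Suc (Suc p)) 0 e" by (rule emb_MC[OF w(1)])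
      have "cst (Dm (Suc p) (emb a')) = 0" by (simp add: cst_Dm w(2))
      from KD_exact_0[OF Dm_MC[OF m] this] obtain c where
        c: "c \<in> MC (Suc p) (Suc 0) e" "KD c = Dm (Suc p) (emb a')" by blast
      have "KD (Dm p c) = 0" by (simp add: KD_Dm c(2) Dm_Dm[OF m])
      then have "Dm p c \<in> cyc p (Suc 0) e" using c(1) unfolding cyc_def by blast
      moreover have "Rel (Dm p c) a'" unfolding Rel_def
        by (intro bexI[OF _ c(1)] bexI[OF _ m]) (simp add: c(2))
      ultimately show ?thesis by blast
    qed
    show "a \<in> bnd p (Suc 0) e \<longleftrightarrow> a' \<in> tbnd (Suc p) e" if rel: "Rel a a'" for a a'
    proof -
      obtain c u where c: "c \<in> MC (Suc p) (Suc 0) e" "u \<in> MC (Suc (Suc p)) 0 e" "Dm p c = a" "KD c = Dm (Suc p) u" "cst u = a'"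
        using rel unfolding Rel_def by blast
      show ?thesis
      proof
        assume "a \<in> bnd p (Suc 0) e"
        then obtain c1 where c1: "c1 \<in> MC (Suc p) (Suc (Suc 0)) e" "a = KD (Dm p c1)" unfolding bnd_def by blast
        have "c - KD c1 \<in> MC (Suc p) (Suc 0) e" by (rule MC_diff[OF c(1) KD_MC[OF c1(1)]])
        moreover have "Dm p (c - KD c1) = 0" by (simp add: Dm_diff c(3) c1(2) KD_Dm)
        ultimately obtain c2 where c2: "c2 \<in> MC (Suc (Suc p)) (Suc 0) e" "Dm (Suc p) c2 = c - KD c1"
          using Dm_exact by blast
        \<comment> \<open>Subtracting \<open>KD c2\<close> does not change the constant terms of u
          but makes the difference a cycle for \<open>Dm (Suc p)\<close>.\<close>
        have m: "u - KD c2 \<in> MC (Suc (Suc p)) 0 e" by (rule MC_diff[OF c(2) KD_MC[OF c2(1)]])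
        have "Dm (Suc p) (KD c2) = KD c"
          unfolding KD_Dm[symmetric] c2(2) by (simp add: KD_diff KD_KD[OF c1(1)])
        then have "Dm (Suc p) (u - KD c2) = 0" by (simp add: Dm_diff c(4))
        from Dm_exact[OF m this] obtain v where v: "v \<in> MC (Suc (Suc (Suc p))) 0 e" "Dm (Suc (Suc p)) v = u - KD c2"
          by blast
        have "TD (Suc (Suc p)) (cst v) = a'"
          using cst_Dm[of "Suc (Suc p)" v] by (simp add: v(2) cst_diff cst_KD c(5))
        then show "a' \<in> tbnd (Suc p) e" unfolding tbnd_def using cst_TC[OF v(1)] by blast
      next
        assume "a' \<in> tbnd (Suc p) e"
        then obtain w where w: "w \<in> TC (Suc (Suc (Suc p))) e" "a' = TD (Suc (Suc p)) w" unfolding tbnd_def by blast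
        let ?v = "Dm (Suc (Suc p)) (emb w)"
        have m: "u - ?v \<in> MC (Suc (Suc p)) 0 e" by (rule MC_diff[OF c(2) Dm_MC[OF emb_MC[OF w(1)]]])
        have "cst (u - ?v) = 0" by (simp add: cst_diff c(5) w(2) cst_Dm)
        from KD_exact_0[OF m this] obtain c2 where c2: "c2 \<in> MC (Suc (Suc p)) (Suc 0) e" "KD c2 = u - ?v" by blast
        have m2: "c - Dm (Suc p) c2 \<in> MC (Suc p) (Suc 0) e" by (rule MC_diff[OF c(1) Dm_MC[OF c2(1)]])
        have "KD (c - Dm (Suc p) c2) = 0"
          by (simp add: KD_diff c(4) KD_Dm c2(2) Dm_diff Dm_Dm[OF emb_MC[OF w(1)]])
        from KD_exact[OF m2 this] obtain c1 where c1: "c1 \<in> MC (Suc p) (Suc (Suc 0)) e" "KD c1 = c - Dm (Suc p) c2"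
          by blast
        have "KD (Dm p c1) = a" by (simp add: KD_Dm c1(2) Dm_diff c(3) Dm_Dm[OF c2(1)])
        then show "a \<in> bnd p (Suc 0) e" unfolding bnd_def using c1(1) by blast
      qed
    qed
  qed
  then show ?thesis
    unfolding khom_def
    by (rule diff_eq_of_sum_eq)
       (rule mv.dim_mono_fin[OF fin_dim_cyc bnd_cyc] tv.dim_mono_fin[OF fin_dim_tcyc tbnd_tcyc])+
qed

text \<open>In index 0 every chain is a Koszul cycle, so a single lift along \<open>Dm 0\<close>
  followed by \<open>cst\<close> gives the comparison.\<close>

lemma khom_0: "khom 0 0 e = tv.dim (tcyc 0 e) - tv.dim (tbnd 0 e)"
proof -
  define Rel where "Rel z w \<longleftrightarrow> (\<exists>u\<in>MC (Suc 0) 0 e. Dm 0 u = z \<and> cst u = w)" for z w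
  have "mv.dim (cyc 0 0 e) + tv.dim (tbnd 0 e) = tv.dim (tcyc 0 e) + mv.dim (bnd 0 0 e)"
  proof (rule quot_dim_rel[where R = Rel, OF vector_space_mscale vector_space_kscale subspace_bnd subspace_tbnd
        subspace_cyc subspace_tcyc fin_dim_cyc fin_dim_tcyc bnd_cyc tbnd_tcyc])
    show "Rel 0 0" unfolding Rel_def by (intro bexI[of _ 0]) simp_all
    show "Rel (x + y) (x' + y')" if xy: "Rel x x'" "Rel y y'" for x y x' y'
    proof -
      obtain u u' where "u \<in> MC (Suc 0) 0 e" "Dm 0 u = x" "cst u = x'"
        "u' \<in> MC (Suc 0) 0 e" "Dm 0 u' = y" "cst u' = y'"
        using xy unfolding Rel_def by blast
      then show ?thesis unfolding Rel_def
        by (intro bexI[of _ "u + u'"]) (simp_all add: Dm_add MC_add cst_add)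
    qed
    show "Rel (mscale k x) (kscale k x')" if xy: "Rel x x'" for k x x'
    proof -
      obtain u where "u \<in> MC (Suc 0) 0 e" "Dm 0 u = x" "cst u = x'"
        using xy unfolding Rel_def by blast
      then show ?thesis unfolding Rel_def
        by (intro bexI[of _ "mscale k u"]) (simp_all add: Dm_scale MC_scale cst_scale)
    qed
    show "\<exists>a'\<in>tcyc 0 e. Rel a a'" if a: "a \<in> cyc 0 0 e" for a
    proof -
      obtain u where u: "u \<in> MC (Suc 0) 0 e" "Dm 0 u = a" using a unfolding cyc_def by blast
      have "cst u \<in> tcyc 0 e" using cst_TC[OF u(1)] by (simp add: tcyc_def)
      then show ?thesis unfolding Rel_def using u by blast
    qed
    show "\<exists>a\<in>cyc 0 0 e. Rel a a'" if a: "a' \<in> tcyc 0 e" for a'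
    proof -
      have m: "emb a' \<in> MC (Suc 0) 0 e" by (rule emb_MC) (use a in \<open>simp add: tcyc_def\<close>)
      have "KD (Dm 0 (emb a')) = 0" by (rule KD_0'[OF Dm_MC[OF m]])
      then have "Dm 0 (emb a') \<in> cyc 0 0 e" unfolding cyc_def using m by blast
      moreover have "Rel (Dm 0 (emb a')) a'" unfolding Rel_def by (intro bexI[OF _ m]) simp
      ultimately show ?thesis by blast
    qed
    show "a \<in> bnd 0 0 e \<longleftrightarrow> a' \<in> tbnd 0 e" if rel: "Rel a a'" for a a'
    proof -
      obtain u where c: "u \<in> MC (Suc 0) 0 e" "Dm 0 u = a" "cst u = a'"
        using rel unfolding Rel_def by blast
      show ?thesis
      proof
        assume "a \<in> bnd 0 0 e"
        then obtain c1 where c1: "c1 \<in> MC (Suc 0) (Suc 0) e" "a = KD (Dm 0 c1)" unfolding bnd_def by blast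
        have m: "u - KD c1 \<in> MC (Suc 0) 0 e" by (rule MC_diff[OF c(1) KD_MC[OF c1(1)]])
        have "Dm 0 (u - KD c1) = 0" by (simp add: Dm_diff c(2) c1(2) KD_Dm)
        from Dm_exact[OF m this] obtain v where v: "v \<in> MC (Suc (Suc 0)) 0 e" "Dm (Suc 0) v = u - KD c1"
          by blast
        have "TD (Suc 0) (cst v) = a'"
          using cst_Dm[of "Suc 0" v] by (simp add: v(2) cst_diff cst_KD c(3))
        then show "a' \<in> tbnd 0 e" unfolding tbnd_def using cst_TC[OF v(1)] by blast
      next
        assume "a' \<in> tbnd 0 e"
        then obtain w where w: "w \<in> TC (Suc (Suc 0)) e" "a' = TD (Suc 0) w" unfolding tbnd_def by blast
        let ?v = "Dm (Suc 0) (emb w)"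
        have m: "u - ?v \<in> MC (Suc 0) 0 e" by (rule MC_diff[OF c(1) Dm_MC[OF emb_MC[OF w(1)]]])
        have "cst (u - ?v) = 0" by (simp add: cst_diff c(3) w(2) cst_Dm)
        from KD_exact_0[OF m this] obtain c1 where c1: "c1 \<in> MC (Suc 0) (Suc 0) e" "KD c1 = u - ?v" by blast
        have "KD (Dm 0 c1) = a" by (simp add: KD_Dm c1(2) Dm_diff c(2) Dm_Dm[OF emb_MC[OF w(1)]])
        then show "a \<in> bnd 0 0 e" unfolding bnd_def using c1(1) by blast
      qed
    qed
  qed
  then show ?thesis
    unfolding khom_def
    by (rule diff_eq_of_sum_eq)
       (rule mv.dim_mono_fin[OF fin_dim_cyc bnd_cyc] tv.dim_mono_fin[OF fin_dim_tcyc tbnd_tcyc])+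
qed

text \<open>For i > 0, shifting i - 1 times along the resolution trades H_i of the first image for
  H_1 of a later one.\<close>

lemma khom_tor: "khom 0 i e = tv.dim (tcyc i e) - tv.dim (tbnd i e)"
proof (cases i)
  case 0
  then show ?thesis by (simp add: khom_0)
next
  case (Suc i')
  have "khom q (Suc i') e = khom (q + i') (Suc 0) e" for q
  proof (induction i' arbitrary: q)
    case (Suc i'')
    have "khom q (Suc (Suc i'')) e = khom (Suc q) (Suc i'') e" by (rule khom_shift) simp
    then show ?case using Suc.IH[of "Suc q"] by simp
  qed simp
  from this[of 0] show ?thesis by (simp add: khom_1 Suc)
qed

text \<open>The image of G_1 \<rightarrow> G_0 is I in the single coordinate of G_0 = S; the
  injection \<open>one\<close> transports cycles and boundaries, hence their dimensions.\<close>

lemma khom_kdim: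
  assumes R0: "R 0 = 1" and sh0: "sh 0 = (\<lambda>_. 0)" and I: "hideal n I"
    and im: "mmap (R 0) (R (Suc 0)) (E 0) ` free_module n (R (Suc 0)) = {v. v 0 \<in> I \<and> (\<forall>b\<ge>1. v b = 0)}"
  shows "khom 0 i e = kdim n I i e"
proof -
  have img: "Dm 0 ` MC (Suc 0) i e = {c \<in> MC 0 i e. \<forall>\<sigma>. c 0 \<sigma> \<in> I}" for i
  proof
    show "Dm 0 ` MC (Suc 0) i e \<subseteq> {c \<in> MC 0 i e. \<forall>\<sigma>. c 0 \<sigma> \<in> I}"
    proof
      fix y assume "y \<in> Dm 0 ` MC (Suc 0) i e"
      then obtain c where c: "c \<in> MC (Suc 0) i e" "y = Dm 0 c" by blast
      have "y 0 \<sigma> \<in> I" for \<sigma>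
      proof -
        have "mmap (R 0) (R (Suc 0)) (E 0) (\<lambda>b. c b \<sigma>) \<in> {v. v 0 \<in> I \<and> (\<forall>b\<ge>1. v b = 0)}"
          unfolding im[symmetric] using MC_free[OF c(1)] by blast
        then show ?thesis by (simp add: c(2) Dm_def)
      qed
      then show "y \<in> {c \<in> MC 0 i e. \<forall>\<sigma>. c 0 \<sigma> \<in> I}" using Dm_MC[OF c(1)] c(2) by blast
    qed
    show "{c \<in> MC 0 i e. \<forall>\<sigma>. c 0 \<sigma> \<in> I} \<subseteq> Dm 0 ` MC (Suc 0) i e"
    proof
      fix c assume c: "c \<in> {c \<in> MC 0 i e. \<forall>\<sigma>. c 0 \<sigma> \<in> I}"
      then have "\<exists>c'\<in>MC (Suc 0) i e. Dm 0 c' = c"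
      proof (intro Dm_lift)
        show "(\<lambda>b. c b \<sigma>) \<in> mmap (R 0) (R (Suc 0)) (E 0) ` free_module n (R (Suc 0))" for \<sigma>
          unfolding im using c MC_D(2)[of c 0 i e] R0 by simp
      qed simp
      then show "c \<in> Dm 0 ` MC (Suc 0) i e" by blast
    qed
  qed
  define one where "one z = (\<lambda>b::nat. if b = 0 then z else 0)" for z :: "nat set \<Rightarrow> 'k mpol"
  have oneMC: "one z \<in> MC 0 i e" if "z \<in> kch n i i e" for z i
    by (rule MC_I) (use that R0 sh0 in \<open>auto simp: one_def\<close>)
  have MC0: "c = one (c 0)" "c 0 \<in> kch n i i e" if c: "c \<in> MC 0 i e" for c i
  proof -
    have "c b = one (c 0) b" for b using MC_D(2)[OF c, of b] R0 by (simp add: one_def)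
    then show "c = one (c 0)" by blast
    show "c 0 \<in> kch n i i e" using MC_D(1)[OF c, of 0] sh0 by simp
  qed
  have KDone: "KD (one z) = one (kos n z)" for z by (intro ext) (simp add: KD_def one_def)
  have one0: "one z 0 = z" "one z = 0 \<longleftrightarrow> z = 0" for z
    by (auto simp: one_def fun_eq_iff)
  have cyc_eq: "cyc 0 i e = one ` kcyc n I i e" for i
  proof
    show "cyc 0 i e \<subseteq> one ` kcyc n I i e"
    proof
      fix c assume "c \<in> cyc 0 i e"
      then have c: "c \<in> MC 0 i e" "\<forall>\<sigma>. c 0 \<sigma> \<in> I" "KD c = 0" unfolding cyc_def img by auto
      have "kos n (c 0) = 0" using fun_cong[OF c(3), of 0] by (simp add: KD_def)
      then have "c 0 \<in> kcyc n I i e" using MC0(2)[OF c(1)] c(2) by (simp add: kcyc_def)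
      then show "c \<in> one ` kcyc n I i e" using MC0(1)[OF c(1)] by blast
    qed
    show "one ` kcyc n I i e \<subseteq> cyc 0 i e"
      unfolding cyc_def img using oneMC KDone one0 by (auto simp: kcyc_def)
  qed
  have bnd_eq: "bnd 0 i e = one ` kbnd n I i e" for i
  proof
    show "bnd 0 i e \<subseteq> one ` kbnd n I i e"
    proof
      fix y assume "y \<in> bnd 0 i e"
      then obtain c where c: "c \<in> MC 0 (Suc i) e" "\<forall>\<sigma>. c 0 \<sigma> \<in> I" "y = KD c" unfolding bnd_def img by blast
      have "y = one (kos n (c 0))" using c(3) MC0(1)[OF c(1)] KDone by metis
      moreover have "kos n (c 0) \<in> kbnd n I i e" unfolding kbnd_def using MC0(2)[OF c(1)] c(2) by blast
      ultimately show "y \<in> one ` kbnd n I i e" by blast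
    qed
    show "one ` kbnd n I i e \<subseteq> bnd 0 i e"
    proof
      fix y assume "y \<in> one ` kbnd n I i e"
      then obtain z where z: "z \<in> kch n (Suc i) (Suc i) e" "\<forall>\<sigma>. z \<sigma> \<in> I" "y = one (kos n z)"
        unfolding kbnd_def by blast
      have "y = KD (one z)" using z(3) KDone by simp
      moreover have "one z \<in> {c \<in> MC 0 (Suc i) e. \<forall>\<sigma>. c 0 \<sigma> \<in> I}" using oneMC[OF z(1)] z(2) one0 by simp
      ultimately show "y \<in> bnd 0 i e" unfolding bnd_def img by blast
    qed
  qed
  have lin: "Vector_Spaces.linear (fscale pscale) mscale one"
  proof -
    have "one (x + y) = one x + one y" "one (fscale pscale k x) = mscale k (one x)" for x y k
      by (intro ext; simp add: one_def fscale_def[of "fscale pscale"] fscale_def pscale_def)+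
    then show ?thesis by (simp add: Vector_Spaces.linear_iff kv.vector_space_axioms mv.vector_space_axioms)
  qed
  have dim_inj: "mv.dim (one ` A) = kv.dim A" if "kv.subspace A" "fin_dim (fscale pscale) A" for A
  proof -
    have "{a \<in> A. one a = 0} = {0}" using kv.subspace_0[OF that(1)] by (auto simp: one0)
    then show ?thesis using rank_nullity(1)[OF lin that] by (simp add: kv.dim_0)
  qed
  have "fin_dim (fscale pscale) (kbnd n I i e)"
    by (rule fin_dim_mono[OF fin_dim_kcyc kbnd_subset[OF I]])
  then show ?thesis
    unfolding khom_def kdim_def cyc_eq bnd_eq
    by (simp add: dim_inj subspace_kcyc[OF I] subspace_kbnd[OF I] fin_dim_kcyc)
qed

end

lemma tor_dim_kdim:
  fixes I :: "'k::field mpol set"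
  assumes F: "graded_free_resolution n I F" and I: "hideal n I"
  shows "tor_dim F i e = kdim n I i e"
proof -
  have g: "gcx n (aR F) (ash F) (aE F)" and aug: "aug_map F ` free_module n (rk F 0) = I"
    using F by (auto simp: resolution_iff)
  interpret gcx n "aR F" "ash F" "aE F" by (rule g)
  have td: "TD (Suc i) = tensor_diff F i" for i
    by (intro ext) (simp add: TD_def tensor_diff_def)
  have tc: "TC (Suc i) e = tensor_comp F i e" for i by (simp add: TC_def tensor_comp_def)
  have cy: "tcyc i e = tensor_cycles F i e" by (cases i) (simp_all add: tcyc_def tc td)
  have bn: "tbnd i e = tensor_boundaries F i e" by (simp add: tbnd_def tensor_boundaries_def tc td)
  have "mmap (aR F 0) (aR F (Suc 0)) (aE F 0) ` free_module n (aR F (Suc 0)) = {v. v 0 \<in> I \<and> (\<forall>b\<ge>1. v b = 0)}"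
  proof
    show "mmap (aR F 0) (aR F (Suc 0)) (aE F 0) ` free_module n (aR F (Suc 0)) \<subseteq> {v. v 0 \<in> I \<and> (\<forall>b\<ge>1. v b = 0)}"
      using aug by (auto simp: aug_map_mmap)
    show "{v. v 0 \<in> I \<and> (\<forall>b\<ge>1. v b = 0)} \<subseteq> mmap (aR F 0) (aR F (Suc 0)) (aE F 0) ` free_module n (aR F (Suc 0))"
    proof
      fix v :: "nat \<Rightarrow> 'k mpol" assume v: "v \<in> {v. v 0 \<in> I \<and> (\<forall>b\<ge>1. v b = 0)}"
      then have "v 0 \<in> aug_map F ` free_module n (rk F 0)" using aug by simp
      then obtain u where u: "u \<in> free_module n (rk F 0)" "v 0 = aug_map F u" by blast
      have "v = (\<lambda>c. if c = 0 then aug_map F u else 0)" using v u(2) by (intro ext) auto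
      then have "v = mmap (aR F 0) (aR F (Suc 0)) (aE F 0) u" by (simp add: aug_map_mmap)
      then show "v \<in> mmap (aR F 0) (aR F (Suc 0)) (aE F 0) ` free_module n (aR F (Suc 0))" using u(1) by simp
    qed
  qed
  from khom_kdim[OF _ _ I this] show ?thesis
    unfolding tor_dim_def cy[symmetric] bn[symmetric] khom_tor[symmetric] by simp
qed

text \<open>Koszul homology mentions no resolution, so the value of \<open>betti\<close> does not
  depend on which one \<open>SOME\<close> picks; existence guarantees that it picks one at
  all.\<close>

lemma betti_kdim:
  fixes I :: "'k::field mpol set"
  assumes "hideal n I"
  shows "betti n I i e = kdim n I i e"
  unfolding betti_def by (rule tor_dim_kdim[OF someI_ex[OF resolution_exists[OF assms]] assms])

section \<open>Linear resolutions and Hilbert functions\<close>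

definition linres :: "nat \<Rightarrow> nat \<Rightarrow> 'k::field mpol set \<Rightarrow> bool" where
  "linres n d I \<longleftrightarrow> (\<forall>i j. j \<noteq> d \<longrightarrow> kdim n I i (i + j) = 0)"

lemma linres_betti: "hideal n I \<Longrightarrow> linres n d I \<longleftrightarrow> linear_resolution n d I"
  by (simp add: linres_def linear_resolution_def betti_kdim)

lemma kdim_eq_0_iff:
  assumes I: "hideal n I"
  shows "kdim n I i e = 0 \<longleftrightarrow> kcyc n I i e = kbnd n I i e"
proof
  assume "kdim n I i e = 0"
  then have "kv.dim (kcyc n I i e) \<le> kv.dim (kbnd n I i e)" by (simp add: kdim_def)
  then show "kcyc n I i e = kbnd n I i e"
    by (rule kv.dim_eq_imp_eq[OF fin_dim_kcyc subspace_kcyc[OF I] subspace_kbnd[OF I] kbnd_subset[OF I]])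
qed (simp add: kdim_def)

lemma linres_cyc:
  assumes I: "hideal n I" and L: "linres n d I" and z: "z \<in> kch n i i (i + j)" "\<And>\<sigma>. z \<sigma> \<in> I" "kos n z = 0"
    and j: "j \<noteq> d"
  obtains c where "c \<in> kch n (Suc i) (Suc i) (i + j)" "\<And>\<sigma>. c \<sigma> \<in> I" "kos n c = z"
proof -
  have "z \<in> kcyc n I i (i + j)" using z by (simp add: kcyc_def)
  then have "z \<in> kbnd n I i (i + j)" using L j kdim_eq_0_iff[OF I, of i "i + j"] by (simp add: linres_def)
  then obtain c where "c \<in> kch n (Suc i) (Suc i) (i + j)" "\<forall>\<sigma>. c \<sigma> \<in> I" "z = kos n c"
    unfolding kbnd_def by blast
  then show ?thesis using that by blast
qed

text \<open>Nakayama's lemma in low degrees: a form of I in degree e < d is a cycle of index 0,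
  hence the boundary of a chain with coefficients in I of degree e - 1, which vanish by
  induction.\<close>

lemma linres_low:
  assumes I: "hideal n I" and L: "linres n d I"
  shows "e < d \<Longrightarrow> I \<inter> forms n e = {0}"
proof (induction e rule: less_induct)
  case (less e)
  have "p = 0" if p: "p \<in> I" "p \<in> forms n e" for p
  proof -
    define z where "z = (\<lambda>\<sigma>::nat set. if \<sigma> = {} then p else 0)"
    have z: "z \<in> kch n 0 0 (0 + e)"
      by (rule kchI) (use p(2) in \<open>auto simp: z_def sforms_eq split: if_splits\<close>)
    have zI: "z \<sigma> \<in> I" for \<sigma> using p(1) hidealD(2)[OF I] by (simp add: z_def)
    have ed: "e \<noteq> d" using less.prems by simp
    obtain c where c: "c \<in> kch n (Suc 0) (Suc 0) (0 + e)" "\<And>\<sigma>. c \<sigma> \<in> I" "kos n c = z"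
      using linres_cyc[OF I L z zI kos_kch_0[OF z] ed] by blast
    have "c \<sigma> = 0" for \<sigma>
    proof (cases "Suc 0 \<le> e")
      case True
      then have "c \<sigma> \<in> I \<inter> forms n (e - 1)" using kchD(1)[OF c(1), of \<sigma>] c(2) by (simp add: sforms_eq)
      moreover have "I \<inter> forms n (e - 1) = {0}" by (rule less.IH) (use less.prems True in auto)
      ultimately show ?thesis by blast
    next
      case False
      then show ?thesis using kchD(1)[OF c(1), of \<sigma>] by (simp add: sforms_eq)
    qed
    then have "c = (\<lambda>_. 0)" by (intro ext) simp
    then have "z = (\<lambda>_. 0)" using c(3) by simp
    then have "z {} = 0" by simp
    then show "p = 0" by (simp add: z_def)
  qed
  then show ?case using hidealD(2)[OF I] by auto
qed

text \<open>The connecting map of 0 -> I -> S -> S/I sends a cycle z modulo I to its boundary, a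
  cycle in I that linearity makes bound some c in I; then z - c is a cycle of the exact Koszul
  complex of S. The hypothesis on d settles the constants when d = 0.\<close>

lemma linres_reg:
  assumes I: "hideal n I" and L: "linres n d I" and d: "0 < d \<or> forms n 0 \<subseteq> I"
  shows "reg n I d"
  unfolding reg_def
proof (intro allI impI ballI)
  fix i e and z :: "nat set \<Rightarrow> 'a mpol"
  assume e: "i + d \<le> e" and z: "z \<in> kch n i i e" "\<forall>\<sigma>. kos n z \<sigma> \<in> I"
  show "\<exists>w\<in>kch n (Suc i) (Suc i) e. \<forall>\<sigma>. z \<sigma> - kos n w \<sigma> \<in> I"
  proof (cases i)
    case 0
    show ?thesis
    proof (cases "e = 0")
      case True
      then have "d = 0" using e by simp
      then have "z \<sigma> \<in> I" for \<sigma> using kchD(1)[OF z(1), of \<sigma>] d True 0 by (auto simp: sforms_eq)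
      then show ?thesis by (intro bexI[of _ 0]) simp_all
    next
      case False
      have "kos n z = 0" using z(1) 0 kos_kch_0 by blast
      from kos_exact[OF z(1) this] False 0 obtain w where "w \<in> kch n (Suc i) (Suc i) e" "kos n w = z" by auto
      then show ?thesis using hidealD(2)[OF I] by (intro bexI[of _ w]) simp_all
    qed
  next
    case (Suc i')
    \<comment> \<open>Lowering the index by one at the same total degree raises j by one, so e - i
      \<ge> d gives j > d.\<close>
    define j where "j = e - i'"
    have j: "e = i' + j" "j \<noteq> d" using e Suc by (auto simp: j_def)
    have k1: "kos n z \<in> kch n i' i' (i' + j)" using kos_kch[of z n i' i' e] z(1) Suc j(1) by simp
    have k2: "kos n (kos n z) = 0" using kos_kos_kch[of z n i' i' e] z(1) Suc by simp
    have k3: "kos n z \<sigma> \<in> I" for \<sigma> using z(2) by blast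
    obtain c where c: "c \<in> kch n (Suc i') (Suc i') (i' + j)" "\<And>\<sigma>. c \<sigma> \<in> I" "kos n c = kos n z"
      using linres_cyc[OF I L k1 k3 k2 j(2)] by blast
    have m: "z - c \<in> kch n i i e" by (rule kv.subspace_diff[OF subspace_kch z(1)]) (use c(1) Suc j(1) in simp)
    have "kos n (z - c) = 0" by (simp add: kos_minus c(3))
    from kos_exact[OF m this] Suc obtain w where w: "w \<in> kch n (Suc i) (Suc i) e" "kos n w = z - c" by auto
    show ?thesis using w c(2) by (intro bexI[of _ w]) simp_all
  qed
qed

text \<open>The connecting map read backwards: a cycle in I bounds some w over S, which is a cycle
  modulo I and can be corrected into I. This takes care of j > d; for j < d all chains in I
  vanish.\<close>

lemma reg_linres:
  assumes I: "hideal n I" and Rg: "reg n I d" and low: "\<And>e. e < d \<Longrightarrow> I \<inter> forms n e = {0}"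
  shows "linres n d I"
  unfolding linres_def
proof (intro allI impI)
  fix i j assume j: "j \<noteq> d"
  have "kcyc n I i (i + j) \<subseteq> kbnd n I i (i + j)"
  proof
    fix c assume "c \<in> kcyc n I i (i + j)"
    then have c: "c \<in> kch n i i (i + j)" "\<forall>\<sigma>. c \<sigma> \<in> I" "kos n c = 0" by (auto simp: kcyc_def)
    show "c \<in> kbnd n I i (i + j)"
    proof (cases "j < d")
      case True
      have "c \<sigma> \<in> I \<inter> forms n j" for \<sigma> using kchD(1)[OF c(1), of \<sigma>] c(2) by (simp add: sforms_eq)
      then have "c \<sigma> = 0" for \<sigma> using low[OF True] by blast
      then have "c = kos n 0" by (intro ext) simp
      then show ?thesis unfolding kbnd_def using hidealD(2)[OF I] by (auto intro!: image_eqI[of _ _ 0])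
    next
      case False
      then have jd: "d < j" using j by simp
      obtain w where w: "w \<in> kch n (Suc i) (Suc i) (i + j)" "kos n w = c" using kos_exact[OF c(1,3)] jd by auto
      have "kos n w \<sigma> \<in> I" for \<sigma> using w(2) c(2) by simp
      moreover have "Suc i + d \<le> i + j" using jd by simp
      ultimately obtain u where u: "u \<in> kch n (Suc (Suc i)) (Suc (Suc i)) (i + j)" "\<And>\<sigma>. w \<sigma> - kos n u \<sigma> \<in> I"
        using regD[OF Rg w(1)] by blast
      have m: "w - kos n u \<in> kch n (Suc i) (Suc i) (i + j)"
        by (rule kv.subspace_diff[OF subspace_kch w(1) kos_kch[OF u(1)]])
      have "c = kos n (w - kos n u)" by (simp add: kos_minus w(2) kos_kos_kch[OF u(1)])
      then show ?thesis unfolding kbnd_def using m u(2) by (auto intro!: image_eqI[of _ _ "w - kos n u"])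
    qed
  qed
  then have "kcyc n I i (i + j) = kbnd n I i (i + j)" using kbnd_subset[OF I] by blast
  then show "kdim n I i (i + j) = 0" by (simp add: kdim_eq_0_iff[OF I])
qed

section \<open>Hilbert functions and Euler characteristics\<close>

definition hilb :: "nat \<Rightarrow> 'k::field mpol set \<Rightarrow> nat \<Rightarrow> nat" where
  "hilb n I e = pv.dim (I \<inter> forms n e)"

definition kI :: "nat \<Rightarrow> 'k::field mpol set \<Rightarrow> nat \<Rightarrow> nat \<Rightarrow> (nat set \<Rightarrow> 'k mpol) set" where
  "kI n I i e = {z \<in> kch n i i e. \<forall>\<sigma>. z \<sigma> \<in> I}"

lemma kI_dim:
  assumes I: "hideal n I"
  shows "kv.dim (kI n I i e) = (if i \<le> e then (n choose i) * hilb n I (e - i) else 0)"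
proof (cases "i \<le> e")
  case True
  have "kI n I i e = fun_space (ksub n i) (I \<inter> forms n (e - i))"
    using True by (auto simp: kI_def kch_def fun_space_def sforms_eq)
  then show ?thesis
    using fun_space_dim[OF vector_space_pscale subspace_hideal[OF I] fin_dim_hideal finite_ksub] True
    by (simp add: card_ksub hilb_def)
next
  case False
  have "kI n I i e = {0}"
  proof
    show "kI n I i e \<subseteq> {0}"
    proof
      fix z assume z: "z \<in> kI n I i e"
      have "z \<sigma> = 0" for \<sigma> using z kchD(1)[of z n i i e \<sigma>] False by (simp add: kI_def sforms_eq)
      then show "z \<in> {0}" by (simp add: fun_eq_iff)
    qed
    show "{0} \<subseteq> kI n I i e" using hidealD(2)[OF I] by (simp add: kI_def)
  qed
  then show ?thesis using False by (simp add: kv.dim_0)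
qed

lemma kI_rank:
  assumes I: "hideal n I"
  shows "kv.dim (kI n I i e) = kv.dim (kos n ` kI n I i e) + kv.dim (kcyc n I i e)"
proof -
  have 1: "{z \<in> kI n I i e. kos n z = 0} = kcyc n I i e" by (auto simp: kI_def kcyc_def)
  have 2: "kv.subspace (kI n I i e)" unfolding kI_def by (rule subspace_kI[OF I])
  have 3: "fin_dim (fscale pscale) (kI n I i e)"
    by (rule fin_dim_mono[OF fin_dim_kch[of n i i e]]) (auto simp: kI_def)
  show ?thesis using rank_nullity(1)[OF linear_kos 2 3, of n] unfolding 1 .
qed

lemma kbnd_kI: "kbnd n I i e = kos n ` kI n I (Suc i) e"
  by (simp add: kbnd_def kI_def)

text \<open>Rank-nullity for each differential. The partial sum leaves the dimension of the last
  boundary space as its error term.\<close>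

lemma euler_partial:
  assumes I: "hideal n I"
  shows "(\<Sum>i\<le>m. (-1) ^ i * int (kv.dim (kI n I i e))) =
    (\<Sum>i\<le>m. (-1) ^ i * int (kdim n I i e)) + (-1) ^ m * int (kv.dim (kbnd n I m e))"
proof -
  have cyc: "int (kv.dim (kcyc n I i e)) = int (kdim n I i e) + int (kv.dim (kbnd n I i e))" for i
    using kv.dim_mono_fin[OF fin_dim_kcyc kbnd_subset[OF I, of i e]] by (simp add: kdim_def)
  show ?thesis
  proof (induction m)
    case 0
    have "kos n ` kI n I 0 e \<subseteq> {0}" using kos_kch_0 by (auto simp: kI_def)
    then have "kv.dim (kos n ` kI n I 0 e) = 0"
      using kv.dim_mono_fin[OF kv.fin_dim_0, of "kos n ` kI n I 0 e"] kv.dim_0 by simp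
    then show ?case using kI_rank[OF I, of 0 e] cyc[of 0] by simp
  next
    case (Suc m)
    have "int (kv.dim (kI n I (Suc m) e)) = int (kv.dim (kbnd n I m e)) + int (kdim n I (Suc m) e) +
        int (kv.dim (kbnd n I (Suc m) e))"
      using kI_rank[OF I, of "Suc m" e] cyc[of "Suc m"] by (simp add: kbnd_kI)
    then show ?case using Suc by (simp add: algebra_simps)
  qed
qed

text \<open>In total degree i + d linearity leaves index i as the only place with homology, so the
  Euler characteristic is that Betti number up to sign. Terms with j > i involve I below degree d,
  where it vanishes.\<close>

lemma linres_kdim:
  assumes I: "hideal n I" and L: "linres n d I"
  shows "int (kdim n I i (i + d)) =
    (\<Sum>j\<le>i. (-1) ^ (i + j) * int (n choose j) * int (hilb n I (d + i - j)))"
proof -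
  let ?e = "i + d"
  \<comment> \<open>A chain whose index exceeds its total degree is zero, so summing up to
    \<open>?e\<close> reaches the end of the complex.\<close>
  have "kv.dim (kbnd n I ?e ?e) = 0"
  proof -
    have "kI n I (Suc ?e) ?e \<subseteq> {0}"
    proof
      fix z assume z: "z \<in> kI n I (Suc ?e) ?e"
      have "z \<sigma> = 0" for \<sigma> using z kchD(1)[of z n "Suc ?e" "Suc ?e" ?e \<sigma>] by (simp add: kI_def sforms_eq)
      then show "z \<in> {0}" by (simp add: fun_eq_iff)
    qed
    then have "kbnd n I ?e ?e \<subseteq> {0}" unfolding kbnd_kI by auto
    then show ?thesis using kv.dim_mono_fin[OF kv.fin_dim_0, of "kbnd n I ?e ?e"] kv.dim_0 by simp
  qed
  then have eu: "(\<Sum>j\<le>?e. (-1) ^ j * int (kv.dim (kI n I j ?e))) = (\<Sum>j\<le>?e. (-1) ^ j * int (kdim n I j ?e))"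
    using euler_partial[OF I, of ?e ?e] by simp
  have "(\<Sum>j\<le>?e. (-1) ^ j * int (kdim n I j ?e)) = (\<Sum>j\<le>?e. if j = i then (-1) ^ i * int (kdim n I i ?e) else 0)"
  proof (intro sum.cong refl)
    fix j assume j: "j \<in> {..?e}"
    have "kdim n I j (j + (?e - j)) = 0" if "?e - j \<noteq> d" using L that by (simp add: linres_def)
    then show "(-1) ^ j * int (kdim n I j ?e) = (if j = i then (-1) ^ i * int (kdim n I i ?e) else 0)"
      using j by (cases "j = i") auto
  qed
  also have "\<dots> = (-1) ^ i * int (kdim n I i ?e)" by simp
  finally have k: "(-1) ^ i * int (kdim n I i ?e) = (\<Sum>j\<le>?e. (-1) ^ j * int (kv.dim (kI n I j ?e)))" using eu by simp
  also have "\<dots> = (\<Sum>j\<le>?e. (-1) ^ j * (int (n choose j) * int (hilb n I (?e - j))))"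
    by (intro sum.cong refl) (simp add: kI_dim[OF I])
  also have "\<dots> = (\<Sum>j\<le>i. (-1) ^ j * (int (n choose j) * int (hilb n I (?e - j))))"
  proof (intro sum.mono_neutral_right ballI)
    fix j assume "j \<in> {..?e} - {..i}"
    then have "?e - j < d" by auto
    then have "hilb n I (?e - j) = 0" using linres_low[OF I L] by (simp add: hilb_def pv.dim_0)
    then show "(-1) ^ j * (int (n choose j) * int (hilb n I (?e - j))) = 0" by simp
  qed auto
  finally have "(-1) ^ i * ((-1) ^ i * int (kdim n I i ?e)) =
      (-1) ^ i * (\<Sum>j\<le>i. (-1) ^ j * (int (n choose j) * int (hilb n I (?e - j))))" by simp
  moreover have "(-1) ^ i * ((-1) ^ i * x) = x" for x :: int by (simp flip: mult.assoc power_mult_distrib)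
  ultimately show ?thesis by (simp add: sum_distrib_left power_add mult.assoc mult.left_commute add.commute)
qed

lemma linres_kdim_0:
  assumes "hideal n I" "linres n d I"
  shows "kdim n I 0 d = hilb n I d"
  using linres_kdim[OF assms, of 0] by simp

section \<open>Summation by parts and cutting by linear forms\<close>

text \<open>Pascal's rule splits the sum, and the halves recombine into differences of f. The
  recursion prescribes g only from index 1 on; the last term corrects for g 0.\<close>

lemma binomial_difference_step:
  fixes f g :: "nat \<Rightarrow> int"
  assumes fg: "\<And>e. g (Suc e) = f (Suc e) - f e"
  shows "(\<Sum>j\<le>i. (-1) ^ (i + j) * int (Suc m choose j) * f (i - j)) =
    (\<Sum>j\<le>i. (-1) ^ (i + j) * int (m choose j) * g (i - j)) + int (m choose i) * (f 0 - g 0)"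
proof -
  have A: "(\<Sum>j\<le>i. (-1) ^ (i + j) * int (Suc m choose j) * f (i - j)) =
    (\<Sum>j\<le>i. (-1) ^ (i + j) * int (m choose j) * f (i - j)) -
    (\<Sum>j<i. (-1) ^ (i + j) * int (m choose j) * f (i - Suc j))"
  proof (cases i)
    case (Suc i')
    have "(\<Sum>j\<le>i. (-1) ^ (i + j) * int (Suc m choose j) * f (i - j)) =
      (-1) ^ i * f i + (\<Sum>j\<le>i'. (-1) ^ (i + Suc j) * int (Suc m choose Suc j) * f (i - Suc j))"
      by (simp add: Suc sum.atMost_Suc_shift del: sum.atMost_Suc binomial_Suc_Suc)
    also have "(\<Sum>j\<le>i'. (-1) ^ (i + Suc j) * int (Suc m choose Suc j) * f (i - Suc j)) =
        (\<Sum>j\<le>i'. (-1) ^ (i + Suc j) * int (m choose Suc j) * f (i - Suc j)) -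
        (\<Sum>j\<le>i'. (-1) ^ (i + j) * int (m choose j) * f (i - Suc j))"
      unfolding sum_subtractf[symmetric] by (intro sum.cong refl) (simp add: algebra_simps)
    also have "(-1) ^ i * f i + ((\<Sum>j\<le>i'. (-1) ^ (i + Suc j) * int (m choose Suc j) * f (i - Suc j)) -
        (\<Sum>j\<le>i'. (-1) ^ (i + j) * int (m choose j) * f (i - Suc j))) =
        (\<Sum>j\<le>i. (-1) ^ (i + j) * int (m choose j) * f (i - j)) -
        (\<Sum>j\<le>i'. (-1) ^ (i + j) * int (m choose j) * f (i - Suc j))"
      by (simp add: Suc sum.atMost_Suc_shift del: sum.atMost_Suc)
    finally show ?thesis by (simp add: Suc lessThan_Suc_atMost del: sum.atMost_Suc)
  qed simp
  have B: "(\<Sum>j\<le>i. (-1) ^ (i + j) * int (m choose j) * h (i - j)) =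
      (\<Sum>j<i. (-1) ^ (i + j) * int (m choose j) * h (i - j)) + int (m choose i) * h 0" for h :: "nat \<Rightarrow> int"
    by (simp add: lessThan_Suc_atMost[symmetric])
  have "(\<Sum>j<i. (-1) ^ (i + j) * int (m choose j) * g (i - j)) =
      (\<Sum>j<i. (-1) ^ (i + j) * int (m choose j) * f (i - j)) - (\<Sum>j<i. (-1) ^ (i + j) * int (m choose j) * f (i - Suc j))"
  proof -
    have "g (i - j) = f (i - j) - f (i - Suc j)" if "j < i" for j
      using fg[of "i - Suc j"] that by (simp add: Suc_diff_Suc)
    then show ?thesis by (simp add: sum_subtractf[symmetric] right_diff_distrib)
  qed
  then show ?thesis using A B[of f] B[of g] by (simp add: right_diff_distrib)
qed

text \<open>
  \<open>\<Delta> t\<close> is the difference of the Hilbert functions of two quotients, cut down by \<open>t\<close> linear forms and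
  started in degree \<open>d\<close>; the sum is the difference of the \<open>i\<close>-th Betti numbers.  Summation by parts turns
  it into a combination of the \<open>\<Delta> t 0\<close> with coefficients \<open>(m choose i) - (m-1 choose i)\<close>.
\<close>

lemma iterated_difference_nonpos:
  fixes \<Delta> :: "nat \<Rightarrow> nat \<Rightarrow> int"
  assumes step: "\<And>t e. t < n \<Longrightarrow> \<Delta> (Suc t) (Suc e) = \<Delta> t (Suc e) - \<Delta> t e"
    and last: "\<And>e. \<Delta> n e = 0"
    and pos: "\<And>t. 0 < t \<Longrightarrow> t \<le> n \<Longrightarrow> 0 \<le> \<Delta> t 0"
    and neg: "\<Delta> 0 0 \<le> 0"
  shows "(\<Sum>j\<le>i. (-1) ^ (i + j) * int (n choose j) * \<Delta> 0 (i - j)) \<le> 0"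
proof -
  \<comment> \<open>T m starts from the sequence after n - m cuts, so increasing m undoes the cuts
    one by one, from T 0 = 0 to the wanted sum T n.\<close>
  define T where "T m = (\<Sum>j\<le>i. (-1) ^ (i + j) * int (m choose j) * \<Delta> (n - m) (i - j))" for m
  have T0: "T 0 = 0"
    unfolding T_def by (intro sum.neutral ballI) (simp add: last)
  have TS: "T (Suc m) = T m + int (m choose i) * (\<Delta> (n - Suc m) 0 - \<Delta> (n - m) 0)" if m: "m < n" for m
  proof -
    have *: "Suc (n - Suc m) = n - m" using m by simp
    have "\<Delta> (n - m) (Suc e) = \<Delta> (n - Suc m) (Suc e) - \<Delta> (n - Suc m) e" for e
      using step[of "n - Suc m" e] m unfolding * by simp
    from binomial_difference_step[of "\<Delta> (n - m)" "\<Delta> (n - Suc m)", OF this] show ?thesis by (simp add: T_def)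
  qed
  \<comment> \<open>The newest term stays in the bound with coefficient \<open>m choose i\<close>;
    the next step subtracts it with the larger coefficient \<open>Suc m choose i\<close>, which
    absorbs it because it is nonnegative.\<close>
  have "Suc m \<le> n \<Longrightarrow> T (Suc m) \<le> int (m choose i) * \<Delta> (n - Suc m) 0" for m
  proof (induction m)
    case 0
    then show ?case using TS[of 0] T0 last[of 0] by simp
  next
    case (Suc m)
    have "T (Suc m) \<le> int (m choose i) * \<Delta> (n - Suc m) 0" using Suc by simp
    also have "\<dots> \<le> int (Suc m choose i) * \<Delta> (n - Suc m) 0"
    proof (rule mult_right_mono)
      show "int (m choose i) \<le> int (Suc m choose i)" by (cases i) simp_all
      show "0 \<le> \<Delta> (n - Suc m) 0" by (rule pos) (use Suc.prems in auto)
    qed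
    finally show ?case using TS[of "Suc m"] Suc.prems by (simp add: right_diff_distrib)
  qed
  note bound = this
  have "T n \<le> 0"
  proof (cases n)
    case (Suc m)
    have "T n \<le> int (m choose i) * \<Delta> 0 0" using bound[of m] Suc by simp
    also have "\<dots> \<le> 0" using neg by (simp add: mult_nonneg_nonpos)
    finally show ?thesis .
  qed (simp add: T0)
  then show ?thesis by (simp add: T_def)
qed

text \<open>Multiplication by l identifies S/I in degree e with (I, l)/I in degree e + 1: surjective
  by construction, injective because l cancels in degrees at least d.\<close>

lemma hilb_addl:
  fixes I :: "'k::field mpol set"
  assumes I: "hideal n I" and l: "l \<in> forms n 1" and C: "colon_trivial n I l d" and e: "d \<le> e"
  shows "card (monomials n e) + hilb n I (Suc e) = hilb n (addl n I l) (Suc e) + hilb n I e"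
proof -
  define Rel where "Rel f g \<longleftrightarrow> (\<exists>a\<in>I \<inter> forms n (Suc e). g = l * f + a)" for f g
  have I': "hideal n (addl n I l)" by (rule hideal_addl[OF I l])
  have lp: "l \<in> polys n" using l by (simp add: forms_def)
  have "pv.dim (forms n e :: 'k mpol set) + pv.dim (I \<inter> forms n (Suc e)) =
      pv.dim (addl n I l \<inter> forms n (Suc e)) + pv.dim (I \<inter> forms n e)"
  proof (rule quot_dim_rel[where R = Rel and A = "forms n e" and A' = "addl n I l \<inter> forms n (Suc e)"
        and B = "I \<inter> forms n e" and B' = "I \<inter> forms n (Suc e)",
        OF vector_space_pscale vector_space_pscale subspace_hideal[OF I] subspace_hideal[OF I] subspace_forms
          subspace_hideal[OF I'] fin_dim_forms fin_dim_hideal])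
    show "I \<inter> forms n e \<subseteq> forms n e" by simp
    show "I \<inter> forms n (Suc e) \<subseteq> addl n I l \<inter> forms n (Suc e)" using addl_superset by blast
    show "Rel 0 0" unfolding Rel_def using hidealD(2)[OF I] by (intro bexI[of _ 0]) auto
    show "Rel (x + y) (x' + y')" if xy: "Rel x x'" "Rel y y'" for x y x' y'
    proof -
      obtain a b where "a \<in> I" "a \<in> forms n (Suc e)" "x' = l * x + a" "b \<in> I" "b \<in> forms n (Suc e)" "y' = l * y + b"
        using xy unfolding Rel_def by blast
      then show ?thesis unfolding Rel_def
        by (intro bexI[of _ "a + b"]) (simp_all add: algebra_simps hidealD(3)[OF I] forms_add)
    qed
    show "Rel (pscale k x) (pscale k x')" if xy: "Rel x x'" for k x x'
    proof -
      obtain a where "a \<in> I" "a \<in> forms n (Suc e)" "x' = l * x + a" using xy unfolding Rel_def by blast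
      then show ?thesis unfolding Rel_def
        by (intro bexI[of _ "pscale k a"])
          (simp_all add: pv.scale_right_distrib pscale_mult_left pscale_hideal[OF I] pscale_forms)
    qed
    show "\<exists>a'\<in>addl n I l \<inter> forms n (Suc e). Rel a a'" if a: "a \<in> forms n e" for a
    proof (intro bexI)
      show "Rel a (l * a)" unfolding Rel_def using hidealD(2)[OF I] by (intro bexI[of _ 0]) auto
      have "a \<in> polys n" using a by (simp add: forms_def)
      then show "l * a \<in> addl n I l \<inter> forms n (Suc e)" using addl_mult[OF I] forms_mult[OF l a] by simp
    qed
    show "\<exists>a\<in>forms n e. Rel a a'" if a': "a' \<in> addl n I l \<inter> forms n (Suc e)" for a'
    proof -
      have "a' \<in> sforms n 0 (Suc e)" "a' \<in> addl n I l" using a' by (simp_all add: sforms_eq)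
      from addl_sforms[OF I l this] obtain a u where
        "a \<in> I" "a \<in> sforms n 0 (Suc e)" "u \<in> sforms n (Suc 0) (Suc e)" "a' = a + l * u" by blast
      then show ?thesis unfolding Rel_def by (intro bexI[of _ u] bexI[of _ a]) (simp_all add: sforms_eq)
    qed
    show "a \<in> I \<inter> forms n e \<longleftrightarrow> a' \<in> I \<inter> forms n (Suc e)"
      if a: "a \<in> forms n e" "a' \<in> addl n I l \<inter> forms n (Suc e)" "Rel a a'" for a a'
    proof -
      obtain b where b: "b \<in> I" "a' = l * a + b" using a(3) unfolding Rel_def by blast
      have "l * a \<in> I \<longleftrightarrow> a' \<in> I"
      proof
        assume "l * a \<in> I"
        then show "a' \<in> I" unfolding b(2) using b(1) by (rule hidealD(3)[OF I])
      next
        assume "a' \<in> I"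
        then have "a' - b \<in> I" using b(1) by (rule hidealD(7)[OF I])
        then show "l * a \<in> I" using b(2) by simp
      qed
      moreover have "l * a \<in> I \<longleftrightarrow> a \<in> I"
        using C e a(1) hidealD(4)[OF I lp] unfolding colon_trivial_def by blast
      ultimately show ?thesis using a(1,2) by blast
    qed
  qed
  then show ?thesis by (simp add: hilb_def dim_forms)
qed

lemma hilb_le: "hilb n I e \<le> card (monomials n e)"
proof -
  have "pv.dim (I \<inter> forms n e) \<le> pv.dim (forms n e :: 'a mpol set)"
    by (rule pv.dim_mono_fin[OF fin_dim_forms]) simp
  then show ?thesis by (simp add: hilb_def dim_forms)
qed

lemma hilb_full: "forms n e \<subseteq> I \<Longrightarrow> hilb n I e = card (monomials n e)"
  by (simp add: hilb_def Int_absorb1 dim_forms)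

text \<open>A filter-regular sequence with the uniform degree bound d; the last condition says that
  n forms exhaust the quotient from degree d on.\<close>

definition regchain :: "nat \<Rightarrow> nat \<Rightarrow> (nat \<Rightarrow> 'k::field mpol) \<Rightarrow> (nat \<Rightarrow> 'k mpol set) \<Rightarrow> bool" where
  "regchain n d l J \<longleftrightarrow> hideal n (J 0) \<and> (\<forall>t<n. l t \<in> forms n 1 \<and> J (Suc t) = addl n (J t) (l t) \<and>
     colon_trivial n (J t) (l t) d) \<and> (\<forall>e\<ge>d. forms n e \<subseteq> J n)"

lemma regchain_hideal: "regchain n d l J \<Longrightarrow> t \<le> n \<Longrightarrow> hideal n (J t)"
proof (induction t)
  case (Suc t)
  then have "hideal n (addl n (J t) (l t))" by (intro hideal_addl) (auto simp: regchain_def)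
  then show ?case using Suc.prems by (simp add: regchain_def)
qed (simp add: regchain_def)

text \<open>Both Betti numbers are the same alternating sum of Hilbert functions, so their
  difference is the sum in \<open>iterated_difference_nonpos\<close>, whose recursion
  \<open>hilb_addl\<close> supplies.\<close>

lemma kdim_le_of_regchains:
  fixes J :: "nat \<Rightarrow> 'k::field mpol set" and J' :: "nat \<Rightarrow> 'k mpol set"
  assumes c: "regchain n d l J" and c': "regchain n d l' J'"
    and L: "linres n d (J 0)" and L': "linres n d (J' 0)"
    and pos: "\<And>t. 0 < t \<Longrightarrow> t \<le> n \<Longrightarrow> hilb n (J t) d \<le> hilb n (J' t) d"
    and neg: "hilb n (J' 0) d \<le> hilb n (J 0) d"
  shows "kdim n (J' 0) i (i + d) \<le> kdim n (J 0) i (i + d)"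
proof -
  define \<Delta> where "\<Delta> t e = int (hilb n (J' t) (d + e)) - int (hilb n (J t) (d + e))" for t e
  have "(\<Sum>j\<le>i. (-1) ^ (i + j) * int (n choose j) * \<Delta> 0 (i - j)) \<le> 0"
  proof (rule iterated_difference_nonpos)
    fix t e assume t: "t < n"
    have 1: "J (Suc t) = addl n (J t) (l t)" "J' (Suc t) = addl n (J' t) (l' t)"
      using c c' t by (simp_all add: regchain_def)
    have "card (monomials n (d + e)) + hilb n (J t) (Suc (d + e)) = hilb n (J (Suc t)) (Suc (d + e)) + hilb n (J t) (d + e)"
      unfolding 1 by (rule hilb_addl[of _ _ _ d]) (use c t regchain_hideal[OF c, of t] in \<open>auto simp: regchain_def\<close>)
    moreover have "card (monomials n (d + e)) + hilb n (J' t) (Suc (d + e)) = hilb n (J' (Suc t)) (Suc (d + e)) + hilb n (J' t) (d + e)"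
      unfolding 1 by (rule hilb_addl[of _ _ _ d]) (use c' t regchain_hideal[OF c', of t] in \<open>auto simp: regchain_def\<close>)
    ultimately show "\<Delta> (Suc t) (Suc e) = \<Delta> t (Suc e) - \<Delta> t e" by (simp add: \<Delta>_def)
  next
    fix e
    show "\<Delta> n e = 0" using c c' by (simp add: \<Delta>_def regchain_def hilb_full)
  next
    fix t assume "0 < t" "t \<le> n"
    then show "0 \<le> \<Delta> t 0" using pos by (simp add: \<Delta>_def)
  next
    show "\<Delta> 0 0 \<le> 0" using neg by (simp add: \<Delta>_def)
  qed
  moreover have "int (kdim n (J' 0) i (i + d)) - int (kdim n (J 0) i (i + d)) =
      (\<Sum>j\<le>i. (-1) ^ (i + j) * int (n choose j) * \<Delta> 0 (i - j))"
    unfolding linres_kdim[OF regchain_hideal[OF c le0] L] linres_kdim[OF regchain_hideal[OF c' le0] L']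
      sum_subtractf[symmetric]
    by (intro sum.cong refl) (simp add: \<Delta>_def right_diff_distrib)
  ultimately show ?thesis by simp
qed

section \<open>Generic linear forms\<close>

text \<open>A socle element f gives a cycle at the top of the Koszul complex of S/J. Nothing above
  index n could bound it, so regularity forces f into J.\<close>

lemma reg_socle:
  assumes J: "hideal n J" and Rg: "reg n J d" and f: "f \<in> forms n m" and m: "d \<le> m"
    and soc: "\<And>s. s < n \<Longrightarrow> var s * f \<in> J"
  shows "f \<in> J"
proof -
  define z where "z = (\<lambda>\<sigma>::nat set. if \<sigma> = {..<n} then f else 0)"
  have z: "z \<in> kch n n n (n + m)"
    by (rule kchI) (use f in \<open>auto simp: z_def sforms_eq split: if_splits\<close>)
  have kz: "kos n z \<tau> \<in> J" for \<tau>
    unfolding kos_def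
  proof (rule hideal_sum[OF J])
    fix j assume j: "j \<in> {..<n} - \<tau>"
    have "var j * z (insert j \<tau>) \<in> J" using j soc hidealD(2)[OF J] by (simp add: z_def)
    then show "ksgn j \<tau> * (var j * z (insert j \<tau>)) \<in> J" by (rule hidealD(4)[OF J ksgn_polys])
  qed
  obtain w where w: "w \<in> kch n (Suc n) (Suc n) (n + m)" "\<And>\<sigma>. z \<sigma> - kos n w \<sigma> \<in> J"
    by (rule regD[OF Rg z kz]) (use m in simp_all)
  have "w \<sigma> = 0" for \<sigma>
  proof (cases "\<sigma> \<subseteq> {..<n}")
    case True
    then have "card \<sigma> \<le> n" using card_mono[of "{..<n}" \<sigma>] by simp
    then show ?thesis by (intro kchD(4)[OF w(1)]) simp
  qed (rule kchD(3)[OF w(1)])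
  then have "w = (\<lambda>_. 0)" by (intro ext) simp
  then show ?thesis using w(2)[of "{..<n}"] by (simp add: z_def)
qed

section \<open>Saturations and pencils of linear forms\<close>

text \<open>The saturation I : l^\<infinity>, modulo which l is a nonzerodivisor.\<close>

definition sat :: "nat \<Rightarrow> 'k::field mpol set \<Rightarrow> 'k mpol \<Rightarrow> 'k mpol set" where
  "sat n I l = {f \<in> polys n. \<exists>s. l ^ s * f \<in> I}"

lemma polys_power: "l \<in> polys n \<Longrightarrow> l ^ s \<in> polys n"
  by (induction s) simp_all

lemma forms_power: "l \<in> forms n 1 \<Longrightarrow> l ^ s \<in> forms n s"
proof (induction s)
  case 0
  then show ?case by (simp add: forms_def homog_def)
next
  case (Suc s)
  then show ?case using forms_mult[of l n 1 "l ^ s" s] by simp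
qed

lemma forms_polys: "p \<in> forms n e \<Longrightarrow> p \<in> polys n"
  by (simp add: forms_def)

lemma sat_power_mono:
  assumes I: "hideal n I" and l: "l \<in> polys n" and f: "l ^ s * f \<in> I" and s: "s \<le> s'"
  shows "l ^ s' * f \<in> I"
proof -
  have "l ^ s' * f = l ^ (s' - s) * (l ^ s * f)"
    using s by (simp flip: mult.assoc power_add)
  then show ?thesis using hidealD(4)[OF I polys_power[OF l, of "s' - s"] f] by (simp only:)
qed

lemma hideal_sat:
  assumes I: "hideal n I" and l: "l \<in> forms n 1"
  shows "hideal n (sat n I l)"
  unfolding hideal_def
proof (intro conjI ballI allI)
  have lp: "l \<in> polys n" using l by (rule forms_polys)
  show "sat n I l \<subseteq> polys n" by (auto simp: sat_def)
  show "0 \<in> sat n I l" using hidealD(2)[OF I] by (simp add: sat_def)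
  fix p assume "p \<in> sat n I l"
  then obtain s where p: "p \<in> polys n" "l ^ s * p \<in> I" unfolding sat_def by blast
  show "p + q \<in> sat n I l" if q: "q \<in> sat n I l" for q
  proof -
    obtain s' where q: "q \<in> polys n" "l ^ s' * q \<in> I" using q unfolding sat_def by blast
    have "l ^ (s + s') * p \<in> I" "l ^ (s + s') * q \<in> I"
      using sat_power_mono[OF I lp p(2)] sat_power_mono[OF I lp q(2)] by simp_all
    then have "l ^ (s + s') * (p + q) \<in> I" using hidealD(3)[OF I] by (simp add: distrib_left)
    then show ?thesis unfolding sat_def using polys_add[OF p(1) q(1)] by blast
  qed
  show "r * p \<in> sat n I l" if r: "r \<in> polys n" for r
  proof -
    have eq: "l ^ s * (r * p) = r * (l ^ s * p)" by (rule mult.left_commute)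
    have "l ^ s * (r * p) \<in> I" unfolding eq by (rule hidealD(4)[OF I r p(2)])
    then show ?thesis unfolding sat_def using polys_mult[OF r p(1)] by blast
  qed
  show "hom_component e p \<in> sat n I l" for e
  proof -
    have "homog s (l ^ s)" using forms_power[OF l] by (simp add: forms_def)
    then have "hom_component (s + e) (l ^ s * p) = l ^ s * hom_component e p" by (simp add: hom_component_mult)
    then have "l ^ s * hom_component e p \<in> I" using hidealD(5)[OF I p(2), of "s + e"] by simp
    then show ?thesis unfolding sat_def using p(1) by auto
  qed
qed

lemma sat_superset: "hideal n I \<Longrightarrow> I \<subseteq> sat n I l"
  unfolding sat_def using hidealD(1) by (fastforce intro: exI[of _ 0])

lemma sat_cancel:
  assumes "f \<in> polys n" "l * f \<in> sat n I l" shows "f \<in> sat n I l"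
proof -
  obtain s where "l ^ s * (l * f) \<in> I" using assms(2) unfolding sat_def by blast
  then have "l ^ Suc s * f \<in> I" by (simp add: mult.assoc power_commutes mult.left_commute)
  then show ?thesis unfolding sat_def using assms(1) by blast
qed

text \<open>Scaling by a nonzero constant does not affect saturation, which allows a member of a
  pencil to be read from either end.\<close>

lemma sat_pscale:
  assumes I: "hideal n I" and t: "t \<noteq> 0" and f: "f \<in> sat n I (pscale t l)"
  shows "f \<in> sat n I l"
proof -
  obtain s where s: "f \<in> polys n" "(pscale t l) ^ s * f \<in> I" using f unfolding sat_def by blast
  have pw: "sg 0 c ^ s = sg (0::mon) (c ^ s)" for c :: 'a
    by (induction s) (simp_all add: mult_single)
  have "pscale (inverse t ^ s) ((pscale t l) ^ s * f) = sg 0 (inverse t ^ s * t ^ s) * (l ^ s * f)"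
    by (simp add: pscale_def power_mult_distrib pw mult_single flip: mult.assoc)
  also have "\<dots> = l ^ s * f" using t by (simp flip: power_mult_distrib)
  finally have "l ^ s * f \<in> I" using pscale_hideal[OF I s(2)] by metis
  then show ?thesis unfolding sat_def using s(1) by blast
qed

text \<open>
  The submodules \<open>0 :\<^bsub>S/U\<^esub> l + t l'\<close> for different \<open>t\<close> are independent if \<open>l'\<close> is a nonzerodivisor on \<open>S/U\<close>
  (a Vandermonde argument), so by noetherianity only finitely many of them are nonzero.
\<close>

lemma annihilators_independent:
  assumes U: "hideal n U" and canc: "\<And>f. f \<in> polys n \<Longrightarrow> l' * f \<in> U \<Longrightarrow> f \<in> U"
    and l: "l \<in> polys n" "l' \<in> polys n"
  shows "finite A \<Longrightarrow> (\<And>t. t \<in> A \<Longrightarrow> f t \<in> polys n \<and> (l + pscale t l') * f t \<in> U) \<Longrightarrow> sum f A \<in> U \<Longrightarrow>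
    t \<in> A \<Longrightarrow> f t \<in> U"
proof (induction A arbitrary: f t rule: finite_induct)
  case (insert a A)
  have fp: "f t \<in> polys n" and fU: "(l + pscale t l') * f t \<in> U" if "t \<in> insert a A" for t
    using insert.prems(1)[OF that] by auto
  have ps: "pscale c p \<in> polys n" if "p \<in> polys n" for c p using that by (simp add: pscale_def)
  have la: "l + pscale a l' \<in> polys n" using l ps[OF l(2), of a] by simp
  \<comment> \<open>Multiplying the sum by l + a l' removes f a and turns every other f t into (a -
    t) l' f t modulo U: the elimination step of the Vandermonde argument.\<close>
  define h where "h t = pscale (a - t) (l' * f t)" for t
  have h_eq: "h t = (l + pscale a l') * f t - (l + pscale t l') * f t" for t
    by (simp add: h_def pscale_def algebra_simps single_diff)
  have "(l + pscale a l') * sum f (insert a A) \<in> U" by (rule hidealD(4)[OF U la insert.prems(2)])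
  then have "(l + pscale a l') * f a + (\<Sum>t\<in>A. (l + pscale a l') * f t) \<in> U"
    using insert.hyps by (simp add: distrib_left sum_distrib_left)
  from hidealD(7)[OF U this fU[of a]] have 1: "(\<Sum>t\<in>A. (l + pscale a l') * f t) \<in> U" by simp
  have 2: "(\<Sum>t\<in>A. (l + pscale t l') * f t) \<in> U" by (rule hideal_sum[OF U]) (use fU in simp)
  have hs: "sum h A \<in> U" unfolding h_eq sum_subtractf by (rule hidealD(7)[OF U 1 2])
  have hN: "h t \<in> polys n \<and> (l + pscale t l') * h t \<in> U" if t: "t \<in> A" for t
  proof
    show "h t \<in> polys n" unfolding h_def using fp[of t] t l by (intro ps polys_mult) auto
    have eq: "(l + pscale t l') * h t = (sg 0 (a - t) * l') * ((l + pscale t l') * f t)"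
      unfolding h_def pscale_def[of "a - t"] by (simp only: ac_simps)
    have "sg 0 (a - t) * l' \<in> polys n" using l by simp
    then show "(l + pscale t l') * h t \<in> U" unfolding eq by (rule hidealD(4)[OF U _ fU]) (use t in simp)
  qed
  have hU: "h t \<in> U" if t: "t \<in> A" for t by (rule insert.IH[OF hN hs t])
  have fA: "f t \<in> U" if t: "t \<in> A" for t
  proof -
    have "a - t \<noteq> 0" using t insert.hyps by auto
    then have "l' * f t = pscale (inverse (a - t)) (h t)"
      by (simp add: h_def)
    then have "l' * f t \<in> U" using pscale_hideal[OF U hU[OF t]] by simp
    then show ?thesis using canc fp t by blast
  qed
  have "f a = sum f (insert a A) - sum f A" using insert.hyps by simp
  moreover have "sum f A \<in> U" by (rule hideal_sum[OF U fA])
  ultimately have "f a \<in> U" using hidealD(7)[OF U insert.prems(2)] by simp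
  then show ?case using insert.prems(3) fA by blast
qed simp

text \<open>Modulo U = I : l'^\<infinity> the form l' cancels. The sum of all annihilators N t is
  finitely generated, so its generators involve finitely many parameters T; for t outside T, N t
  lies in the sum over T and by independence inside U.\<close>

lemma pencil_avoids:
  fixes I :: "'k::field mpol set"
  assumes I: "hideal n I" and l: "l \<in> forms n 1" "l' \<in> forms n 1"
  shows "\<exists>T. finite T \<and> (\<forall>t. t \<notin> T \<longrightarrow> sat n I (l + pscale t l') \<subseteq> sat n I l')"
proof -
  define U where "U = sat n I l'"
  have U: "hideal n U" unfolding U_def by (rule hideal_sat[OF I l(2)])
  have canc: "f \<in> U" if "f \<in> polys n" "l' * f \<in> U" for f
    using sat_cancel[of f n l' I] that unfolding U_def by blast
  have lp: "l \<in> polys n" "l' \<in> polys n" using l by (auto simp: forms_def)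
  have lt: "l + pscale t l' \<in> forms n 1" for t by (intro forms_add l pscale_forms)
  define N where "N t = {f \<in> polys n. (l + pscale t l') * f \<in> U}" for t
  have N: "hideal n (N t)" for t
    unfolding hideal_def
  proof (intro conjI ballI allI)
    show "N t \<subseteq> polys n" "0 \<in> N t" using hidealD(2)[OF U] by (auto simp: N_def)
    fix p assume p: "p \<in> N t"
    show "p + q \<in> N t" if "q \<in> N t" for q
      using p that hidealD(3)[OF U] by (simp add: N_def distrib_left)
    show "r * p \<in> N t" if r: "r \<in> polys n" for r
    proof -
      have "(l + pscale t l') * (r * p) = r * ((l + pscale t l') * p)" by (rule mult.left_commute)
      moreover have "r * ((l + pscale t l') * p) \<in> U" using p by (intro hidealD(4)[OF U r]) (simp add: N_def)
      ultimately have "(l + pscale t l') * (r * p) \<in> U" by (simp only:)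
      then show ?thesis using p r by (simp add: N_def)
    qed
    show "hom_component e p \<in> N t" for e
    proof -
      have "homog 1 (l + pscale t l')" using lt by (simp add: forms_def)
      then have "hom_component (Suc e) ((l + pscale t l') * p) = (l + pscale t l') * hom_component e p"
        by (simp add: hom_component_mult)
      then show ?thesis using p hidealD(5)[OF U, of "(l + pscale t l') * p" "Suc e"] by (simp add: N_def)
    qed
  qed
  define J where "J = {p. \<exists>A f. finite A \<and> (\<forall>t. f t \<in> N t) \<and> p = sum f A}"
  have J: "hideal n J"
    unfolding hideal_def
  proof (intro conjI ballI allI)
    show "J \<subseteq> polys n"
    proof
      fix p assume "p \<in> J"
      then obtain A f where "\<forall>t. f t \<in> N t" "p = sum f A" unfolding J_def by blast
      then show "p \<in> polys n" by (auto simp: N_def)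
    qed
    show "0 \<in> J" unfolding J_def using hidealD(2)[OF N] by (auto intro!: exI[of _ "{}"] exI[of _ "\<lambda>_. 0"])
    fix p assume "p \<in> J"
    then obtain A f where p: "finite A" "\<And>t. f t \<in> N t" "p = sum f A" unfolding J_def by blast
    show "p + q \<in> J" if q: "q \<in> J" for q
    proof -
      obtain B g where q: "finite B" "\<And>t. g t \<in> N t" "q = sum g B" using q unfolding J_def by blast
      define h where "h t = (if t \<in> A then f t else 0) + (if t \<in> B then g t else 0)" for t
      have "sum f A = (\<Sum>t\<in>A \<union> B. if t \<in> A then f t else 0)" "sum g B = (\<Sum>t\<in>A \<union> B. if t \<in> B then g t else 0)"
        using p(1) q(1) by (simp_all add: sum.If_cases Int_absorb1 Int_Un_distrib2 Int_commute Un_Int_distrib)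
      then have "p + q = sum h (A \<union> B)" by (simp add: h_def p(3) q(3) sum.distrib)
      moreover have "h t \<in> N t" for t
        unfolding h_def by (rule hidealD(3)[OF N]) (use p(2) q(2) hidealD(2)[OF N] in auto)
      moreover have "finite (A \<union> B)" using p(1) q(1) by simp
      ultimately show ?thesis unfolding J_def by blast
    qed
    show "r * p \<in> J" if r: "r \<in> polys n" for r
    proof -
      have "r * p = (\<Sum>t\<in>A. r * f t)" by (simp add: p(3) sum_distrib_left)
      moreover have "r * f t \<in> N t" for t by (rule hidealD(4)[OF N r p(2)])
      ultimately show ?thesis unfolding J_def using p(1) by (intro CollectI exI[of _ A] exI[of _ "\<lambda>t. r * f t"]) simp
    qed
    show "hom_component e p \<in> J" for e
    proof -
      have "hom_component e p = (\<Sum>t\<in>A. hom_component e (f t))" by (simp add: p(3) hom_component_sum)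
      moreover have "hom_component e (f t) \<in> N t" for t by (rule hidealD(5)[OF N p(2)])
      ultimately show ?thesis unfolding J_def using p(1)
        by (intro CollectI exI[of _ A] exI[of _ "\<lambda>t. hom_component e (f t)"]) simp
    qed
  qed
  from ideal_finitely_generated[OF J] obtain G where G: "finite G" "G \<subseteq> J"
    "\<forall>p\<in>J. \<exists>f. (\<forall>g. f g \<in> polys n) \<and> p = (\<Sum>g\<in>G. f g * g)" by (elim exE conjE)
  have "\<forall>g\<in>G. \<exists>Af. finite (fst Af) \<and> (\<forall>t. snd Af t \<in> N t) \<and> g = sum (snd Af) (fst Af)"
    using G(2) unfolding J_def by force
  from bchoice[OF this] obtain Af where
    Af: "\<forall>g\<in>G. finite (fst (Af g)) \<and> (\<forall>t. snd (Af g) t \<in> N t) \<and> g = sum (snd (Af g)) (fst (Af g))" by (rule exE)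
  define T where "T = (\<Union>g\<in>G. fst (Af g))"
  have finT: "finite T" unfolding T_def using G(1) Af by blast
  define F where "F g t = (if t \<in> fst (Af g) then snd (Af g) t else 0)" for g t
  have FN: "F g t \<in> N t" if "g \<in> G" for g t using Af that hidealD(2)[OF N] by (simp add: F_def)
  have Fsum: "g = (\<Sum>t\<in>T. F g t)" if g: "g \<in> G" for g
  proof -
    have "fst (Af g) \<subseteq> T" unfolding T_def using g by blast
    then have "(\<Sum>t\<in>T. F g t) = (\<Sum>t\<in>fst (Af g). F g t)"
      using finT by (intro sum.mono_neutral_right) (auto simp: F_def)
    also have "\<dots> = sum (snd (Af g)) (fst (Af g))" by (simp add: F_def)
    finally show ?thesis using Af g by simp
  qed
  have NU: "f \<in> U" if f: "f \<in> N t" and t: "t \<notin> T" for f t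
  proof -
    have "f \<in> J" unfolding J_def using f hidealD(2)[OF N]
      by (auto intro!: exI[of _ "{t}"] exI[of _ "\<lambda>t'. if t' = t then f else 0"])
    then obtain c where c: "\<forall>g. c g \<in> polys n" "f = (\<Sum>g\<in>G. c g * g)" using G(3) by blast
    define h where "h t = (\<Sum>g\<in>G. c g * F g t)" for t
    have hN: "h t \<in> N t" for t
      unfolding h_def by (rule hideal_sum[OF N hidealD(4)[OF N]]) (use c(1) FN in auto)
    have "f = (\<Sum>g\<in>G. \<Sum>t\<in>T. c g * F g t)"
      unfolding c(2) by (intro sum.cong refl) (simp add: Fsum flip: sum_distrib_left)
    also have "\<dots> = sum h T" unfolding h_def by (rule sum.swap)
    finally have fh: "f = sum h T" .
    \<comment> \<open>The relation f = sum h T as a vanishing sum with component f at the new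
      parameter t.\<close>
    define k where "k t' = (if t' = t then f else - h t')" for t'
    have "sum k (insert t T) = f + sum k T" using finT t by (simp add: k_def)
    also have "sum k T = (\<Sum>t'\<in>T. - h t')" using t by (intro sum.cong) (auto simp: k_def)
    finally have "sum k (insert t T) = 0" using fh by (simp add: sum_negf)
    then have ks: "sum k (insert t T) \<in> U" using hidealD(2)[OF U] by simp
    have "k t' \<in> N t'" for t' using f hidealD(6)[OF N hN] by (simp add: k_def)
    then have kN: "k t' \<in> polys n \<and> (l + pscale t' l') * k t' \<in> U" for t' unfolding N_def by blast
    have "k t \<in> U"
      by (rule annihilators_independent[OF U canc lp _ kN ks]) (use finT in simp_all)
    then show ?thesis by (simp add: k_def)
  qed
  have "sat n I (l + pscale t l') \<subseteq> sat n I l'" if t: "t \<notin> T" for t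
  proof
    fix f assume "f \<in> sat n I (l + pscale t l')"
    then obtain s where f: "f \<in> polys n" "(l + pscale t l') ^ s * f \<in> I" unfolding sat_def by blast
    have lp': "l + pscale t l' \<in> polys n" using lt by (rule forms_polys)
    have "(l + pscale t l') ^ s * f \<in> U \<Longrightarrow> f \<in> U" for s
    proof (induction s)
      case (Suc s)
      have "(l + pscale t l') ^ s * f \<in> N t"
        unfolding N_def using Suc.prems f(1) polys_power[OF lp', of s] by (simp add: mult.assoc)
      then show ?case using Suc.IH NU[OF _ t] by blast
    qed simp
    moreover have "(l + pscale t l') ^ s * f \<in> U" using f(2) sat_superset[OF I] unfolding U_def by blast
    ultimately show "f \<in> sat n I l'" unfolding U_def by blast
  qed
  then show ?thesis using finT by blast
qed

text \<open>The forms are added one at a time. Each pencil has finitely many bad parameters for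
  either of its two ends, and an infinite field has one outside.\<close>

lemma generic_form:
  fixes I :: "'k::field mpol set" and m :: nat
  assumes K: "infinite (UNIV :: 'k set)" and I: "hideal n I" and l: "l \<in> forms n 1"
    and y: "\<And>j. j < m \<Longrightarrow> y j \<in> forms n 1"
  shows "\<exists>c. \<forall>f\<in>sat n I (l + (\<Sum>j<m. pscale (c j) (y j))). f \<in> sat n I l \<and> (\<forall>j<m. f \<in> sat n I (y j))"
  using y
proof (induction m)
  case (Suc m)
  then obtain c where c: "\<forall>f\<in>sat n I (l + (\<Sum>j<m. pscale (c j) (y j))). f \<in> sat n I l \<and> (\<forall>j<m. f \<in> sat n I (y j))"
    by (metis less_SucI)
  define L where "L = l + (\<Sum>j<m. pscale (c j) (y j))"
  have L: "L \<in> forms n 1" unfolding L_def by (intro forms_add l forms_sum pscale_forms Suc.prems) simp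
  have ym: "y m \<in> forms n 1" by (rule Suc.prems) simp
  obtain T1 where T1: "finite T1" "\<forall>t. t \<notin> T1 \<longrightarrow> sat n I (L + pscale t (y m)) \<subseteq> sat n I (y m)"
    using pencil_avoids[OF I L ym] by blast
  \<comment> \<open>The same pencil from its other end: L + t y and y + L / t differ by a scalar, so
    this bad set enters through inverses.\<close>
  obtain T2 where T2: "finite T2" "\<forall>t. t \<notin> T2 \<longrightarrow> sat n I (y m + pscale t L) \<subseteq> sat n I L"
    using pencil_avoids[OF I ym L] by blast
  have finT: "finite (T1 \<union> inverse ` T2 \<union> {0})" using T1(1) T2(1) by simp
  from ex_new_if_finite[OF K finT] obtain t where t: "t \<notin> T1 \<union> inverse ` T2 \<union> {0}" by (rule exE)
  then have t0: "t \<noteq> 0" "t \<notin> T1" by blast+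
  have t2: "inverse t \<notin> T2"
  proof
    assume "inverse t \<in> T2"
    then have "inverse (inverse t) \<in> inverse ` T2" by (rule imageI)
    then show False using t by (simp only: inverse_inverse_eq) blast
  qed
  have eq: "L + pscale t (y m) = pscale t (y m + pscale (inverse t) L)"
    using t0(1) by (simp add: pv.scale_right_distrib add.commute)
  define c' where "c' = c(m := t)"
  have sum_eq: "l + (\<Sum>j<Suc m. pscale (c' j) (y j)) = L + pscale t (y m)"
  proof -
    have "(\<Sum>j<m. pscale (c' j) (y j)) = (\<Sum>j<m. pscale (c j) (y j))" by (intro sum.cong) (auto simp: c'_def)
    then show ?thesis by (simp add: L_def c'_def add.assoc)
  qed
  have "f \<in> sat n I l \<and> (\<forall>j<Suc m. f \<in> sat n I (y j))" if f: "f \<in> sat n I (L + pscale t (y m))" for f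
  proof -
    have 1: "f \<in> sat n I (y m)" using f T1(2) t0(2) by blast
    have "f \<in> sat n I (y m + pscale (inverse t) L)" using sat_pscale[OF I t0(1)] f eq by simp
    then have "f \<in> sat n I L" using T2(2) t2 by blast
    then show ?thesis using c 1 unfolding L_def by (metis less_Suc_eq)
  qed
  then show ?case by (intro exI[of _ c']) (simp only: sum_eq, blast)
qed simp

section \<open>Linear forms and elimination of variables\<close>

lemma mdeg_1: "mdeg a = 1 \<Longrightarrow> \<exists>j. a = sg j 1"
proof -
  assume a: "mdeg a = 1"
  then have "a \<noteq> 0" by auto
  then have "ks a \<noteq> {}" by simp
  then obtain j where "j \<in> ks a" by blast
  then obtain b where b: "a = sg j 1 + b" using single_le_mon by blast
  then have "mdeg b = 0" using a by (simp only: mdeg_add mdeg_single)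
  then have "b = 0" by simp
  then show ?thesis using b by auto
qed

lemma linear_form_expansion:
  assumes m: "m \<in> forms r 1"
  shows "m = (\<Sum>j<r. pscale (lk m (sg j 1)) (var j))"
proof (rule poly_mapping_eqI)
  fix a
  have s: "lk (\<Sum>j<r. pscale (lk m (sg j 1)) (var j)) a = (\<Sum>j<r. if sg j 1 = a then lk m a else 0)"
    unfolding lookup_sum by (intro sum.cong refl) (auto simp: var_def lookup_single when_def)
  show "lk m a = lk (\<Sum>j<r. pscale (lk m (sg j 1)) (var j)) a"
  proof (cases "a \<in> ks m")
    case True
    then have "mdeg a = 1" "ks a \<subseteq> {..<r}" using m by (auto simp: forms_def homog_def polys_def)
    then obtain i where i: "a = sg i 1" "i < r" using mdeg_1[of a] by auto
    have "(sg j (1::nat) = a) = (j = i)" for j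
      unfolding i(1) by (auto dest: arg_cong[of _ _ ks])
    then show ?thesis unfolding s using i(2) by simp
  next
    case False
    then show ?thesis unfolding s by (auto simp: in_keys_iff intro!: sum.neutral)
  qed
qed

text \<open>Records the triangular shape of the forms cut by so far: modulo J only the first r
  variables remain.\<close>

definition elim_vars :: "nat \<Rightarrow> nat \<Rightarrow> 'k::field mpol set \<Rightarrow> bool" where
  "elim_vars n r J \<longleftrightarrow> (\<forall>s<n. \<exists>m\<in>forms r 1. var s - m \<in> J)"

lemma forms_mono: "r \<le> n \<Longrightarrow> forms r e \<subseteq> forms n e"
  unfolding forms_def polys_def by fastforce

text \<open>Induction on the sum of the exponents: each x_j f with j \<le> r satisfies the
  hypothesis with one exponent lowered, so lies in J. All other variables are combinations of these
  modulo J, so f is a socle element and \<open>reg_socle\<close> applies.\<close>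

lemma powers_in_imp_in:
  assumes J: "hideal n J" and Rg: "reg n J d" and el: "elim_vars n (Suc r) J" and r: "r < n"
  shows "f \<in> forms n m \<Longrightarrow> d \<le> m \<Longrightarrow> (\<And>j. j \<le> r \<Longrightarrow> var j ^ s j * f \<in> J) \<Longrightarrow> (\<Sum>j\<le>r. s j) = N \<Longrightarrow> f \<in> J"
proof (induction N arbitrary: f m s rule: less_induct)
  case (less N)
  have v: "var j * f \<in> J" if j: "j \<le> r" for j
  proof (cases "s j")
    case 0
    then have "f \<in> J" using less.prems(3)[OF j] by simp
    then show ?thesis using j r by (intro hidealD(4)[OF J]) simp_all
  next
    case (Suc k)
    define s' where "s' = s(j := k)"
    have "(\<Sum>i\<le>r. s' i) < N"
      unfolding less.prems(4)[symmetric]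
      by (rule sum_strict_mono_ex1) (use j Suc in \<open>auto simp: s'_def\<close>)
    then show ?thesis
    proof (rule less.IH)
      show "var j * f \<in> forms n (Suc m)" using forms_mult[of "var j" n 1 f m] less.prems(1) j r by simp
      show "d \<le> Suc m" using less.prems(2) by simp
      show "var i ^ s' i * (var j * f) \<in> J" if i: "i \<le> r" for i
      proof (cases "i = j")
        case True
        have eq: "var j ^ s j * f = var j ^ s' j * (var j * f)" by (simp add: s'_def Suc mult.left_commute mult.assoc)
        show ?thesis unfolding True eq[symmetric] by (rule less.prems(3)[OF j])
      next
        case False
        have eq: "var i ^ s' i * (var j * f) = var j * (var i ^ s i * f)"
          using False by (simp add: s'_def mult.left_commute)
        show ?thesis unfolding eq by (rule hidealD(4)[OF J _ less.prems(3)[OF i]]) (use j r in simp)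
      qed
    qed simp
  qed
  have fp: "f \<in> polys n" using less.prems(1) by (rule forms_polys)
  show ?case
  proof (rule reg_socle[OF J Rg less.prems(1,2)])
    fix t assume "t < n"
    then obtain m where m: "m \<in> forms (Suc r) 1" "var t - m \<in> J" using el unfolding elim_vars_def by blast
    have "m * f = (\<Sum>j<Suc r. pscale (lk m (sg j 1)) (var j * f))"
      by (subst linear_form_expansion[OF m(1)]) (simp only: sum_distrib_right pscale_def mult.assoc)
    also have "\<dots> \<in> J" by (rule hideal_sum[OF J pscale_hideal[OF J]]) (use v in simp)
    finally have 1: "m * f \<in> J" .
    have 2: "f * (var t - m) \<in> J" by (rule hidealD(4)[OF J fp m(2)])
    have "var t * f = f * (var t - m) + m * f" by (simp add: algebra_simps)
    then show "var t * f \<in> J" using hidealD(3)[OF J 2 1] by simp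
  qed
qed

text \<open>The form is x_r plus a generic combination of lower variables. Whatever it kills modulo
  J lies in the saturation by every x_j with j \<le> r, hence in J from degree d on; its coefficient
  1 at x_r lets it eliminate x_r.\<close>

lemma regular_form_exists:
  fixes J :: "'k::field mpol set"
  assumes K: "infinite (UNIV :: 'k set)" and J: "hideal n J" and Rg: "reg n J d"
    and el: "elim_vars n (Suc r) J" and r: "r < n"
  shows "\<exists>l\<in>forms n 1. colon_trivial n J l d \<and> elim_vars n r (addl n J l)"
proof -
  have v: "var r \<in> forms n 1" "j < r \<Longrightarrow> var j \<in> forms n 1" for j using r by simp_all
  obtain c where c: "\<forall>f\<in>sat n J (var r + (\<Sum>j<r. pscale (c j) (var j))).
      f \<in> sat n J (var r) \<and> (\<forall>j<r. f \<in> sat n J (var j))"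
    using generic_form[OF K J v(1), of r var] v(2) by blast
  define m0 where "m0 = (\<Sum>j<r. pscale (c j) (var j))"
  define l where "l = var r + m0"
  have m0: "m0 \<in> forms r 1" unfolding m0_def by (intro forms_sum pscale_forms) simp
  have l: "l \<in> forms n 1"
    unfolding l_def using v(1) m0 forms_mono[of r n 1] r by (intro forms_add) auto
  have "colon_trivial n J l d"
    unfolding colon_trivial_def
  proof (intro allI impI ballI)
    fix m f assume m: "d \<le> m" and f: "f \<in> forms n m" "l * f \<in> J"
    have "l ^ 1 * f \<in> J" using f(2) by simp
    then have "f \<in> sat n J l" unfolding sat_def using forms_polys[OF f(1)] by blast
    then have "f \<in> sat n J (var r) \<and> (\<forall>j<r. f \<in> sat n J (var j))" using c unfolding l_def m0_def by blast
    then have "f \<in> sat n J (var j)" if "j \<le> r" for j using that by (cases "j = r") auto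
    then have "\<forall>j. \<exists>s. j \<le> r \<longrightarrow> var j ^ s * f \<in> J" unfolding sat_def by blast
    from choice[OF this] obtain s where s: "\<forall>j. j \<le> r \<longrightarrow> var j ^ s j * f \<in> J" by (rule exE)
    show "f \<in> J" by (rule powers_in_imp_in[OF J Rg el r f(1) m _ refl]) (use s in blast)
  qed
  moreover have "elim_vars n r (addl n J l)"
    unfolding elim_vars_def
  proof (intro allI impI)
    fix s assume "s < n"
    then obtain m where m: "m \<in> forms (Suc r) 1" "var s - m \<in> J" using el unfolding elim_vars_def by blast
    define k where "k = lk m (sg r 1)"
    define m1 where "m1 = (\<Sum>j<r. pscale (lk m (sg j 1)) (var j))"
    have mm: "m = m1 + pscale k (var r)"
      using linear_form_expansion[OF m(1)] by (simp add: m1_def k_def)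
    have "m1 - pscale k m0 \<in> forms r 1"
      unfolding m1_def by (intro forms_diff forms_sum pscale_forms m0) simp
    moreover have "var s - (m1 - pscale k m0) = (var s - m) + l * sg 0 k"
      by (simp add: mm l_def pscale_def algebra_simps)
    moreover have "(var s - m) + l * sg 0 k \<in> addl n J l"
      unfolding addl_def using m(2) forms_polys[OF forms_const[of k n]] by blast
    ultimately show "\<exists>m\<in>forms r 1. var s - m \<in> addl n J l" by metis
  qed
  ultimately show ?thesis using l by blast
qed

lemma elim_vars_forms:
  assumes J: "hideal n J" and el: "elim_vars n r J" and r: "r \<le> n"
  shows "p \<in> forms n e \<Longrightarrow> \<exists>q\<in>forms r e. p - q \<in> J"
proof (induction e arbitrary: p)
  case 0
  have "p \<in> forms r 0" using forms_0_const[OF 0] forms_const[of "lk p 0" r] by simp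
  then show ?case using hidealD(2)[OF J] by (intro bexI[of _ p]) simp_all
next
  case (Suc e)
  have "\<exists>q. q \<in> forms r (Suc e) \<and> sg a (lk p a) - q \<in> J" if a: "a \<in> ks p" for a
  proof -
    have am: "mdeg a = Suc e" "ks a \<subseteq> {..<n}" using Suc.prems a by (auto simp: forms_def homog_def polys_def)
    then have "a \<noteq> 0" by auto
    then have "ks a \<noteq> {}" by simp
    then obtain s where s: "s \<in> ks a" by blast
    then obtain b where b: "a = sg s 1 + b" using single_le_mon by blast
    have sn: "s < n" using s am by auto
    have bf: "sg b (lk p a) \<in> forms n e"
      using am b by (simp add: forms_def homog_single)
    obtain q where q: "q \<in> forms r e" "sg b (lk p a) - q \<in> J" using Suc.IH[OF bf] by blast
    obtain m where m: "m \<in> forms r 1" "var s - m \<in> J" using el sn unfolding elim_vars_def by blast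
    have mp: "m \<in> polys n" using m(1) forms_mono[OF r] forms_polys by blast
    have "sg a (lk p a) - m * q = sg b (lk p a) * (var s - m) + m * (sg b (lk p a) - q)"
      by (simp add: b var_def algebra_simps mult_single)
    moreover have "sg b (lk p a) * (var s - m) \<in> J" by (rule hidealD(4)[OF J forms_polys[OF bf] m(2)])
    moreover have "m * (sg b (lk p a) - q) \<in> J" by (rule hidealD(4)[OF J mp q(2)])
    ultimately have "sg a (lk p a) - m * q \<in> J" using hidealD(3)[OF J] by simp
    moreover have "m * q \<in> forms r (Suc e)" using forms_mult[OF m(1) q(1)] by simp
    ultimately show ?thesis by blast
  qed
  then have "\<forall>a\<in>ks p. \<exists>q. q \<in> forms r (Suc e) \<and> sg a (lk p a) - q \<in> J" by blast
  from bchoice[OF this] obtain q where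
    q: "\<forall>a\<in>ks p. q a \<in> forms r (Suc e) \<and> sg a (lk p a) - q a \<in> J" by (rule exE)
  have "(\<Sum>a\<in>ks p. sg a (lk p a) - q a) \<in> J" by (rule hideal_sum[OF J]) (use q in blast)
  then have "p - sum q (ks p) \<in> J" by (simp add: sum_subtractf flip: poly_sum)
  moreover have "sum q (ks p) \<in> forms r (Suc e)" by (rule forms_sum) (use q in blast)
  ultimately show ?case by blast
qed

lemma card_monomials_Suc:
  "card (monomials (Suc r) (Suc e)) = card (monomials r (Suc e)) + card (monomials (Suc r) e)"
proof -
  have "monomials (Suc r) (Suc e) = monomials r (Suc e) \<union> (\<lambda>b. sg r 1 + b) ` monomials (Suc r) e"
  proof
    show "monomials (Suc r) (Suc e) \<subseteq> monomials r (Suc e) \<union> (\<lambda>b. sg r 1 + b) ` monomials (Suc r) e"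
    proof
      fix a assume a: "a \<in> monomials (Suc r) (Suc e)"
      show "a \<in> monomials r (Suc e) \<union> (\<lambda>b. sg r 1 + b) ` monomials (Suc r) e"
      proof (cases "r \<in> ks a")
        case True
        then obtain b where "a = sg r 1 + b" using single_le_mon by blast
        then show ?thesis using a by (auto simp: monomials_def)
      next
        case False
        then have "ks a \<subseteq> {..<r}" using a by (force simp: monomials_def less_Suc_eq)
        then show ?thesis using a by (simp add: monomials_def)
      qed
    qed
    show "monomials r (Suc e) \<union> (\<lambda>b. sg r 1 + b) ` monomials (Suc r) e \<subseteq> monomials (Suc r) (Suc e)"
      by (fastforce simp: monomials_def)
  qed
  moreover have "monomials r (Suc e) \<inter> (\<lambda>b. sg r 1 + b) ` monomials (Suc r) e = {}"
    by (auto simp: monomials_def)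
  moreover have "card ((\<lambda>b. sg r 1 + b) ` monomials (Suc r) e) = card (monomials (Suc r) e)"
    by (rule card_image) (simp add: inj_on_def)
  ultimately show ?thesis by (simp add: card_Un_disjoint finite_monomials)
qed

text \<open>Modulo J a multiple of l depends on the class of its cofactor, which has a
  representative in r variables; so l adds at most one dimension per monomial of degree e in
  these.\<close>

lemma hilb_addl_le:
  fixes J :: "'k::field mpol set"
  assumes J: "hideal n J" and l: "l \<in> forms n 1" and el: "elim_vars n r J" and r: "r \<le> n"
  shows "hilb n (addl n J l) (Suc e) \<le> hilb n J (Suc e) + card (monomials r e)"
proof -
  obtain B where B: "B \<subseteq> J \<inter> forms n (Suc e)" "pv.span B = J \<inter> forms n (Suc e)"
      "card B = pv.dim (J \<inter> forms n (Suc e))" "finite B"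
    using pv.fin_dim_basis[OF fin_dim_hideal subspace_hideal[OF J]] by metis
  define W where "W = B \<union> (\<lambda>b. l * sg b 1) ` monomials r e"
  have finW: "finite W" unfolding W_def using B(4) finite_monomials by simp
  have "addl n J l \<inter> forms n (Suc e) \<subseteq> pv.span W"
  proof
    fix p assume p: "p \<in> addl n J l \<inter> forms n (Suc e)"
    have "p \<in> sforms n 0 (Suc e)" "p \<in> addl n J l" using p by (simp_all add: sforms_eq)
    from addl_sforms[OF J l this] obtain a u where
      au: "a \<in> J" "a \<in> sforms n 0 (Suc e)" "u \<in> sforms n (Suc 0) (Suc e)" "p = a + l * u" by blast
    have uf: "u \<in> forms n e" using au(3) by (simp add: sforms_eq)
    obtain q where q: "q \<in> forms r e" "u - q \<in> J" using elim_vars_forms[OF J el r uf] by blast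
    have qn: "q \<in> forms n e" using q(1) forms_mono[OF r] by blast
    have "l * (u - q) \<in> J" by (rule hidealD(4)[OF J forms_polys[OF l] q(2)])
    moreover have "l * (u - q) \<in> forms n (Suc e)" using forms_mult[OF l forms_diff[OF uf qn]] by simp
    moreover have "a \<in> forms n (Suc e)" using au(2) by (simp add: sforms_eq)
    ultimately have "a + l * (u - q) \<in> J \<inter> forms n (Suc e)" using au(1) hidealD(3)[OF J] forms_add by blast
    then have 1: "a + l * (u - q) \<in> pv.span W" unfolding B(2)[symmetric] W_def using pv.span_mono[of B] by blast
    have "l * q = (\<Sum>b\<in>ks q. pscale (lk q b) (l * sg b 1))"
    proof -
      have "l * q = (\<Sum>b\<in>ks q. l * sg b (lk q b))" by (subst poly_sum[of q]) (rule sum_distrib_left)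
      also have "\<dots> = (\<Sum>b\<in>ks q. pscale (lk q b) (l * sg b 1))"
        by (intro sum.cong refl) (simp add: pscale_mult_left, simp add: pscale_def mult_single)
      finally show ?thesis .
    qed
    also have "\<dots> \<in> pv.span W"
    proof (intro pv.span_sum pv.span_scale pv.span_base)
      fix b assume "b \<in> ks q"
      then have "b \<in> monomials r e" using q(1) by (auto simp: forms_eq)
      then show "l * sg b 1 \<in> W" unfolding W_def by blast
    qed
    finally have 2: "l * q \<in> pv.span W" .
    have "p = (a + l * (u - q)) + l * q" by (simp add: au(4) algebra_simps)
    then show "p \<in> pv.span W" using pv.span_add[OF 1 2] by simp
  qed
  then have "hilb n (addl n J l) (Suc e) \<le> card W" unfolding hilb_def using finW by (rule pv.dim_le_card)
  also have "\<dots> \<le> card B + card ((\<lambda>b. l * sg b 1) ` monomials r e)" unfolding W_def by (rule card_Un_le)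
  also have "\<dots> \<le> card B + card (monomials r e)" using card_image_le[OF finite_monomials] by simp
  finally show ?thesis by (simp add: B(3) hilb_def)
qed

text \<open>Each cut leaves one variable fewer, so the increments bounded by
  \<open>hilb_addl_le\<close> telescope: over t cuts they add up to the number of monomials of
  degree d involving one of the last t variables.\<close>

lemma generic_regchain:
  fixes I :: "'k::field mpol set"
  assumes K: "infinite (UNIV :: 'k set)" and I: "hideal n I" and Rg: "reg n I d"
    and d: "0 < d \<or> forms n 0 \<subseteq> I"
  shows "\<exists>l J. J 0 = I \<and> regchain n d l J \<and>
    (0 < d \<longrightarrow> (\<forall>t\<le>n. hilb n (J t) d + card (monomials (n - t) d) \<le> hilb n I d + card (monomials n d)))"
proof -
  \<comment> \<open>The choice runs over all naturals, so states beyond t = n are left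
    unconstrained.\<close>
  define P where "P t J \<longleftrightarrow> (t = 0 \<longrightarrow> J = I) \<and> (t \<le> n \<longrightarrow> hideal n J \<and> reg n J d \<and> elim_vars n (n - t) J)"
    for t and J :: "'k mpol set"
  define Q where "Q t J J' \<longleftrightarrow> (t < n \<longrightarrow> (\<exists>l\<in>forms n 1. colon_trivial n J l d \<and> J' = addl n J l))"
    for t and J J' :: "'k mpol set"
  have "\<exists>J. \<forall>t. P t (J t) \<and> Q t (J t) (J (Suc t))"
  proof (rule dependent_nat_choice)
    have "elim_vars n n I" unfolding elim_vars_def
    proof (intro allI impI)
      fix s assume "s < n"
      then show "\<exists>m\<in>forms n 1. var s - m \<in> I" using hidealD(2)[OF I] by (intro bexI[of _ "var s"]) simp_all
    qed
    then show "\<exists>J. P 0 J" unfolding P_def using I Rg by auto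
    fix J t assume PJ: "P t J"
    show "\<exists>J'. P (Suc t) J' \<and> Q t J J'"
    proof (cases "t < n")
      case True
      have J: "hideal n J" "reg n J d" "elim_vars n (Suc (n - Suc t)) J" using PJ True by (simp_all add: P_def Suc_diff_Suc)
      obtain l where l: "l \<in> forms n 1" "colon_trivial n J l d" "elim_vars n (n - Suc t) (addl n J l)"
        using regular_form_exists[OF K J] True by auto
      have "P (Suc t) (addl n J l)" unfolding P_def
        using hideal_addl[OF J(1) l(1)] reg_addl[OF J(1) l(1) J(2) l(2)] l(3) by simp
      then show ?thesis unfolding Q_def using l by blast
    qed (auto simp: P_def Q_def)
  qed
  then obtain J where J: "\<And>t. P t (J t)" "\<And>t. Q t (J t) (J (Suc t))" by blast
  have "\<forall>t. \<exists>l. t < n \<longrightarrow> l \<in> forms n 1 \<and> colon_trivial n (J t) l d \<and> J (Suc t) = addl n (J t) l"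
    using J(2) unfolding Q_def by blast
  from choice[OF this] obtain l where
    l: "\<forall>t. t < n \<longrightarrow> l t \<in> forms n 1 \<and> colon_trivial n (J t) (l t) d \<and> J (Suc t) = addl n (J t) (l t)" by (rule exE)
  have J0: "J 0 = I" using J(1)[of 0] by (simp add: P_def)
  have hJ: "hideal n (J t)" "elim_vars n (n - t) (J t)" if "t \<le> n" for t using J(1)[of t] that by (simp_all add: P_def)
  have sub: "t \<le> n \<Longrightarrow> I \<subseteq> J t" for t
  proof (induction t)
    case (Suc t)
    then show ?case using l addl_superset[of "J t" n "l t"] by auto
  qed (simp add: J0)
  \<comment> \<open>After n cuts no variable is left modulo \<open>J n\<close>, so forms of positive
    degree vanish there; degree 0 occurs only for d = 0, where the constants lie in I by
    assumption.\<close>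
  have "forms n e \<subseteq> J n" if e: "d \<le> e" for e
  proof
    fix p :: "'k mpol" assume p: "p \<in> forms n e"
    show "p \<in> J n"
    proof (cases "e = 0")
      case True
      then show ?thesis using d e p sub[of n] by auto
    next
      case False
      have "elim_vars n 0 (J n)" using hJ(2)[of n] by simp
      from elim_vars_forms[OF hJ(1) this _ p] obtain q where q: "q \<in> forms 0 e" "p - q \<in> J n" by auto
      have "a \<notin> ks q" for a
      proof
        assume "a \<in> ks q"
        then have "ks a \<subseteq> {}" "mdeg a = e" using q(1) by (auto simp: forms_def polys_def homog_def)
        then have "a = 0" by simp
        then show False using \<open>mdeg a = e\<close> False by simp
      qed
      then have "ks q = {}" by blast
      then have "q = 0" by simp
      then show ?thesis using q(2) by simp
    qed
  qed
  then have rc: "regchain n d l J" unfolding regchain_def using l hJ(1)[of 0] by auto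
  have "hilb n (J t) d + card (monomials (n - t) d) \<le> hilb n I d + card (monomials n d)" if d: "0 < d" and t: "t \<le> n" for t
    using t
  proof (induction t)
    case (Suc t)
    obtain e where e: "d = Suc e" using d gr0_implies_Suc by blast
    have "hilb n (J (Suc t)) (Suc e) \<le> hilb n (J t) (Suc e) + card (monomials (n - t) e)"
      using hilb_addl_le[OF hJ(1), of t "l t" "n - t" e] hJ(2)[of t] l Suc.prems by simp
    moreover have "card (monomials (n - t) (Suc e)) = card (monomials (n - Suc t) (Suc e)) + card (monomials (n - t) e)"
      using card_monomials_Suc[of "n - Suc t" e] Suc.prems by (simp add: Suc_diff_Suc)
    ultimately show ?case using Suc by (simp add: e)
  qed (simp add: J0)
  then show ?thesis using J0 rc by blast
qed

section \<open>Revlex-segments\<close>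

definition revgt :: "mon \<Rightarrow> mon \<Rightarrow> bool" where
  "revgt a b \<longleftrightarrow> (\<exists>r. lk a r < lk b r \<and> (\<forall>s>r. lk a s = lk b s))"

lemma rlex_greater_iff: "mdeg a = mdeg b \<Longrightarrow> rlex_greater a b \<longleftrightarrow> revgt a b"
  by (simp add: rlex_greater_def revgt_def)

lemma revgt_irrefl: "\<not> revgt a a"
  by (simp add: revgt_def)

lemma revgt_trans:
  assumes "revgt a b" "revgt b c" shows "revgt a c"
proof -
  obtain r where r: "lk a r < lk b r" "\<forall>s>r. lk a s = lk b s" using assms(1) unfolding revgt_def by blast
  obtain r' where r': "lk b r' < lk c r'" "\<forall>s>r'. lk b s = lk c s" using assms(2) unfolding revgt_def by blast
  have "lk a (max r r') < lk c (max r r')"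
  proof (cases r r' rule: linorder_cases)
    case less
    then show ?thesis using r(2) r'(1) by (simp add: max_def)
  next
    case equal
    then show ?thesis using r(1) r'(1) by simp
  next
    case greater
    then show ?thesis using r(1) r'(2) by (simp add: max_def)
  qed
  moreover have "\<forall>s>max r r'. lk a s = lk c s" using r(2) r'(2) by simp
  ultimately show ?thesis unfolding revgt_def by blast
qed

lemma revgt_total:
  assumes "a \<noteq> b" shows "revgt a b \<or> revgt b a"
proof -
  define D where "D = {s. lk a s \<noteq> lk b s}"
  have "D \<subseteq> ks a \<union> ks b" by (auto simp: D_def in_keys_iff)
  then have fin: "finite D" by (rule finite_subset) simp
  have "D \<noteq> {}" using assms poly_mapping_eqI[of a b] unfolding D_def by blast
  then have m: "Max D \<in> D" using fin by (rule Max_in[rotated])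
  have "lk a s = lk b s" if "Max D < s" for s
  proof (rule ccontr)
    assume "lk a s \<noteq> lk b s"
    then have "s \<in> D" by (simp add: D_def)
    then show False using Max_ge[OF fin] that by fastforce
  qed
  moreover have "lk a (Max D) < lk b (Max D) \<or> lk b (Max D) < lk a (Max D)" using m by (auto simp: D_def)
  ultimately show ?thesis unfolding revgt_def by metis
qed

lemma segment_eq: "a \<in> monomials n d \<Longrightarrow> revlex_segment n a = {b \<in> monomials n d. revgt b a \<or> b = a}"
  by (auto simp: revlex_segment_def monomials_def rlex_greater_iff)

lemma segment_psubset:
  assumes "a \<in> monomials n d" "b \<in> monomials n d" "revgt b a"
  shows "revlex_segment n b \<subset> revlex_segment n a"
proof
  show "revlex_segment n b \<subseteq> revlex_segment n a"
    unfolding segment_eq[OF assms(1)] segment_eq[OF assms(2)] using assms(3) revgt_trans by blast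
  have "a \<notin> revlex_segment n b" unfolding segment_eq[OF assms(2)]
    using assms(3) revgt_trans revgt_irrefl by blast
  moreover have "a \<in> revlex_segment n a" unfolding segment_eq[OF assms(1)] using assms(1) by simp
  ultimately show "revlex_segment n b \<noteq> revlex_segment n a" by blast
qed

lemma finite_segment: "finite (revlex_segment n a)"
  by (rule finite_subset[OF _ finite_monomials[of n "mdeg a"]]) (auto simp: revlex_segment_def)

lemma inj_on_card_segment: "inj_on (\<lambda>a. card (revlex_segment n a)) (monomials n d)"
proof (rule inj_onI, rule ccontr)
  fix a b assume ab: "a \<in> monomials n d" "b \<in> monomials n d"
    "card (revlex_segment n a) = card (revlex_segment n b)" "a \<noteq> b"
  have "card (revlex_segment n a) < card (revlex_segment n b) \<or> card (revlex_segment n b) < card (revlex_segment n a)"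
    using revgt_total[OF ab(4)] segment_psubset[OF ab(1,2)] segment_psubset[OF ab(2,1)]
      psubset_card_mono[OF finite_segment] by blast
  then show False using ab(3) by simp
qed

text \<open>Segments grow strictly along the order, so their sizes are distinct; being as many as
  the numbers in this interval, they take each value exactly once.\<close>

lemma card_segments:
  "(\<lambda>a. card (revlex_segment n a)) ` monomials n d = {1..card (monomials n d)}"
proof (rule card_subset_eq)
  show "(\<lambda>a. card (revlex_segment n a)) ` monomials n d \<subseteq> {1..card (monomials n d)}"
  proof
    fix m assume "m \<in> (\<lambda>a. card (revlex_segment n a)) ` monomials n d"
    then obtain a where a: "a \<in> monomials n d" "m = card (revlex_segment n a)" by blast
    have "m \<le> card (monomials n d)" unfolding a(2) segment_eq[OF a(1)]
      by (rule card_mono[OF finite_monomials]) blast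
    moreover have "a \<in> revlex_segment n a" unfolding segment_eq[OF a(1)] using a(1) by simp
    then have "m \<noteq> 0" unfolding a(2) using finite_segment card_0_eq by blast
    ultimately show "m \<in> {1..card (monomials n d)}" by simp
  qed
qed (simp_all add: card_image[OF inj_on_card_segment])

definition segk :: "nat \<Rightarrow> nat \<Rightarrow> nat \<Rightarrow> mon set" where
  "segk n d k = (\<Union>a \<in> {a \<in> monomials n d. card (revlex_segment n a) = k}. revlex_segment n a)"

lemma segk_0: "segk n d 0 = {}"
proof -
  have "card (revlex_segment n a) \<noteq> 0" if "a \<in> monomials n d" for a
    using card_segments[of n d] that by force
  then have e: "{a \<in> monomials n d. card (revlex_segment n a) = 0} = {}" by blast
  show ?thesis unfolding segk_def e by simp
qed

lemma segk_segment:
  assumes "0 < k" "k \<le> card (monomials n d)"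
  obtains a where "a \<in> monomials n d" "segk n d k = revlex_segment n a" "card (revlex_segment n a) = k"
proof -
  have "k \<in> (\<lambda>a. card (revlex_segment n a)) ` monomials n d" unfolding card_segments using assms by simp
  then obtain a where a: "a \<in> monomials n d" "card (revlex_segment n a) = k" by blast
  have "{a \<in> monomials n d. card (revlex_segment n a) = k} = {a}"
    using a inj_onD[OF inj_on_card_segment, of n a _ d] by blast
  then have "segk n d k = revlex_segment n a" by (simp add: segk_def)
  then show ?thesis using that a by blast
qed

lemma segk_subset: "segk n d k \<subseteq> monomials n d"
  unfolding segk_def using segment_eq by blast

lemma card_segk: "k \<le> card (monomials n d) \<Longrightarrow> card (segk n d k) = k"
proof (cases "k = 0")
  case False
  assume "k \<le> card (monomials n d)"
  then show ?thesis using segk_segment[of k n d] False by (metis neq0_conv)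
qed (simp add: segk_0)

lemma segk_up:
  assumes k: "k \<le> card (monomials n d)" and b: "b \<in> segk n d k" and b': "b' \<in> monomials n d" "revgt b' b"
  shows "b' \<in> segk n d k"
proof -
  have "0 < k" using b segk_0[of n d] by (cases "k = 0") auto
  from segk_segment[OF this k] obtain a where a: "a \<in> monomials n d" "segk n d k = revlex_segment n a" by blast
  show ?thesis using b b' revgt_trans unfolding a(2) segment_eq[OF a(1)] by blast
qed

lemma monomials_mono: "r \<le> n \<Longrightarrow> monomials r d \<subseteq> monomials n d"
  unfolding monomials_def by fastforce

text \<open>If a member b involves a variable of index at least r, every monomial in the first r
  variables has exponent 0 at the largest variable of b, so it precedes b and lies in the segment
  too.\<close>

lemma segk_cases:
  assumes k: "k \<le> card (monomials n d)" and r: "r \<le> n"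
  shows "monomials r d \<subseteq> segk n d k \<or> segk n d k \<subseteq> monomials r d"
proof (rule disjCI)
  assume "\<not> segk n d k \<subseteq> monomials r d"
  then obtain b where b: "b \<in> segk n d k" "b \<notin> monomials r d" by blast
  then have bm: "b \<in> monomials n d" using segk_subset by blast
  then obtain s where s: "s \<in> ks b" "r \<le> s" using b(2) by (auto simp: monomials_def not_less subset_iff)
  define m where "m = Max (ks b)"
  have m: "m \<in> ks b" "s \<le> m" using s(1) unfolding m_def by (auto intro: Max_in)
  show "monomials r d \<subseteq> segk n d k"
  proof
    fix a assume a: "a \<in> monomials r d"
    then have a0: "lk a t = 0" if "r \<le> t" for t using that by (force simp: monomials_def in_keys_iff)
    have "lk b t = 0" if "m < t" for t
    proof -
      have "t \<notin> ks b" using that Max_ge[of "ks b" t] unfolding m_def by fastforce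
      then show ?thesis by (simp add: in_keys_iff)
    qed
    moreover have "lk a m < lk b m" using a0[of m] m s(2) by (simp add: in_keys_iff)
    ultimately have "revgt a b" unfolding revgt_def using a0 m s(2) by (intro exI[of _ m]) auto
    then show "a \<in> segk n d k" using segk_up[OF k b(1)] a monomials_mono[OF r] by blast
  qed
qed

section \<open>Monomial ideals generated in one degree\<close>

definition upc :: "mon set \<Rightarrow> mon set" where
  "upc M = {b + c | b c. b \<in> M}"

lemma upclosed_upc: "upclosed (upc M)"
  unfolding upclosed_def
proof (intro ballI allI)
  fix a x assume "a \<in> upc M"
  then obtain b c where "a = b + c" "b \<in> M" unfolding upc_def by blast
  then have "a + x = b + (c + x)" by (simp add: add.assoc)
  then show "a + x \<in> upc M" unfolding upc_def using \<open>b \<in> M\<close> by blast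
qed

lemma upc_deg: "M \<subseteq> monomials n d \<Longrightarrow> a \<in> upc M \<Longrightarrow> d \<le> mdeg a"
  by (auto simp: upc_def monomials_def)

lemma upc_deg_eq:
  assumes "M \<subseteq> monomials n d" "mdeg a = d" shows "a \<in> upc M \<longleftrightarrow> a \<in> M"
proof
  assume "a \<in> upc M"
  then obtain b c where "a = b + c" "b \<in> M" by (auto simp: upc_def)
  moreover from this have "mdeg c = 0" using assms by (auto simp: monomials_def)
  ultimately show "a \<in> M" by simp
next
  assume "a \<in> M"
  then show "a \<in> upc M" by (force simp: upc_def intro: exI[of _ a] exI[of _ 0])
qed

text \<open>Let x_r a = b c with b in M. If x_r divides c, it is cancelled there. Otherwise it
  divides b, and c, which is not 1 by degree, contains some x_j with j < r; replacing x_r by x_j in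
  b moves up in the order, and removing x_j from c leaves a as the product.\<close>

lemma rstable_upc:
  assumes M: "M \<subseteq> monomials n d" and ne: "M \<noteq> {}"
    and up: "\<And>b b'. b \<in> M \<Longrightarrow> b' \<in> monomials n d \<Longrightarrow> revgt b' b \<Longrightarrow> b' \<in> M"
  shows "rstable n (upc M) d"
  unfolding rstable_def
proof (intro conjI allI impI)
  assume d: "d = 0"
  obtain b where b: "b \<in> M" using ne by blast
  then have "mdeg b = 0" using M d by (auto simp: monomials_def)
  then have "b = 0" by simp
  then show "0 \<in> upc M" using b by (force simp: upc_def)
next
  fix r a assume r: "r < n" and a: "ks a \<subseteq> {..r}" "d \<le> mdeg a" "sg r 1 + a \<in> upc M"
  obtain b c where bc: "sg r 1 + a = b + c" "b \<in> M" using a(3) unfolding upc_def by blast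
  have b: "mdeg b = d" "ks b \<subseteq> {..<n}" using bc(2) M by (auto simp: monomials_def)
  have "mdeg (sg r 1 + a) = mdeg (b + c)" using bc(1) by simp
  then have md: "Suc (mdeg a) = d + mdeg c" using b(1) by simp
  show "a \<in> upc M"
  proof (cases "r \<in> ks c")
    case True
    then obtain c' where "c = sg r 1 + c'" using single_le_mon by blast
    then have "sg r 1 + a = sg r 1 + (b + c')" using bc(1) by (simp add: add.left_commute)
    then have "a = b + c'" by simp
    then show ?thesis using bc(2) by (auto simp: upc_def)
  next
    case False
    have "c \<noteq> 0" using md a(2) by auto
    then have "ks c \<noteq> {}" by simp
    then obtain j where j: "j \<in> ks c" by blast
    then obtain c' where c': "c = sg j 1 + c'" using single_le_mon by blast
    have "ks (sg r 1 + a) = ks (b + c)" using bc(1) by simp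
    then have kk: "insert r (ks a) = ks b \<union> ks c" by simp
    then have "j \<in> insert r (ks a)" using j by blast
    moreover have jne: "j \<noteq> r" using j False by blast
    ultimately have "j \<in> {..r}" using a(1) by blast
    then have jr: "j < r" using jne by simp
    have "r \<in> ks b" using kk False by (metis UnE insertI1)
    then obtain b0 where b0: "b = sg r 1 + b0" using single_le_mon by blast
    define b' where "b' = sg j 1 + b0"
    have "lk b' r < lk b r" "\<forall>s>r. lk b' s = lk b s"
      using jr by (auto simp: b'_def b0 lookup_add lookup_single when_def)
    then have "revgt b' b" unfolding revgt_def by blast
    moreover have "b' \<in> monomials n d" using b b0 jr r by (auto simp: b'_def monomials_def)
    ultimately have "b' \<in> M" using up bc(2) by blast
    moreover have "sg r 1 + a = sg r 1 + (b' + c')" using bc(1) by (simp add: b0 c' b'_def ac_simps)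
    then have "a = b' + c'" by simp
    ultimately show ?thesis by (auto simp: upc_def)
  qed
qed

lemma hideal_imp_ideal:
  fixes I :: "'k::field mpol set"
  assumes I: "hideal n I" shows "ideal I (poly_ring n)"
proof -
  interpret cring "poly_ring n :: 'k mpol ring" by (rule cring_poly_ring)
  have sub: "I \<subseteq> carrier (poly_ring n)" using hidealD(1)[OF I] by (auto simp: carrier_poly_ring)
  show ?thesis
  proof (rule idealI)
    show "ring (poly_ring n :: 'k mpol ring)" by (rule ring_axioms)
    show "subgroup I (add_monoid (poly_ring n))"
    proof (rule add.subgroupI)
      show "I \<subseteq> carrier (poly_ring n)" by (rule sub)
      show "I \<noteq> {}" using hidealD(2)[OF I] by blast
      show "\<ominus>\<^bsub>poly_ring n\<^esub> p \<in> I" if p: "p \<in> I" for p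
      proof -
        have c: "p \<in> carrier (poly_ring n)" "- p \<in> carrier (poly_ring n)"
          using hidealD(1)[OF I p] by (simp_all add: carrier_poly_ring)
        have "- p \<oplus>\<^bsub>poly_ring n\<^esub> p = \<zero>\<^bsub>poly_ring n\<^esub>" by (simp add: poly_ring_def)
        then have "\<ominus>\<^bsub>poly_ring n\<^esub> p = - p" using minus_equality[OF _ c] by blast
        then show ?thesis using hidealD(6)[OF I p] by simp
      qed
      show "p \<oplus>\<^bsub>poly_ring n\<^esub> q \<in> I" if "p \<in> I" "q \<in> I" for p q
        using hidealD(3)[OF I that] by (simp add: poly_ring_def)
    qed
    show "x \<otimes>\<^bsub>poly_ring n\<^esub> a \<in> I" "a \<otimes>\<^bsub>poly_ring n\<^esub> x \<in> I" if "a \<in> I" "x \<in> carrier (poly_ring n)" for a x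
      using hidealD(4)[OF I _ that(1), of x] that(2) unfolding carrier_poly_ring
      by (simp_all add: poly_ring_def mult.commute)
  qed
qed

lemma monomial_ideal:
  fixes M :: "mon set"
  assumes M: "M \<subseteq> monomials n d"
  shows "(Idl\<^bsub>poly_ring n\<^esub> ((\<lambda>b. sg b 1) ` M) :: 'k::field mpol set) = mid n (upc M)"
proof
  have "ideal (mid n (upc M) :: 'k mpol set) (poly_ring n)"
    by (rule hideal_imp_ideal[OF hideal_mid[OF upclosed_upc]])
  moreover have "(\<lambda>b. sg b 1) ` M \<subseteq> (mid n (upc M) :: 'k mpol set)"
  proof
    fix p :: "'k mpol" assume "p \<in> (\<lambda>b. sg b 1) ` M"
    then obtain b where b: "b \<in> M" "p = sg b 1" by blast
    have "b + 0 \<in> upc M" unfolding upc_def using b(1) by blast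
    then show "p \<in> mid n (upc M)" using b M by (auto simp: mid_def monomials_def)
  qed
  ultimately show "(Idl\<^bsub>poly_ring n\<^esub> ((\<lambda>b. sg b 1) ` M) :: 'k mpol set) \<subseteq> mid n (upc M)"
    unfolding genideal_def by blast
  show "(mid n (upc M) :: 'k mpol set) \<subseteq> Idl\<^bsub>poly_ring n\<^esub> ((\<lambda>b. sg b 1) ` M)"
    unfolding genideal_def
  proof (intro subsetI InterI)
    fix p :: "'k mpol" and X :: "'k mpol set"
    assume p: "p \<in> mid n (upc M)" and "X \<in> {I. ideal I (poly_ring n) \<and> (\<lambda>b. sg b 1) ` M \<subseteq> I}"
    then have X: "ideal X (poly_ring n)" "(\<lambda>b. sg b 1) ` M \<subseteq> X" by auto
    have "sg a (lk p a) \<in> X" if a: "a \<in> ks p" for a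
    proof -
      obtain b c where bc: "a = b + c" "b \<in> M" using p a by (auto simp: mid_def upc_def)
      have "ks a \<subseteq> {..<n}" using p a by (auto simp: mid_def polys_def)
      then have "sg c (lk p a) \<in> polys n" using bc(1) by simp
      moreover have "sg b 1 \<in> X" using X(2) bc(2) by blast
      ultimately have "sg c (lk p a) * sg b 1 \<in> X" by (rule ideal_poly_ringD(3)[OF X(1)])
      then show ?thesis by (simp add: bc(1) mult_single add.commute)
    qed
    then have "A \<subseteq> ks p \<Longrightarrow> (\<Sum>a\<in>A. sg a (lk p a)) \<in> X" for A
      by (induction A rule: infinite_finite_induct) (simp_all add: ideal_poly_ringD[OF X(1)])
    from this[of "ks p"] show "p \<in> X" by (simp flip: poly_sum)
  qed
qed

lemma revlex_ideal_eq: "(revlex_ideal n d k :: 'k::field mpol set) = mid n (upc (segk n d k))"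
  unfolding revlex_ideal_def segk_def[symmetric] by (rule monomial_ideal[OF segk_subset])

lemma hilb_mid: "hilb n (mid n V :: 'k::field mpol set) d = card {a \<in> monomials n d. a \<in> V}"
proof -
  have "(mid n V \<inter> forms n d :: 'k mpol set) = monspan {a \<in> monomials n d. a \<in> V}"
    by (auto simp: mid_def forms_eq monspan_def forms_def polys_def monomials_def)
  then show ?thesis using monspan_dim(2)[of "{a \<in> monomials n d. a \<in> V}"] finite_monomials[of n d]
    by (simp add: hilb_def)
qed

lemma kdim_zero: "kdim n {0 :: 'k::field mpol} i e = 0"
proof -
  have "kcyc n {0 :: 'k mpol} i e \<subseteq> {0}" by (auto simp: kcyc_def fun_eq_iff)
  then have "kv.dim (kcyc n {0 :: 'k mpol} i e) \<le> kv.dim {0 :: nat set \<Rightarrow> 'k mpol}"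
    by (rule kv.dim_mono_fin[OF kv.fin_dim_0])
  then show ?thesis by (simp add: kdim_def kv.dim_0)
qed

lemma card_monomials_0: "monomials n 0 = {0}"
  by (auto simp: monomials_def)

lemma kdim_revlex_le:
  fixes I :: "'k::field mpol set"
  assumes K: "infinite (UNIV :: 'k set)" and I: "hideal n I" and L: "linres n d I" and k: "hilb n I d = k"
  shows "kdim n (revlex_ideal n d k :: 'k mpol set) i (i + j) \<le> kdim n I i (i + j)"
proof (cases "k = 0")
  case True
  \<comment> \<open>The zero ideal is treated apart, as an empty set of generators is not stable
    when d = 0.\<close>
  then have "(revlex_ideal n d k :: 'k mpol set) = {0}"
    by (simp add: revlex_ideal_eq segk_0 upc_def mid_empty)
  then show ?thesis by (simp add: kdim_zero)
next
  case False
  have kle: "k \<le> card (monomials n d)" using hilb_le[of n I d] k by simp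
  define M where "M = segk n d k"
  have M: "M \<subseteq> monomials n d" "card M = k" using segk_subset card_segk[OF kle] by (simp_all add: M_def)
  have Mne: "M \<noteq> {}" using M(2) False by auto
  have finM: "finite M" using M(1) finite_monomials by (rule finite_subset)
  define U where "U = upc M"
  have U: "upclosed U" unfolding U_def by (rule upclosed_upc)
  have st: "rstable n U d"
    unfolding U_def by (rule rstable_upc[OF M(1) Mne]) (use segk_up[OF kle] in \<open>auto simp: M_def\<close>)
  have I'_eq: "(revlex_ideal n d k :: 'k mpol set) = mid n U" by (simp add: revlex_ideal_eq U_def M_def)
  \<comment> \<open>For d = 0 the only monomial is 1, so a nonzero k makes I contain all
    constants.\<close>
  have d: "0 < d \<or> forms n 0 \<subseteq> I"
  proof (cases "d = 0")
    case True
    have "pv.dim (forms n 0 :: 'k mpol set) \<le> pv.dim (I \<inter> forms n 0)"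
      using k False True by (simp add: dim_forms card_monomials_0 hilb_def)
    then have "forms n 0 = I \<inter> forms n 0"
      by (rule pv.dim_eq_imp_eq[OF fin_dim_forms subspace_forms subspace_hideal[OF I] Int_lower2])
    then show ?thesis by blast
  qed simp
  obtain l J where lJ: "J 0 = I" "regchain n d l J"
    "0 < d \<longrightarrow> (\<forall>t\<le>n. hilb n (J t) d + card (monomials (n - t) d) \<le> hilb n I d + card (monomials n d))"
    using generic_regchain[OF K I linres_reg[OF I L d] d] by blast
  \<comment> \<open>The revlex ideal after the last t variables have been added.\<close>
  define J' where "J' t = (mid n (upr U (n - t)) :: 'k mpol set)" for t
  have J'0: "J' 0 = mid n U" by (simp add: J'_def mid_upr_n)
  have rc': "regchain n d (\<lambda>t. var (n - Suc t)) J'"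
    unfolding regchain_def
  proof (intro conjI allI impI)
    show "hideal n (J' 0)" unfolding J'0 by (rule hideal_mid[OF U])
    fix t assume t: "t < n"
    have S: "n - t = Suc (n - Suc t)" "n - Suc t < n" using t by auto
    show "var (n - Suc t) \<in> forms n 1" using t by simp
    show "J' (Suc t) = addl n (J' t) (var (n - Suc t))"
      unfolding J'_def S(1) by (rule addl_mid_upr[OF U S(2), symmetric])
    show "colon_trivial n (J' t) (var (n - Suc t)) d"
      unfolding J'_def S(1) by (rule colon_trivial_upr[OF st S(2)])
  next
    fix e assume "d \<le> e"
    then show "forms n e \<subseteq> J' n" unfolding J'_def using forms_mid_upr_0[OF st] by simp
  qed
  have L': "linres n d (mid n U :: 'k mpol set)"
  proof (rule reg_linres[OF hideal_mid[OF U] reg_mid[OF U st]])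
    fix e assume e: "e < d"
    have "p = 0" if p: "p \<in> mid n U" "p \<in> forms n e" for p :: "'k mpol"
    proof -
      have "a \<notin> ks p" for a
        using p e upc_deg[OF M(1), of a] by (auto simp: mid_def forms_def homog_def U_def)
      then have "ks p = {}" by blast
      then show ?thesis by simp
    qed
    then show "mid n U \<inter> forms n e = {0 :: 'k mpol}" by (auto simp: mid_def)
  qed
  have hJ': "hilb n (J' t) d = card (M \<union> (monomials n d - monomials (n - t) d))" for t
  proof -
    have "{a \<in> monomials n d. a \<in> upr U (n - t)} = M \<union> (monomials n d - monomials (n - t) d)"
    proof (rule Set.set_eqI)
      fix a
      have "(\<exists>s\<in>ks a. n - t \<le> s) \<longleftrightarrow> a \<notin> monomials (n - t) d" if "a \<in> monomials n d"
        using that by (auto simp: monomials_def not_less subset_iff)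
      moreover have "a \<in> U \<longleftrightarrow> a \<in> M" if "a \<in> monomials n d"
        unfolding U_def by (rule upc_deg_eq[OF M(1)]) (use that in \<open>simp add: monomials_def\<close>)
      ultimately show "a \<in> {a \<in> monomials n d. a \<in> upr U (n - t)} \<longleftrightarrow> a \<in> M \<union> (monomials n d - monomials (n - t) d)"
        using M(1) unfolding upr_def by blast
    qed
    then show ?thesis unfolding J'_def by (simp add: hilb_mid)
  qed
  \<comment> \<open>Any ideal is bounded by all forms and by k plus the number of monomials
    involving a killed variable. The revlex ideal attains the first bound if the segment contains
    all monomials in the first n - t variables, and the second if it lies among them.\<close>
  have pos: "hilb n (J t) d \<le> hilb n (J' t) d" if t: "t \<le> n" for t
  proof (cases "monomials (n - t) d \<subseteq> M")
    case True
    have "M \<union> (monomials n d - monomials (n - t) d) = monomials n d" using True M(1) by blast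
    then show ?thesis unfolding hJ' using hilb_le[of n "J t" d] by simp
  next
    case False
    then have sub: "M \<subseteq> monomials (n - t) d" using segk_cases[OF kle, of "n - t"] unfolding M_def by auto
    \<comment> \<open>In degree 0 the nonempty segment would be all of {1}, contrary to the case
      assumption.\<close>
    have "0 < d"
    proof (rule ccontr)
      assume "\<not> 0 < d"
      then have e: "monomials (n - t) d = {0}" by (simp add: card_monomials_0)
      then have "M = {0}" using sub Mne subset_singletonD[of M 0] by simp
      then show False using False e by simp
    qed
    then have 1: "hilb n (J t) d + card (monomials (n - t) d) \<le> k + card (monomials n d)" using lJ(3) t k by simp
    have "card (M \<union> (monomials n d - monomials (n - t) d)) = card M + card (monomials n d - monomials (n - t) d)"
      using sub finM finite_monomials[of n d] by (intro card_Un_disjoint) auto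
    also have "card (monomials n d - monomials (n - t) d) = card (monomials n d) - card (monomials (n - t) d)"
      by (rule card_Diff_subset[OF finite_monomials monomials_mono]) simp
    finally show ?thesis unfolding hJ' using 1 M(2) by simp
  qed
  have neg: "hilb n (J' 0) d \<le> hilb n (J 0) d" by (simp add: hJ' lJ(1) k M(2))
  show ?thesis
  proof (cases "j = d")
    case True
    have "kdim n (J' 0) i (i + d) \<le> kdim n (J 0) i (i + d)"
      by (rule kdim_le_of_regchains[OF lJ(2) rc' _ _ pos neg]) (simp_all add: lJ(1) L J'0 L')
    then show ?thesis unfolding I'_eq True lJ(1) J'0 .
  next
    case False
    then have "kdim n (mid n U :: 'k mpol set) i (i + j) = 0" using L' by (simp add: linres_def)
    then show ?thesis by (simp add: I'_eq)
  qed
qed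

theorem theorem4p3:
  fixes I :: "'k::field mpol set" and n d k :: nat
  assumes "infinite (UNIV :: 'k set)"
    and "k \<le> (n + d - 1) choose d"
    and "graded_ideal n I"
    and "linear_resolution n d I"
    and "betti n I 0 d = k"
  shows "\<forall>i j. betti n I i (i + j) \<ge> betti n (revlex_ideal n d k :: 'k mpol set) i (i + j)"
proof (intro allI)
  fix i j
  have I: "hideal n I" by (rule graded_ideal_imp_hideal[OF assms(3)])
  have L: "linres n d I" using assms(4) linres_betti[OF I] by blast
  \<comment> \<open>Nothing of I lies below degree d, so its whole degree d part consists of minimal
    generators and k is a value of the Hilbert function.\<close>
  have k: "hilb n I d = k" using assms(5) linres_kdim_0[OF I L] betti_kdim[OF I] by simp
  have "hideal n (revlex_ideal n d k :: 'k mpol set)"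
    unfolding revlex_ideal_eq by (rule hideal_mid[OF upclosed_upc])
  then show "betti n (revlex_ideal n d k :: 'k mpol set) i (i + j) \<le> betti n I i (i + j)"
    using kdim_revlex_le[OF assms(1) I L k, of i j] by (simp add: betti_kdim I)
qed

end
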